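(* Let $N\ge 2$, $\alpha>-1$ and $\delta\in\,]0,1[$. Let $u\in C^3_{\mathrm{loc}}(\mathbb{R}^N;\mathbb{R}^N)$ be the velocity profile, with pressure profile $q$, of a locally backward self-similar solution $(v,p)$ of the Euler equations (as defined in the context), where up to an additive constant $q$ is given from $u$ by the representation formula in the context. Assume that $$|u(y)|\lesssim |y|^{\delta},\qquad \forall |y|\gg 1 .$$ (1) If additionally there is a number $\epsilon_0$ with $0<\epsilon_0<\delta$ such that $$|u(y)|\gtrsim |y|^{\epsilon_0},\qquad \forall |y|\gg 1,$$ then necessarily $-\delta\le \alpha\le -\epsilon_0$ (i.e. for $\alpha>-1$ outside this range there are no such nontrivial profiles), and $$\int_{|y|\le L}|u(y)|^2\,\mathrm{d}y\sim L^{N-2\alpha},\qquad \forall L\gg 1 .$$ (2) If $\delta<\frac12$, $\alpha>-\frac12$, and additionally $$|u(y)|\gtrsim 1,\qquad \forall |y|\gg 1,$$ then necessarily $-\delta\le \alpha\le 0$ (i.e. for $\alpha>-\frac12$ outside this range there are no such nontrivial profiles), and $$\int_{|y|\le L}|u(y)|^2\,\mathrm{d}y\sim L^{N-2\alpha},\qquad \forall L\gg 1 .$$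
   Context: Notation: $X\lesssim Y$ means $X\le CY$ for a constant $C>0$ (independent of the point $y$, resp. of $L$); $X\gtrsim Y$ means $Y\lesssim X$; $X\sim Y$ means both. "$\forall |y|\gg1$" means for all $|y|\ge M$ for some large $M>0$, and "$\forall L\gg1$" means for all $L\ge L_0$ for some $L_0$. $B_\rho(x_0)=\{x\in\mathbb{R}^N:|x-x_0|\le\rho\}$. Repeated indices are summed over $1,\dots,N$. Euler equations: $\partial_t v+v\cdot\nabla v+\nabla p=0$, $\nabla\cdot v=0$, $v|_{t=0}=v_0$ on $\mathbb{R}^N\times[0,T[$, with $v_0\in H^s(\mathbb{R}^N)$, $s>\frac N2+1$, $v\in C([0,T[;H^s)$, and pressure given, up to a constant, by $$p(x,t)=-\frac1N|v(x,t)|^2+\mathrm{p.v.}\int_{\mathbb{R}^N}K_{ij}(x-y)v_i(y,t)v_j(y,t)\,\mathrm{d}y,\qquad K_{ij}(y)=\frac{1}{N|\mathbb{S}^{N-1}|}\,\frac{Ny_iy_j-|y|^2\delta_{ij}}{|y|^{N+2}} .$$ Locally backward self-similar solution with index $\alpha>-1$ and profiles $(u,q)$: there are $T>0$, $x_0\in\mathbb{R}^N$, $0<\rho<\infty$ and a function $d(t)$ of $t$ only such that for all $(x,t)\in B_\rho(x_0)\times\,]0,T[$, $$v(x,t)=\frac{1}{(T-t)^{\frac{\alpha}{\alpha+1}}}\,u\Big(\frac{x-x_0}{(T-t)^{\frac1{\alpha+1}}}\Big),\qquad p(x,t)=\frac{1}{(T-t)^{\frac{2\alpha}{\alpha+1}}}\,q\Big(\frac{x-x_0}{(T-t)^{\frac1{\alpha+1}}}\Big)+d(t),$$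 and $v,p$ remain regular outside $B_\rho(x_0)$. In terms of the profiles, on $\mathbb{R}^N$, $$\frac{\alpha}{\alpha+1}u+\frac1{\alpha+1}y\cdot\nabla u+u\cdot\nabla u+\nabla q=0,\qquad \mathrm{div}\,u=0 .$$ Representation formula for $q$ (up to an additive constant): for a fixed vector $A\in\mathbb{R}^N$, with $A=0$ if $\alpha>-\frac12$ and $\delta<\frac12$, $$q(y)=-\frac1N|u(y)|^2+\mathrm{p.v.}\int_{\mathbb{R}^N}K_{ij}(y-z)u_i(z)u_j(z)\,\mathrm{d}z+\bar q(y)+A\cdot y,$$ $$\bar q(y)=\begin{cases}-\int_{|z|\ge M}K_{ij}(z)u_i(z)u_j(z)\,\mathrm{d}z, & \delta\in[0,\frac12[,\\[2pt] -\int_{|z|\ge M}\big(K_{ij}(z)-y\cdot\nabla K_{ij}(z)\big)u_i(z)u_j(z)\,\mathrm{d}z, & \delta\in[\frac12,1[,\end{cases}$$ where $M>0$ is a large number such that the assumed bounds on $u$ hold for all $|y|\ge M$. The two integrals are understood combined into a single (principal value) integral, e.g. $\mathrm{p.v.}\int_{\mathbb{R}^N}\big(K_{ij}(y-z)-\mathbf 1_{\{|z|\ge M\}}K_{ij}(z)\big)u_iu_j(z)\,\mathrm{d}z$ in the first case. *)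

theory Defs
  imports "HOL-Analysis.Analysis" "HOL-Library.Landau_Symbols"
begin

section \<open>Function spaces\<close>

primrec Ck :: "nat \<Rightarrow> (real^'n \<Rightarrow> real^'m) \<Rightarrow> bool" where
  "Ck 0 f \<longleftrightarrow> continuous_on UNIV f"
| "Ck (Suc k) f \<longleftrightarrow> (\<forall>x. f differentiable (at x)) \<and>
     (\<forall>i. Ck k (\<lambda>x. frechet_derivative f (at x) (axis i 1)))"

text \<open>The Fourier transform of a square integrable function is the \<open>L\<^sup>2\<close>-limit, as
  \<open>R \<rightarrow> \<infinity>\<close>, of the Fourier integrals over the balls of radius \<open>R\<close>.  The normalising
  factor is omitted; it only changes the Sobolev norm by a constant.\<close>

definition fourier_integral :: "(real^'n \<Rightarrow> real) \<Rightarrow> real^'n \<Rightarrow> complex" where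
  "fourier_integral f \<xi> = (LINT x|lborel. cis (- (\<xi> \<bullet> x)) * complex_of_real (f x))"

definition has_fourier :: "(real^'n \<Rightarrow> real) \<Rightarrow> (real^'n \<Rightarrow> complex) \<Rightarrow> bool" where
  "has_fourier f g \<longleftrightarrow> g \<in> borel_measurable lborel \<and>
     ((\<lambda>R. \<integral>\<^sup>+\<xi>. ennreal ((cmod (g \<xi> -
          fourier_integral (\<lambda>x. indicator (cball 0 R) x * f x) \<xi>))\<^sup>2) \<partial>lborel)
        \<longlongrightarrow> 0) at_top"

definition fourier :: "(real^'n \<Rightarrow> real) \<Rightarrow> real^'n \<Rightarrow> complex" where
  "fourier f = (SOME g. has_fourier f g)"

text \<open>The square of the \<open>H\<^sup>s\<close>-norm.\<close>

definition sobolev_norm2 :: "real \<Rightarrow> (real^'n \<Rightarrow> real) \<Rightarrow> ennreal" where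
  "sobolev_norm2 s f =
     (\<integral>\<^sup>+\<xi>. ennreal ((1 + (norm \<xi>)\<^sup>2) powr s * (cmod (fourier f \<xi>))\<^sup>2) \<partial>lborel)"

definition sobolev :: "real \<Rightarrow> (real^'n \<Rightarrow> real) set" where
  "sobolev s = {f. f \<in> borel_measurable lborel \<and> integrable lborel (\<lambda>x. (f x)\<^sup>2) \<and>
                   sobolev_norm2 s f < \<infinity>}"

text \<open>\<open>v \<in> C([0,T[; H\<^sup>s)\<close>, componentwise.\<close>

definition continuous_into_sobolev ::
    "real \<Rightarrow> real \<Rightarrow> (real \<Rightarrow> real^'n \<Rightarrow> real^'n) \<Rightarrow> bool" where
  "continuous_into_sobolev s T v \<longleftrightarrow> (\<forall>t\<in>{0..<T}. \<forall>i.
     (\<lambda>x. v t x $ i) \<in> sobolev s \<and>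
     ((\<lambda>\<tau>. sobolev_norm2 s (\<lambda>x. v \<tau> x $ i - v t x $ i)) \<longlongrightarrow> 0) (at t within {0..<T}))"

section \<open>The pressure kernel\<close>

definition has_pv :: "(real^'n \<Rightarrow> real) \<Rightarrow> real^'n \<Rightarrow> real \<Rightarrow> bool" where
  "has_pv f y I \<longleftrightarrow>
     (\<forall>\<epsilon>>0. set_integrable lborel {z. \<epsilon> \<le> dist y z} f) \<and>
     ((\<lambda>\<epsilon>. LINT z:{z. \<epsilon> \<le> dist y z}|lborel. f z) \<longlongrightarrow> I) (at_right 0)"

text \<open>Surface measure of the unit sphere in dimension \<open>N\<close>.\<close>

definition sphere_area :: "nat \<Rightarrow> real" where
  "sphere_area N = real N * unit_ball_vol (real N)"

text \<open>The normalising constant \<open>\<kappa>\<close> is a parameter because two values occur for it: the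
  factor \<open>1 / (N * sphere_area N)\<close> with which the kernel is sometimes printed, and
  \<open>1 / sphere_area N\<close>, for which the kernel is the Hessian of the fundamental solution of
  the negative Laplacian away from \<open>0\<close>, as the Euler equations require.  The first arises from the second when the
  volume of the unit ball is replaced by the area of the unit sphere.\<close>

definition kernel_constants :: "nat \<Rightarrow> real set" where
  "kernel_constants N = {1 / (real N * sphere_area N), 1 / sphere_area N}"

definition K :: "real \<Rightarrow> 'n \<Rightarrow> 'n \<Rightarrow> real^'n \<Rightarrow> real" where
  "K \<kappa> i j y = \<kappa> * (real CARD('n) * (y $ i) * (y $ j) - (if i = j then (norm y)\<^sup>2 else 0))
                 / norm y ^ (CARD('n) + 2)"

section \<open>Euler solutions and self-similar solutions\<close>

definition divergence :: "(real^'n \<Rightarrow> real^'n) \<Rightarrow> real^'n \<Rightarrow> real" where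
  "divergence w x = (\<Sum>i\<in>UNIV. frechet_derivative w (at x) (axis i 1) $ i)"

text \<open>For \<open>s > N/2 + 1\<close> a solution in \<open>C([0,T[; H\<^sup>s)\<close> is classical, so the equations are
  stated pointwise, for the continuous representative.  The convective term is the
  derivative of the velocity in its own direction; the time derivative at \<open>t = 0\<close> is
  one-sided.  The initial datum is \<open>v 0\<close>.\<close>

definition euler_solution ::
    "real \<Rightarrow> real \<Rightarrow> real \<Rightarrow> (real \<Rightarrow> real^'n \<Rightarrow> real^'n) \<Rightarrow> (real \<Rightarrow> real^'n \<Rightarrow> real) \<Rightarrow> bool" where
  "euler_solution \<kappa> s T v p \<longleftrightarrow>
     0 < T \<and> real CARD('n) / 2 + 1 < s \<and> continuous_into_sobolev s T v \<and>
     (\<forall>t\<in>{0..<T}. \<forall>x.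
        v t differentiable (at x) \<and> divergence (v t) x = 0 \<and>
        (\<exists>vt gp. ((\<lambda>\<tau>. v \<tau> x) has_vector_derivative vt) (at t within {0..<T}) \<and>
                 GDERIV (p t) x :> gp \<and>
                 vt + frechet_derivative (v t) (at x) (v t x) + gp = 0)) \<and>
     (\<forall>t\<in>{0..<T}. \<exists>c. \<forall>x.
        has_pv (\<lambda>y. \<Sum>i\<in>UNIV. \<Sum>j\<in>UNIV. K \<kappa> i j (x - y) * (v t y $ i) * (v t y $ j)) x
          (p t x + (norm (v t x))\<^sup>2 / real CARD('n) + c))"

text \<open>\<open>v\<close>, \<open>p\<close> and their spatial gradients extend continuously up to the time \<open>T\<close> on the
  set \<open>S\<close>.  The pressure is only meaningful up to a function of time, hence \<open>e\<close>.\<close>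

definition remains_regular ::
    "real \<Rightarrow> (real^'n) set \<Rightarrow> (real \<Rightarrow> real^'n \<Rightarrow> real^'n) \<Rightarrow> (real \<Rightarrow> real^'n \<Rightarrow> real) \<Rightarrow> bool" where
  "remains_regular T S v p \<longleftrightarrow> (\<exists>w \<pi> e.
     (\<forall>t\<in>{0<..<T}. \<forall>x\<in>S. w t x = v t x \<and> \<pi> t x = p t x + e t) \<and>
     (\<forall>t\<in>{0<..T}. \<forall>x\<in>S. w t differentiable (at x) \<and> \<pi> t differentiable (at x)) \<and>
     continuous_on ({0<..T} \<times> S) (\<lambda>(t, x). w t x) \<and>
     continuous_on ({0<..T} \<times> S) (\<lambda>(t, x). \<pi> t x) \<and>
     (\<forall>h. continuous_on ({0<..T} \<times> S) (\<lambda>(t, x). frechet_derivative (w t) (at x) h)) \<and>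
     (\<forall>h. continuous_on ({0<..T} \<times> S) (\<lambda>(t, x). frechet_derivative (\<pi> t) (at x) h)))"

text \<open>The profile equations are not listed: they follow from the Euler equations by letting
  \<open>t\<close> tend to \<open>T\<close>, since the rescaled balls exhaust the space.\<close>

definition locally_self_similar ::
    "real \<Rightarrow> real \<Rightarrow> (real^'n \<Rightarrow> real^'n) \<Rightarrow> (real^'n \<Rightarrow> real) \<Rightarrow>
     (real \<Rightarrow> real^'n \<Rightarrow> real^'n) \<Rightarrow> (real \<Rightarrow> real^'n \<Rightarrow> real) \<Rightarrow> bool" where
  "locally_self_similar \<kappa> \<alpha> u q v p \<longleftrightarrow> (\<exists>s T x0 \<rho> d.
     euler_solution \<kappa> s T v p \<and> 0 < \<rho> \<and>
     (\<forall>t\<in>{0<..<T}. \<forall>x\<in>cball x0 \<rho>.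
        v t x = (1 / (T - t) powr (\<alpha> / (\<alpha> + 1))) *\<^sub>R
                  u ((1 / (T - t) powr (1 / (\<alpha> + 1))) *\<^sub>R (x - x0)) \<and>
        p t x = (1 / (T - t) powr (2 * \<alpha> / (\<alpha> + 1))) *
                  q ((1 / (T - t) powr (1 / (\<alpha> + 1))) *\<^sub>R (x - x0)) + d t) \<and>
     remains_regular T (- cball x0 \<rho>) v p)"

section \<open>Representation of the pressure profile\<close>

text \<open>The far-field correction: Taylor polynomial in \<open>y\<close> at \<open>0\<close> of \<open>K (y - z)\<close>, of degree
  \<open>0\<close> or \<open>1\<close>; recall that \<open>K\<close> is even.\<close>

definition far_kernel :: "real \<Rightarrow> real \<Rightarrow> 'n \<Rightarrow> 'n \<Rightarrow> real^'n \<Rightarrow> real^'n \<Rightarrow> real" where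
  "far_kernel \<kappa> \<delta> i j y z =
     (if \<delta> < 1/2 then K \<kappa> i j z
      else K \<kappa> i j z - frechet_derivative (K \<kappa> i j) (at z) y)"

text \<open>Neither integral need converge at infinity by itself, so they are combined into one.
  Changing \<open>M\<close> only changes \<open>c\<close> (and, if \<open>\<delta> \<ge> 1/2\<close>, also \<open>A\<close>), so any \<open>M > 0\<close> may be used
  here.\<close>

definition pressure_representation ::
    "real \<Rightarrow> real \<Rightarrow> real \<Rightarrow> (real^'n \<Rightarrow> real^'n) \<Rightarrow> (real^'n \<Rightarrow> real) \<Rightarrow> bool" where
  "pressure_representation \<kappa> \<alpha> \<delta> u q \<longleftrightarrow> (\<exists>M c A. 0 < M \<and>
     (\<alpha> > -1/2 \<and> \<delta> < 1/2 \<longrightarrow> A = 0) \<and>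
     (\<forall>y. \<exists>I.
        has_pv (\<lambda>z. \<Sum>i\<in>UNIV. \<Sum>j\<in>UNIV.
            (K \<kappa> i j (y - z) - indicator {z. M \<le> norm z} z * far_kernel \<kappa> \<delta> i j y z)
              * (u z $ i) * (u z $ j)) y I \<and>
        q y = - (norm (u y))\<^sup>2 / real CARD('n) + I + A \<bullet> y + c))"

end

theory Submission
  imports Defs
begin

text \<open>
  Everything is read off the profile equation
  \<open>\<alpha> u + y \<cdot> \<nabla>u + (1 + \<alpha>) (u \<cdot> \<nabla>u + \<nabla>q) = 0\<close>.  Put
  \<open>\<phi>(x) = (max 0 (1 - |x|\<^sup>2))\<^sup>2\<close>, \<open>e(l) = l\<^bsup>2\<alpha>-N\<^esup> \<integral> |u|\<^sup>2 \<phi>(y/l) dy\<close>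
  and \<open>E(l) = \<integral>\<^bsub>|y| \<le> l\<^esub> |u|\<^sup>2\<close>.  Testing the profile equation with \<open>u \<phi>(y/l)\<close> gives
  \<open>e'(l) = (1+\<alpha>) l\<^bsup>2\<alpha>-N-2\<^esup> \<integral> (\<nabla>\<phi>)(y/l) \<cdot> u (|u|\<^sup>2 + 2q) dy\<close>, where constants
  in \<open>q\<close> do not contribute because \<open>u\<close> is divergence free.  On \<open>|y| \<le> l\<close> the pressure
  splits into a singular integral of \<open>u\<^sub>i u\<^sub>j 1\<^bsub>{|z| \<le> 2l}\<^esub>\<close>, controlled in
  \<open>L\<^sup>2\<close>, a constant, a linear function, and a far field controlled by the decay of the
  Taylor remainder of the kernel.

  If \<open>E(l) \<lesssim> l\<^bsup>N+2\<gamma>\<^esup>\<close> with \<open>\<gamma> \<le> \<delta>\<close>, this yields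
  \<open>|e'(l)| \<lesssim> l\<^bsup>2(\<alpha>+\<gamma>)-1-4\<eta>\<^esup>\<close> for some fixed \<open>\<eta> > 0\<close>.  Starting from
  \<open>\<gamma> = \<delta>\<close> and integrating from \<open>1\<close> to \<open>l\<close>, the exponent \<open>\<gamma>\<close> can be lowered step
  by step until \<open>e\<close> is bounded, that is, until \<open>\<gamma> = -\<alpha>\<close>.  Then \<open>e\<close> has a limit.  If
  the limit vanished, integrating from \<open>l\<close> to \<open>\<infinity>\<close> would lower \<open>\<gamma>\<close> further, beyond
  what the lower bound on \<open>u\<close> permits; so the limit is positive and
  \<open>E(l) \<sim> l\<^bsup>N-2\<alpha>\<^esup>\<close>.  Comparing with the pointwise bounds on \<open>u\<close> confines \<open>\<alpha>\<close>.
\<close>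

section \<open>Translations, convolutions and tails\<close>

text \<open>Every term of the flux is measured against \<open>l^(N+2+2\<gamma>)\<close>, and the
  gain has two separate sources. In the cubic terms, where the local pressure counts as
  \<open>|u|^2\<close>, one factor is estimated by its supremum, of order \<open>l^\<delta>\<close>,
  and the other two by the energy; this gives \<open>l^(1+\<delta>) l^(N+2\<gamma>)\<close>, short
  of the reference size by \<open>l^(1-\<delta>)\<close>. A pressure of linear growth contributes
  \<open>l^2\<close> times the integral of \<open>|u|\<close>, of order
  \<open>l^(N+2+\<gamma>)\<close>, and gains only \<open>l^(-\<gamma>)\<close>. Such terms come from
  the vector \<open>A\<close> and from the first-order Taylor correction. They force \<gamma> to
  stay away from 0 in part (1), which the positive exponent of the lower bound guarantees; in part
  (2) both are absent and the exponent 0 is allowed.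

  The pressure is needed only in \<open>L2\<close>, because its partner \<open>u\<close> is bounded
  pointwise on the ball. The \<open>L2\<close> bound for the singular integral is obtained by
  integrating by parts against a smoothed kernel instead of by Fourier transform. It is uniform in
  the truncation and so passes to the principal value by Fatou's lemma.\<close>

lemma distr_lborel_reflect:
  fixes c :: "'a::euclidean_space"
  shows "distr lborel borel (\<lambda>z. c - z) = lborel"
  using lborel_affine[of "-1" c] by (simp add: density_1)

lemma distr_lborel_shift:
  fixes c :: "'a::euclidean_space"
  shows "distr lborel borel (\<lambda>z. z + c) = lborel"
  using lborel_distr_plus[of c] by (simp add: add.commute[of _ c])

lemma nn_integral_lborel_reflect:
  fixes f :: "'a::euclidean_space \<Rightarrow> ennreal"
  assumes "f \<in> borel_measurable borel"
  shows "(\<integral>\<^sup>+z. f (c - z) \<partial>lborel) = (\<integral>\<^sup>+z. f z \<partial>lborel)"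
  using assms by (subst distr_lborel_reflect[of c, symmetric]) (simp add: nn_integral_distr)

lemma nn_integral_lborel_shift:
  fixes f :: "'a::euclidean_space \<Rightarrow> ennreal"
  assumes "f \<in> borel_measurable borel"
  shows "(\<integral>\<^sup>+z. f (z + c) \<partial>lborel) = (\<integral>\<^sup>+z. f z \<partial>lborel)"
  using assms by (subst distr_lborel_shift[of c, symmetric]) (simp add: nn_integral_distr)

lemma nn_integral_lborel_shift_minus:
  fixes f :: "'a::euclidean_space \<Rightarrow> ennreal"
  assumes "f \<in> borel_measurable borel"
  shows "(\<integral>\<^sup>+z. f (z - c) \<partial>lborel) = (\<integral>\<^sup>+z. f z \<partial>lborel)"
  using nn_integral_lborel_shift[OF assms, of "-c"] by simp

lemma integral_lborel_shift:
  fixes f :: "'a::euclidean_space \<Rightarrow> real"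
  assumes "f \<in> borel_measurable borel"
  shows "(LINT z|lborel. f (z + c)) = (LINT z|lborel. f z)"
  using assms by (subst (2) distr_lborel_shift[of c, symmetric]) (simp add: integral_distr)

lemma integrable_lborel_shift:
  fixes f :: "'a::euclidean_space \<Rightarrow> real"
  assumes "f \<in> borel_measurable borel"
  shows "integrable lborel (\<lambda>z. f (z + c)) \<longleftrightarrow> integrable lborel f"
  using assms by (subst (2) distr_lborel_shift[of c, symmetric]) (simp add: integrable_distr_eq)

text \<open>Translation invariance gives \<open>\<integral> (F (x + e) - F x) = 0\<close>, and the difference is the mean
  of the derivative over the segment.\<close>

lemma integral_directional_derivative_eq_0:
  fixes F f :: "'a::euclidean_space \<Rightarrow> real"
  assumes der: "\<And>x. ((\<lambda>t. F (x + t *\<^sub>R e)) has_real_derivative f x) (at 0)"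
    and cont: "continuous_on UNIV f"
    and F: "integrable lborel F" and f: "integrable lborel f"
  shows "(LINT x|lborel. f x) = 0"
proof -
  have [measurable]: "f \<in> borel_measurable borel"
    using cont by (rule borel_measurable_continuous_onI)
  have [measurable]: "F \<in> borel_measurable borel"
    using F by (simp add: borel_measurable_integrable)
  define g where "g = (\<lambda>(x, t::real). f (x + t *\<^sub>R e) * indicator {0..1} t)"
  have [measurable]: "g \<in> borel_measurable (lborel \<Otimes>\<^sub>M lborel)"
    unfolding g_def split_beta by measurable
  have FTC: "(LINT t|lborel. g (x, t)) = F (x + e) - F x" for x
  proof -
    have "((\<lambda>t. F (x + t *\<^sub>R e)) has_real_derivative f (x + t *\<^sub>R e)) (at t)" for t
      using der[of "x + t *\<^sub>R e"] DERIV_shift[of "\<lambda>t. F (x + t *\<^sub>R e)" "f (x + t *\<^sub>R e)" 0 t]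
      by (simp add: algebra_simps)
    moreover have "isCont (\<lambda>t. f (x + t *\<^sub>R e)) t" for t
    proof -
      have "continuous_on UNIV (\<lambda>t. f (x + t *\<^sub>R e))"
        by (intro continuous_on_compose2[OF cont] continuous_intros) auto
      then show ?thesis by (simp add: continuous_on_eq_continuous_at)
    qed
    ultimately show ?thesis
      unfolding g_def using integral_FTC_Icc_real[of 0 1 "\<lambda>t. F (x + t *\<^sub>R e)" "\<lambda>t. f (x + t *\<^sub>R e)"]
      by simp
  qed
  have int_g: "integrable (lborel \<Otimes>\<^sub>M lborel) g"
  proof (rule integrableI_bounded)
    have "(\<integral>\<^sup>+w. norm (g w) \<partial>(lborel \<Otimes>\<^sub>M lborel)) = (\<integral>\<^sup>+t. \<integral>\<^sup>+x. norm (g (x, t)) \<partial>lborel \<partial>lborel)"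
      by (rule lborel_pair.nn_integral_snd[symmetric]) simp
    also have "\<dots> = (\<integral>\<^sup>+t. (\<integral>\<^sup>+x. norm (f x) \<partial>lborel) * indicator {0..1} (t::real) \<partial>lborel)"
    proof (intro nn_integral_cong)
      fix t :: real
      have "(\<integral>\<^sup>+x. norm (g (x, t)) \<partial>lborel) = (\<integral>\<^sup>+x. ennreal (norm (f (x + t *\<^sub>R e))) * indicator {0..1} t \<partial>lborel)"
        by (intro nn_integral_cong) (simp add: g_def abs_mult indicator_def)
      also have "\<dots> = (\<integral>\<^sup>+x. ennreal (norm (f (x + t *\<^sub>R e))) \<partial>lborel) * indicator {0..1} t"
        by (rule nn_integral_multc) simp
      also have "(\<integral>\<^sup>+x. ennreal (norm (f (x + t *\<^sub>R e))) \<partial>lborel) = (\<integral>\<^sup>+x. ennreal (norm (f x)) \<partial>lborel)"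
        by (rule nn_integral_lborel_shift[of "\<lambda>x. ennreal (norm (f x))"]) simp
      finally show "(\<integral>\<^sup>+x. norm (g (x, t)) \<partial>lborel) = (\<integral>\<^sup>+x. norm (f x) \<partial>lborel) * indicator {0..1} t" .
    qed
    also have "\<dots> = (\<integral>\<^sup>+x. norm (f x) \<partial>lborel)"
      by (simp add: nn_integral_cmult)
    also have "\<dots> < \<infinity>" using f by (simp add: integrable_iff_bounded)
    finally show "(\<integral>\<^sup>+w. norm (g w) \<partial>(lborel \<Otimes>\<^sub>M lborel)) < \<infinity>" .
  qed simp
  have "0 = (LINT x|lborel. F (x + e) - F x)"
    using F by (simp add: integrable_lborel_shift integral_lborel_shift Bochner_Integration.integral_diff)
  also have "\<dots> = (LINT x|lborel. LINT t|lborel. g (x, t))"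
    by (simp add: FTC)
  also have "\<dots> = (LINT t|lborel. LINT x|lborel. g (x, t))"
    using lborel_pair.Fubini_integral[of "\<lambda>x t. g (x, t)"] int_g by simp
  also have "\<dots> = (LINT t|lborel. (LINT x|lborel. f x) * indicator {0..1} (t::real))"
    by (intro Bochner_Integration.integral_cong) (simp_all add: g_def integral_lborel_shift)
  also have "\<dots> = (LINT x|lborel. f x)" by simp
  finally show ?thesis by simp
qed

text \<open>Young's inequality for the convolution of \<open>L1\<close> with \<open>L2\<close>.
  Splitting \<open>a\<close> into \<open>sqrt a * sqrt a\<close> lets Cauchy-Schwarz leave one full
  copy of \<open>a\<close> beside \<open>b^2\<close>; Tonelli and translation invariance integrate
  that copy.\<close>

lemma nn_integral_convolution_square_le:
  fixes a b :: "'a::euclidean_space \<Rightarrow> real"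
  assumes [measurable]: "a \<in> borel_measurable borel" "b \<in> borel_measurable borel"
    and a: "\<And>x. 0 \<le> a x" and b: "\<And>x. 0 \<le> b x"
  shows "(\<integral>\<^sup>+x. (\<integral>\<^sup>+z. ennreal (a (x - z) * b z) \<partial>lborel)\<^sup>2 \<partial>lborel)
     \<le> (\<integral>\<^sup>+x. ennreal (a x) \<partial>lborel)\<^sup>2 * (\<integral>\<^sup>+z. ennreal ((b z)\<^sup>2) \<partial>lborel)"
proof -
  let ?A = "\<integral>\<^sup>+x. ennreal (a x) \<partial>lborel"
  have "(\<integral>\<^sup>+z. ennreal (a (x - z) * b z) \<partial>lborel)\<^sup>2
      \<le> ?A * (\<integral>\<^sup>+z. ennreal (a (x - z)) * ennreal ((b z)\<^sup>2) \<partial>lborel)" for x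
  proof -
    have "(\<integral>\<^sup>+z. ennreal (a (x - z) * b z) \<partial>lborel)
       = (\<integral>\<^sup>+z. ennreal (sqrt (a (x - z))) * ennreal (sqrt (a (x - z)) * b z) \<partial>lborel)"
      by (intro nn_integral_cong) (simp add: a b ennreal_mult[symmetric] flip: mult.assoc)
    also have "\<dots>\<^sup>2 \<le> (\<integral>\<^sup>+z. (ennreal (sqrt (a (x - z))))\<^sup>2 \<partial>lborel)
        * (\<integral>\<^sup>+z. (ennreal (sqrt (a (x - z)) * b z))\<^sup>2 \<partial>lborel)"
      by (rule Cauchy_Schwarz_nn_integral) simp_all
    also have "(\<integral>\<^sup>+z. (ennreal (sqrt (a (x - z))))\<^sup>2 \<partial>lborel) = (\<integral>\<^sup>+z. ennreal (a (x - z)) \<partial>lborel)"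
      by (simp add: ennreal_power a)
    also have "\<dots> = ?A"
      using nn_integral_lborel_reflect[of "\<lambda>x. ennreal (a x)" x] by simp
    also have "(\<integral>\<^sup>+z. (ennreal (sqrt (a (x - z)) * b z))\<^sup>2 \<partial>lborel)
        = (\<integral>\<^sup>+z. ennreal (a (x - z)) * ennreal ((b z)\<^sup>2) \<partial>lborel)"
      by (simp add: ennreal_power a b power_mult_distrib ennreal_mult)
    finally show ?thesis .
  qed
  then have "(\<integral>\<^sup>+x. (\<integral>\<^sup>+z. ennreal (a (x - z) * b z) \<partial>lborel)\<^sup>2 \<partial>lborel)
     \<le> (\<integral>\<^sup>+x. ?A * (\<integral>\<^sup>+z. ennreal (a (x - z)) * ennreal ((b z)\<^sup>2) \<partial>lborel) \<partial>lborel)"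
    by (intro nn_integral_mono)
  also have "\<dots> = ?A * (\<integral>\<^sup>+x. \<integral>\<^sup>+z. ennreal (a (x - z)) * ennreal ((b z)\<^sup>2) \<partial>lborel \<partial>lborel)"
    by (rule nn_integral_cmult) measurable
  also have "(\<integral>\<^sup>+x. \<integral>\<^sup>+z. ennreal (a (x - z)) * ennreal ((b z)\<^sup>2) \<partial>lborel \<partial>lborel)
     = (\<integral>\<^sup>+z. \<integral>\<^sup>+x. ennreal (a (x - z)) * ennreal ((b z)\<^sup>2) \<partial>lborel \<partial>lborel)"
    by (rule lborel_pair.Fubini'[symmetric]) (unfold split_beta, measurable)
  also have "\<dots> = (\<integral>\<^sup>+z. ?A * ennreal ((b z)\<^sup>2) \<partial>lborel)"
    by (intro nn_integral_cong)
       (simp add: nn_integral_multc nn_integral_lborel_shift_minus[of "\<lambda>x. ennreal (a x)"])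
  also have "\<dots> = ?A * (\<integral>\<^sup>+z. ennreal ((b z)\<^sup>2) \<partial>lborel)"
    by (rule nn_integral_cmult) measurable
  finally show ?thesis by (simp add: power2_eq_square mult.assoc)
qed

section \<open>Layer-cake estimates for tails of negative powers\<close>

lemma measurable_cball [measurable]:
  fixes c :: "'a::metric_space"
  shows "cball c r \<in> sets borel"
  by simp

lemma borel_norm_ge [measurable]:
  "{x::'a::real_normed_vector. r \<le> norm x} \<in> sets borel"
  by (intro borel_closed closed_Collect_le continuous_intros)

text \<open>The weight \<open>|z|^(-p')\<close> is the integral of
  \<open>p' * r powr (-p' - 1)\<close> over \<open>r \<ge> norm z\<close>. Exchanging the integrals
  replaces the weight by ball integrals of \<open>f\<close>, whose growth is known, and the constant
  is the integral of \<open>C * p' * r powr (p - p' - 1)\<close> over \<open>r \<ge> R\<close>.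
  Applied with \<open>f = 1\<close> to volumes and with \<open>f = |u|^2\<close> to the far
  field.\<close>

lemma nn_integral_powr_tail:
  fixes f :: "'a::euclidean_space \<Rightarrow> ennreal"
  assumes [measurable]: "f \<in> borel_measurable borel"
    and R: "0 < R" and C: "0 \<le> C" and p: "p < p'" "0 < p'"
    and growth: "\<And>r. R \<le> r \<Longrightarrow> (\<integral>\<^sup>+z. f z * indicator (cball 0 r) z \<partial>lborel) \<le> ennreal (C * r powr p)"
  shows "(\<integral>\<^sup>+z. ennreal (norm z powr (-p')) * f z * indicator {z. R \<le> norm z} z \<partial>lborel)
     \<le> ennreal (C * p' / (p' - p) * R powr (p - p'))"
proof -
  have cake: "ennreal (s powr (-k)) = (\<integral>\<^sup>+r. ennreal (k * r powr (-k - 1)) * indicator {s..} r \<partial>lborel)"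
    if s: "0 < s" and k: "0 < k" for s k :: real
  proof -
    have "((\<lambda>r. - (r powr (-k))) \<longlongrightarrow> - 0) at_top"
      using k by (intro tendsto_minus tendsto_neg_powr filterlim_ident) auto
    moreover have "((\<lambda>r. - (r powr (-k))) has_real_derivative k * r powr (-k - 1)) (at r)" if "s \<le> r" for r
      using that s by (auto intro!: derivative_eq_intros)
    ultimately have "(\<integral>\<^sup>+r. ennreal (k * r powr (-k - 1)) * indicator {s..} r \<partial>lborel)
        = ennreal (- 0 - (- (s powr (-k))))"
      using k by (intro nn_integral_FTC_atLeast) auto
    then show ?thesis by simp
  qed
  let ?g = "\<lambda>z r. ennreal (p' * r powr (-p' - 1)) * indicator {norm z..} r * f z * indicator {z. R \<le> norm z} z"
  have [measurable]: "(\<lambda>(z, r). ?g z r) \<in> borel_measurable (lborel \<Otimes>\<^sub>M lborel)"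
  proof -
    have "(\<lambda>(z::'a, r). ?g z r) = (\<lambda>w. ennreal (p' * snd w powr (-p' - 1))
        * indicator {w. norm (fst w) \<le> snd w} w * f (fst w) * indicator {z. R \<le> norm z} (fst w))"
      by (auto simp: fun_eq_iff indicator_def)
    also have "\<dots> \<in> borel_measurable (lborel \<Otimes>\<^sub>M lborel)"
      by measurable
    finally show ?thesis .
  qed
  have "(\<integral>\<^sup>+z. ennreal (norm z powr (-p')) * f z * indicator {z. R \<le> norm z} z \<partial>lborel)
     = (\<integral>\<^sup>+z. \<integral>\<^sup>+r. ?g z r \<partial>lborel \<partial>lborel)"
  proof (intro nn_integral_cong)
    fix z :: 'a
    have "(\<integral>\<^sup>+r. ?g z r \<partial>lborel) = (\<integral>\<^sup>+r. ennreal (p' * r powr (-p' - 1)) * indicator {norm z..} r \<partial>lborel)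
        * (f z * indicator {z. R \<le> norm z} z)"
      by (subst nn_integral_multc[symmetric]) (simp_all add: mult.assoc)
    also have "\<dots> = ennreal (norm z powr (-p')) * f z * indicator {z. R \<le> norm z} z"
    proof (cases "R \<le> norm z")
      case True
      then show ?thesis using cake[OF less_le_trans[OF R True] p(2)] by simp
    qed simp
    finally show "ennreal (norm z powr (-p')) * f z * indicator {z. R \<le> norm z} z = (\<integral>\<^sup>+r. ?g z r \<partial>lborel)" ..
  qed
  also have "\<dots> = (\<integral>\<^sup>+r. \<integral>\<^sup>+z. ?g z r \<partial>lborel \<partial>lborel)"
    by (rule lborel_pair.Fubini'[symmetric]) measurable
  also have "\<dots> \<le> (\<integral>\<^sup>+r. ennreal (C * p' / (p' - p)) * (ennreal ((p' - p) * r powr (-(p' - p) - 1)) * indicator {R..} r) \<partial>lborel)"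
  proof (intro nn_integral_mono)
    fix r :: real
    show "(\<integral>\<^sup>+z. ?g z r \<partial>lborel) \<le> ennreal (C * p' / (p' - p)) * (ennreal ((p' - p) * r powr (-(p' - p) - 1)) * indicator {R..} r)"
    proof (cases "R \<le> r")
      case False
      then have "(\<integral>\<^sup>+z. ?g z r \<partial>lborel) = (\<integral>\<^sup>+(z::'a). 0 \<partial>lborel)"
        by (intro nn_integral_cong) (auto simp: indicator_def)
      then show ?thesis by simp
    next
      case True
      have "(\<integral>\<^sup>+z. ?g z r \<partial>lborel) \<le> (\<integral>\<^sup>+z. ennreal (p' * r powr (-p' - 1)) * (f z * indicator (cball 0 r) z) \<partial>lborel)"
        by (intro nn_integral_mono) (auto simp: indicator_def)
      also have "\<dots> = ennreal (p' * r powr (-p' - 1)) * (\<integral>\<^sup>+z. f z * indicator (cball 0 r) z \<partial>lborel)"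
        by (rule nn_integral_cmult) measurable
      also have "\<dots> \<le> ennreal (p' * r powr (-p' - 1)) * ennreal (C * r powr p)"
        using growth[OF True] by (intro mult_left_mono) auto
      also have "\<dots> = ennreal (C * p' * (r powr (-p' - 1) * r powr p))"
        using p C by (simp add: ennreal_mult[symmetric] mult_ac)
      also have "r powr (-p' - 1) * r powr p = r powr (-(p' - p) - 1)"
        by (simp add: powr_add[symmetric] algebra_simps)
      also have "ennreal (C * p' * r powr (-(p' - p) - 1)) = ennreal (C * p' / (p' - p)) * ennreal ((p' - p) * r powr (-(p' - p) - 1))"
        using p C by (simp add: ennreal_mult[symmetric])
      finally show ?thesis using True by simp
    qed
  qed
  also have "\<dots> = ennreal (C * p' / (p' - p)) * ennreal (R powr (-(p' - p)))"
    using cake[of R "p' - p"] R p by (simp add: nn_integral_cmult)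
  also have "\<dots> = ennreal (C * p' / (p' - p) * R powr (p - p'))"
    using p C by (simp add: ennreal_mult[symmetric])
  finally show ?thesis .
qed

text \<open>Near 0 the term \<open>\<epsilon>^2\<close> keeps the base away from 0; outside the unit
  ball the tail estimate with \<open>f = 1\<close> applies, since balls have volume of order
  \<open>r^N\<close>. The condition on \<open>p\<close> is the convergence threshold there.\<close>

lemma integrable_norm_powr_add:
  fixes x :: "'a::euclidean_space"
  assumes \<epsilon>: "0 < \<epsilon>" and p: "real DIM('a) < 2 * p"
  shows "integrable lborel (\<lambda>x::'a. ((norm x)\<^sup>2 + \<epsilon>\<^sup>2) powr (-p))"
proof (rule integrableI_bounded)
  have p0: "0 < p" using p by linarith
  let ?V = "unit_ball_vol (real DIM('a))"
  have "(\<integral>\<^sup>+(x::'a). norm (((norm x)\<^sup>2 + \<epsilon>\<^sup>2) powr (-p)) \<partial>lborel)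
     \<le> (\<integral>\<^sup>+(x::'a). ennreal ((\<epsilon>\<^sup>2) powr (-p)) * indicator (cball 0 1) x +
            ennreal (norm x powr (-(2 * p))) * 1 * indicator {x. 1 \<le> norm x} x \<partial>lborel)"
  proof (intro nn_integral_mono)
    fix x :: 'a
    show "ennreal (norm (((norm x)\<^sup>2 + \<epsilon>\<^sup>2) powr (-p))) \<le> ennreal ((\<epsilon>\<^sup>2) powr (-p)) * indicator (cball 0 1) x +
            ennreal (norm x powr (-(2 * p))) * 1 * indicator {x. 1 \<le> norm x} x"
    proof (cases "1 \<le> norm x")
      case True
      have "((norm x)\<^sup>2 + \<epsilon>\<^sup>2) powr (-p) \<le> ((norm x)\<^sup>2) powr (-p)"
        using True p0 by (intro powr_mono2') auto
      also have "\<dots> = norm x powr (-(2 * p))"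
        using True by (simp add: powr_powr flip: powr_numeral)
      finally show ?thesis using True by (simp add: add_increasing)
    next
      case False
      have "((norm x)\<^sup>2 + \<epsilon>\<^sup>2) powr (-p) \<le> (\<epsilon>\<^sup>2) powr (-p)"
        using \<epsilon> p0 by (intro powr_mono2') auto
      then show ?thesis using False by (simp add: ennreal_leI)
    qed
  qed
  also have "\<dots> = (\<integral>\<^sup>+(x::'a). ennreal ((\<epsilon>\<^sup>2) powr (-p)) * indicator (cball 0 1) x \<partial>lborel) +
     (\<integral>\<^sup>+(x::'a). ennreal (norm x powr (-(2 * p))) * 1 * indicator {x. 1 \<le> norm x} x \<partial>lborel)"
    by (rule nn_integral_add) measurable
  also have "\<dots> \<le> ennreal ((\<epsilon>\<^sup>2) powr (-p)) * ennreal ?V + ennreal (?V * (2 * p) / (2 * p - DIM('a)) * 1 powr (DIM('a) - 2 * p))"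
  proof (intro add_mono)
    show "(\<integral>\<^sup>+(x::'a). ennreal ((\<epsilon>\<^sup>2) powr (-p)) * indicator (cball 0 1) x \<partial>lborel) \<le> ennreal ((\<epsilon>\<^sup>2) powr (-p)) * ennreal ?V"
      using emeasure_cball[of 1 "0::'a"] by (subst nn_integral_cmult) simp_all
    have V: "(\<integral>\<^sup>+(z::'a). 1 * indicator (cball 0 r) z \<partial>lborel) \<le> ennreal (?V * r powr real DIM('a))" if "1 \<le> r" for r
      using that emeasure_cball[of r "0::'a"] by (simp add: powr_realpow)
    show "(\<integral>\<^sup>+(x::'a). ennreal (norm x powr (-(2 * p))) * 1 * indicator {x. 1 \<le> norm x} x \<partial>lborel)
       \<le> ennreal (?V * (2 * p) / (2 * p - DIM('a)) * 1 powr (DIM('a) - 2 * p))"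
      using p p0 by (intro nn_integral_powr_tail[where f = "\<lambda>_. 1" and R = 1 and C = ?V and p = "real DIM('a)" and p' = "2 * p"] V) auto
  qed
  also have "\<dots> < \<infinity>" by (simp add: ennreal_mult_less_top)
  finally show "(\<integral>\<^sup>+(x::'a). norm (((norm x)\<^sup>2 + \<epsilon>\<^sup>2) powr (-p)) \<partial>lborel) < \<infinity>" .
qed measurable

section \<open>Inner products of convolutions\<close>

lemma integrable_bounded_mult:
  fixes f g :: "'a \<Rightarrow> real"
  assumes "integrable M f" "g \<in> borel_measurable M" "\<And>x. \<bar>g x\<bar> \<le> B"
  shows "integrable M (\<lambda>x. g x * f x)"
proof (rule Bochner_Integration.integrable_bound[of M "\<lambda>x. B * f x"])
  show "AE x in M. norm (g x * f x) \<le> norm (B * f x)"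
    using assms(3) by (intro AE_I2) (simp add: abs_mult mult_right_mono order_trans[OF _ abs_ge_self])
qed (use assms in auto)

lemma integral_fst_snd_mult:
  fixes f g :: "'a::euclidean_space \<Rightarrow> real"
  assumes f: "integrable lborel f" and g: "integrable lborel g"
  shows "integrable lborel (\<lambda>w. f (fst w) * g (snd w))"
    and "(LINT w|lborel. f (fst w) * g (snd w)) = (LINT z|lborel. f z) * (LINT z|lborel. g z)"
proof -
  have [measurable]: "f \<in> borel_measurable borel" "g \<in> borel_measurable borel"
    using f g by (simp_all add: borel_measurable_integrable)
  have 1: "integrable (lborel \<Otimes>\<^sub>M lborel) (\<lambda>w. f (fst w) * g (snd w))"
  proof (rule integrableI_bounded)
    have "(\<integral>\<^sup>+w. norm (f (fst w) * g (snd w)) \<partial>(lborel \<Otimes>\<^sub>M lborel))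
       = (\<integral>\<^sup>+z. \<integral>\<^sup>+z'. norm (f z) * norm (g z') \<partial>lborel \<partial>lborel)"
      by (subst lborel.nn_integral_fst[symmetric]) (auto simp: abs_mult)
    also have "\<dots> = (\<integral>\<^sup>+z. norm (f z) \<partial>lborel) * (\<integral>\<^sup>+z. norm (g z) \<partial>lborel)"
      by (simp add: ennreal_mult nn_integral_cmult nn_integral_multc)
    also have "\<dots> < \<infinity>"
      using f g by (simp add: integrable_iff_bounded ennreal_mult_less_top)
    finally show "(\<integral>\<^sup>+w. norm (f (fst w) * g (snd w)) \<partial>(lborel \<Otimes>\<^sub>M lborel)) < \<infinity>" .
  qed measurable
  then show "integrable lborel (\<lambda>w. f (fst w) * g (snd w))"
    by (simp add: lborel_prod)
  show "(LINT w|lborel. f (fst w) * g (snd w)) = (LINT z|lborel. f z) * (LINT z|lborel. g z)"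
    using lborel_pair.integral_fst'[OF 1] by (simp add: lborel_prod)
qed

text \<open>On the right the kernels enter only through their correlation, the integral of
  \<open>a (x - z) * b (x - z')\<close> over \<open>x\<close>. An identity between correlations of
  kernels therefore passes to the convolutions; \<open>kker_inner_swap\<close> is used in this
  way.\<close>

lemma integral_convolution_mult:
  fixes a b f g :: "'a::euclidean_space \<Rightarrow> real"
  assumes a[measurable]: "a \<in> borel_measurable borel" and b[measurable]: "b \<in> borel_measurable borel"
    and bd: "\<And>x. \<bar>a x\<bar> \<le> B" "\<And>x. \<bar>b x\<bar> \<le> B"
    and a2: "integrable lborel (\<lambda>x. (a x)\<^sup>2)" and b2: "integrable lborel (\<lambda>x. (b x)\<^sup>2)"
    and f: "integrable lborel f" and g: "integrable lborel g"
  shows "integrable lborel (\<lambda>x. (LINT z|lborel. a (x - z) * f z) * (LINT z|lborel. b (x - z) * g z))"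
    and "(LINT x|lborel. (LINT z|lborel. a (x - z) * f z) * (LINT z|lborel. b (x - z) * g z))
       = (LINT w|lborel. (LINT x|lborel. a (x - fst w) * b (x - snd w)) * (f (fst w) * g (snd w)))"
proof -
  have [measurable]: "f \<in> borel_measurable borel" "g \<in> borel_measurable borel"
    using f g by (simp_all add: borel_measurable_integrable)
  let ?H = "\<lambda>x w. a (x - fst w) * b (x - snd w) * (f (fst w) * g (snd w))"
  let ?A = "\<integral>\<^sup>+x. ennreal ((a x)\<^sup>2) \<partial>lborel" and ?B = "\<integral>\<^sup>+x. ennreal ((b x)\<^sup>2) \<partial>lborel"
  have meas[measurable]: "(\<lambda>y. ?H (fst y) (snd y)) \<in> borel_measurable (lborel \<Otimes>\<^sub>M (lborel \<Otimes>\<^sub>M lborel))"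
    by measurable
  have H: "integrable (lborel \<Otimes>\<^sub>M lborel) (\<lambda>(x, w). ?H x w)"
  proof (rule integrableI_bounded)
    show m: "(\<lambda>(x, w). ?H x w) \<in> borel_measurable (lborel \<Otimes>\<^sub>M lborel)"
      using meas by (simp add: split_beta lborel_prod)
    have "(\<integral>\<^sup>+y. norm (case y of (x, w) \<Rightarrow> ?H x w) \<partial>(lborel \<Otimes>\<^sub>M lborel))
       = (\<integral>\<^sup>+w. \<integral>\<^sup>+x. norm (?H x w) \<partial>lborel \<partial>lborel)"
      using m by (subst lborel_pair.nn_integral_snd[symmetric]) auto
    also have "\<dots> \<le> (\<integral>\<^sup>+w. ennreal (norm (f (fst w) * g (snd w))) * (?A + ?B) \<partial>lborel)"
    proof (intro nn_integral_mono)
      fix w :: "'a \<times> 'a"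
      have "(\<integral>\<^sup>+x. norm (?H x w) \<partial>lborel) \<le> (\<integral>\<^sup>+x. ennreal (norm (f (fst w) * g (snd w))) *
          (ennreal ((a (x - fst w))\<^sup>2) + ennreal ((b (x - snd w))\<^sup>2)) \<partial>lborel)"
      proof (intro nn_integral_mono)
        fix x
        \<comment> \<open>This separates the two shifts. Translation invariance then removes each of
          them, so the integral over \<open>x\<close> is bounded independently of
          \<open>w\<close>.\<close>
        have "\<bar>a (x - fst w)\<bar> * \<bar>b (x - snd w)\<bar> \<le> (a (x - fst w))\<^sup>2 + (b (x - snd w))\<^sup>2"
        proof -
          have "s * t \<le> s\<^sup>2 + t\<^sup>2" if "0 \<le> s" "0 \<le> t" for s t :: real
            using sum_squares_bound[of s t] that mult_nonneg_nonneg[OF that] by linarith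
          from this[of "\<bar>a (x - fst w)\<bar>" "\<bar>b (x - snd w)\<bar>"] show ?thesis by simp
        qed
        from mult_left_mono[OF this, of "norm (f (fst w) * g (snd w))"]
        show "ennreal (norm (?H x w)) \<le> ennreal (norm (f (fst w) * g (snd w))) *
          (ennreal ((a (x - fst w))\<^sup>2) + ennreal ((b (x - snd w))\<^sup>2))"
          by (simp add: abs_mult mult_ac flip: ennreal_mult ennreal_plus)
      qed
      also have "\<dots> = ennreal (norm (f (fst w) * g (snd w))) * (?A + ?B)"
        by (simp add: nn_integral_cmult nn_integral_add nn_integral_lborel_shift_minus[of "\<lambda>x. ennreal ((a x)\<^sup>2)"]
              nn_integral_lborel_shift_minus[of "\<lambda>x. ennreal ((b x)\<^sup>2)"])
      finally show "(\<integral>\<^sup>+x. norm (?H x w) \<partial>lborel) \<le> ennreal (norm (f (fst w) * g (snd w))) * (?A + ?B)" .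
    qed
    also have "\<dots> = (\<integral>\<^sup>+w. ennreal (norm (f (fst w) * g (snd w))) \<partial>lborel) * (?A + ?B)"
      by (intro nn_integral_multc) (simp flip: lborel_prod)
    also have "\<dots> < \<infinity>"
      using integral_fst_snd_mult(1)[OF f g] a2 b2
      by (simp add: integrable_iff_bounded ennreal_mult_less_top ennreal_add_less_top)
    finally show "(\<integral>\<^sup>+y. norm (case y of (x, w) \<Rightarrow> ?H x w) \<partial>(lborel \<Otimes>\<^sub>M lborel)) < \<infinity>" .
  qed
  have split: "(LINT w|lborel. ?H x w) = (LINT z|lborel. a (x - z) * f z) * (LINT z|lborel. b (x - z) * g z)" for x
  proof -
    have "integrable lborel (\<lambda>z. a (x - z) * f z)" "integrable lborel (\<lambda>z. b (x - z) * g z)"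
      by (intro integrable_bounded_mult[where B=B] f g bd; measurable)+
    from integral_fst_snd_mult(2)[OF this] show ?thesis by (simp add: mult_ac)
  qed
  show "integrable lborel (\<lambda>x. (LINT z|lborel. a (x - z) * f z) * (LINT z|lborel. b (x - z) * g z))"
    using lborel_pair.integrable_fst[OF H] by (simp add: split)
  show "(LINT x|lborel. (LINT z|lborel. a (x - z) * f z) * (LINT z|lborel. b (x - z) * g z))
       = (LINT w|lborel. (LINT x|lborel. a (x - fst w) * b (x - snd w)) * (f (fst w) * g (snd w)))"
    using lborel_pair.Fubini_integral[of ?H, OF H] by (simp add: split)
qed

section \<open>The regularised kernel\<close>

definition regsq :: "real \<Rightarrow> real^'n \<Rightarrow> real" where
  "regsq \<epsilon> x = (norm x)\<^sup>2 + \<epsilon>\<^sup>2"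

text \<open>A component of a gradient: for \<open>N > 2\<close> of
  \<open>regsq powr (1 - N/2) / (2 - N)\<close>, for \<open>N = 2\<close> of half the logarithm of
  \<open>regsq\<close>. Starting from the gradient treats all dimensions alike. \<open>kker\<close>
  and \<open>tker\<close> are the first and second derivatives of \<open>hker\<close>, hence second
  and third derivatives of this potential.\<close>

definition hker :: "real \<Rightarrow> 'n \<Rightarrow> real^'n \<Rightarrow> real" where
  "hker \<epsilon> j x = x $ j * regsq \<epsilon> x powr (- real CARD('n) / 2)"

definition kker :: "real \<Rightarrow> 'n \<Rightarrow> 'n \<Rightarrow> real^'n \<Rightarrow> real" where
  "kker \<epsilon> i j x = of_bool (i = j) * regsq \<epsilon> x powr (- real CARD('n) / 2)
     - real CARD('n) * x $ i * x $ j * regsq \<epsilon> x powr (- real CARD('n) / 2 - 1)"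

definition tker :: "real \<Rightarrow> 'n \<Rightarrow> 'n \<Rightarrow> 'n \<Rightarrow> real^'n \<Rightarrow> real" where
  "tker \<epsilon> l i j x =
     - real CARD('n) * (of_bool (i = j) * x $ l + of_bool (i = l) * x $ j + of_bool (j = l) * x $ i)
         * regsq \<epsilon> x powr (- real CARD('n) / 2 - 1)
     + real CARD('n) * (real CARD('n) + 2) * x $ i * x $ j * x $ l
         * regsq \<epsilon> x powr (- real CARD('n) / 2 - 2)"

section \<open>Derivatives, symmetry and decay of the regularised kernels\<close>

lemma regsq_pos: "0 < \<epsilon> \<Longrightarrow> 0 < regsq \<epsilon> x"
  by (simp add: regsq_def add_nonneg_pos)

lemma regsq_axis: "regsq \<epsilon> (x + t *\<^sub>R axis i 1) = regsq \<epsilon> x + 2 * t * x $ i + t\<^sup>2"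
  unfolding regsq_def power2_norm_eq_inner
  by (simp add: inner_add_left inner_add_right inner_axis inner_axis' inner_axis_axis power2_eq_square algebra_simps)

lemma nth_add_axis: "(x + t *\<^sub>R axis i (1::real)) $ j = x $ j + t * of_bool (i = j)"
  by (simp add: axis_def)

lemma regsq_ge: "(norm x)\<^sup>2 \<le> regsq \<epsilon> x" "\<epsilon>\<^sup>2 \<le> regsq \<epsilon> x"
  by (simp_all add: regsq_def)

lemma nth_le_regsq: "\<bar>x $ j\<bar> \<le> regsq \<epsilon> x powr (1/2)"
proof -
  have "\<bar>x $ j\<bar> \<le> sqrt ((norm x)\<^sup>2)" using component_le_norm_cart[of x j] by simp
  also have "\<dots> \<le> sqrt (regsq \<epsilon> x)" using regsq_ge(1) by (rule real_sqrt_le_mono)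
  finally show ?thesis by (simp add: powr_half_sqrt regsq_def)
qed

lemma regsq_powr_deriv:
  assumes "0 < \<epsilon>"
  shows "((\<lambda>t. regsq \<epsilon> (x + t *\<^sub>R axis i 1) powr p) has_real_derivative
            2 * p * x $ i * regsq \<epsilon> x powr (p - 1)) (at 0)"
proof -
  have "((\<lambda>t. regsq \<epsilon> x + 2 * t * x $ i + t\<^sup>2) has_real_derivative 2 * x $ i) (at 0)"
    by (auto intro!: derivative_eq_intros)
  from DERIV_powr[OF this, of "\<lambda>_. p" 0] show ?thesis
    using regsq_pos[OF assms, of x] by (simp add: regsq_axis powr_diff mult_ac)
qed

lemma nth_add_axis_deriv:
  "((\<lambda>t. (x + t *\<^sub>R axis i (1::real)) $ j) has_real_derivative of_bool (i = j)) (at 0)"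
  unfolding nth_add_axis by (auto intro!: derivative_eq_intros)

lemma hker_deriv:
  assumes "0 < \<epsilon>"
  shows "((\<lambda>t. hker \<epsilon> j (x + t *\<^sub>R axis i 1)) has_real_derivative kker \<epsilon> i j x) (at 0)"
  unfolding hker_def kker_def
  by (rule DERIV_cong[OF DERIV_mult[OF nth_add_axis_deriv regsq_powr_deriv[OF assms]]]) simp

lemma kker_deriv:
  fixes x :: "real^'n"
  assumes "0 < \<epsilon>"
  shows "((\<lambda>t. kker \<epsilon> i j (x + t *\<^sub>R axis l 1)) has_real_derivative tker \<epsilon> l i j x) (at 0)"
proof -
  let ?n = "real CARD('n)"
  have e: "- ?n / 2 - 1 - 1 = - ?n / 2 - 2" by simp
  define P where "P = regsq \<epsilon> x powr (- ?n / 2 - 1)"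
  define Q where "Q = regsq \<epsilon> x powr (- ?n / 2 - 2)"
  note d = regsq_powr_deriv[OF assms, of x l] and c = nth_add_axis_deriv[of x l]
  show ?thesis
    unfolding kker_def
  proof (rule DERIV_cong[OF DERIV_diff[OF DERIV_cmult[OF d] DERIV_mult[OF DERIV_mult[OF DERIV_cmult[OF c] c] d]]])
    show "of_bool (i = j) * (2 * (- ?n / 2) * x $ l * regsq \<epsilon> x powr (- ?n / 2 - 1)) -
      ((?n * of_bool (l = i) * (x + 0 *\<^sub>R axis l 1) $ j + of_bool (l = j) * (?n * (x + 0 *\<^sub>R axis l 1) $ i)) *
        regsq \<epsilon> (x + 0 *\<^sub>R axis l 1) powr (- ?n / 2 - 1) +
       2 * (- ?n / 2 - 1) * x $ l * regsq \<epsilon> x powr (- ?n / 2 - 1 - 1) *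
        (?n * (x + 0 *\<^sub>R axis l 1) $ i * (x + 0 *\<^sub>R axis l 1) $ j)) = tker \<epsilon> l i j x"
      unfolding tker_def e scaleR_zero_left add_0_right P_def[symmetric] Q_def[symmetric]
      by (cases "i = j"; cases "l = i"; cases "l = j") (simp_all add: algebra_simps)
  qed
qed

text \<open>Third partial derivatives of one potential commute. This links the two integrations by
  parts in \<open>kker_inner_swap\<close>.\<close>

lemma tker_sym: "tker \<epsilon> i i j x = tker \<epsilon> j i i x"
  by (auto simp: tker_def)

lemma continuous_regsq_powr:
  assumes "0 < \<epsilon>"
  shows "continuous_on UNIV (\<lambda>x. regsq \<epsilon> x powr p)"
proof (rule continuous_on_powr)
  show "continuous_on UNIV (regsq \<epsilon> :: real^'n \<Rightarrow> real)"
    unfolding regsq_def[abs_def] by (intro continuous_on_add continuous_on_power continuous_on_norm continuous_on_id continuous_on_const)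
  show "\<forall>x\<in>UNIV. regsq \<epsilon> x \<noteq> 0"
    using regsq_pos[OF assms] by (metis less_irrefl)
qed (rule continuous_on_const)

lemmas continuous_kernel_intros = continuous_on_mult continuous_on_add continuous_on_diff
  continuous_on_const continuous_on_component continuous_on_id continuous_regsq_powr

lemma continuous_hker: "0 < \<epsilon> \<Longrightarrow> continuous_on UNIV (hker \<epsilon> j)"
  unfolding hker_def[abs_def] by (intro continuous_kernel_intros)

lemma continuous_kker: "0 < \<epsilon> \<Longrightarrow> continuous_on UNIV (kker \<epsilon> i j)"
  unfolding kker_def[abs_def] by (intro continuous_kernel_intros)

lemma continuous_tker: "0 < \<epsilon> \<Longrightarrow> continuous_on UNIV (tker \<epsilon> l i j)"
  unfolding tker_def[abs_def] by (intro continuous_kernel_intros)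

text \<open>Each derivative costs half a power of \<open>regsq\<close>, since a component of
  \<open>x\<close> is at most its square root. The three kernels are thus bounded at infinity by
  multiples of \<open>|x|^(1-N)\<close>, \<open>|x|^(-N)\<close> and
  \<open>|x|^(-N-1)\<close>.\<close>

lemma hker_bound:
  fixes x :: "real^'n"
  assumes "0 < \<epsilon>"
  shows "\<bar>hker \<epsilon> j x\<bar> \<le> regsq \<epsilon> x powr (- (real CARD('n) / 2 - 1/2))"
proof -
  have "\<bar>hker \<epsilon> j x\<bar> \<le> regsq \<epsilon> x powr (1/2) * regsq \<epsilon> x powr (- real CARD('n) / 2)"
    unfolding hker_def abs_mult using nth_le_regsq[of x j \<epsilon>] by (intro mult_mono) auto
  then show ?thesis by (simp add: powr_add[symmetric])
qed

lemma kker_bound: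
  fixes x :: "real^'n"
  assumes "0 < \<epsilon>"
  shows "\<bar>kker \<epsilon> i j x\<bar> \<le> (1 + real CARD('n)) * regsq \<epsilon> x powr (- (real CARD('n) / 2))"
proof -
  let ?s = "regsq \<epsilon> x" and ?n = "real CARD('n)"
  have s: "0 < ?s" using assms by (rule regsq_pos)
  have "\<bar>?n * x $ i * x $ j * ?s powr (- ?n / 2 - 1)\<bar> = ?n * (\<bar>x $ i\<bar> * \<bar>x $ j\<bar>) * ?s powr (- ?n / 2 - 1)"
    by (simp add: abs_mult)
  also have "\<dots> \<le> ?n * (?s powr (1/2) * ?s powr (1/2)) * ?s powr (- ?n / 2 - 1)"
    by (intro mult_right_mono mult_left_mono mult_mono nth_le_regsq) auto
  also have "\<dots> = ?n * ?s powr (- (?n / 2))"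
  proof -
    have "?s powr (1/2) * ?s powr (1/2) * ?s powr (- ?n / 2 - 1) = ?s powr (1/2 + 1/2 + (- ?n / 2 - 1))"
      by (simp only: powr_add)
    then show ?thesis by (simp add: mult.assoc)
  qed
  finally have "\<bar>?n * x $ i * x $ j * ?s powr (- ?n / 2 - 1)\<bar> \<le> ?n * ?s powr (- (?n / 2))" .
  moreover have "\<bar>of_bool (i = j) * ?s powr (- ?n / 2)\<bar> \<le> ?s powr (- (?n / 2))"
    by simp
  ultimately show ?thesis
    unfolding kker_def by (simp only: ring_distribs mult_1)
qed

lemma tker_bound:
  fixes x :: "real^'n"
  assumes "0 < \<epsilon>"
  shows "\<bar>tker \<epsilon> l i j x\<bar> \<le> (3 * real CARD('n) + real CARD('n) * (real CARD('n) + 2))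
            * regsq \<epsilon> x powr (- (real CARD('n) / 2 + 1/2))"
proof -
  let ?s = "regsq \<epsilon> x" and ?n = "real CARD('n)"
  have s: "0 < ?s" using assms by (rule regsq_pos)
  let ?r = "?s powr (1/2)"
  have r: "\<bar>x $ a\<bar> \<le> ?r" for a by (rule nth_le_regsq)
  have "\<bar>of_bool (i = j) * x $ l + of_bool (i = l) * x $ j + of_bool (j = l) * x $ i\<bar> \<le> 3 * ?r"
    using r[of i] r[of j] r[of l] by (auto simp: of_bool_def)
  then have 1: "\<bar>- ?n * (of_bool (i = j) * x $ l + of_bool (i = l) * x $ j + of_bool (j = l) * x $ i)
         * ?s powr (- ?n / 2 - 1)\<bar> \<le> ?n * (3 * ?r) * ?s powr (- ?n / 2 - 1)"
    unfolding abs_mult by (intro mult_mono) auto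
  have 2: "\<bar>?n * (?n + 2) * x $ i * x $ j * x $ l * ?s powr (- ?n / 2 - 2)\<bar>
     \<le> ?n * (?n + 2) * ?r * ?r * ?r * ?s powr (- ?n / 2 - 2)"
    unfolding abs_mult by (intro mult_mono r mult_nonneg_nonneg) auto
  have "?r * ?s powr (- ?n / 2 - 1) = ?s powr (1/2 + (- ?n / 2 - 1))"
    by (simp only: powr_add)
  also have "1/2 + (- ?n / 2 - 1) = - (?n / 2 + 1/2)" by simp
  finally have P: "?r * ?s powr (- ?n / 2 - 1) = ?s powr (- (?n / 2 + 1/2))" .
  have "?r * ?r * ?r * ?s powr (- ?n / 2 - 2) = ?s powr (1/2 + 1/2 + 1/2 + (- ?n / 2 - 2))"
    by (simp only: powr_add)
  also have "1/2 + 1/2 + 1/2 + (- ?n / 2 - 2) = - (?n / 2 + 1/2)" by simp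
  finally have Q: "?r * ?r * ?r * ?s powr (- ?n / 2 - 2) = ?s powr (- (?n / 2 + 1/2))" .
  have 1: "\<bar>- ?n * (of_bool (i = j) * x $ l + of_bool (i = l) * x $ j + of_bool (j = l) * x $ i)
         * ?s powr (- ?n / 2 - 1)\<bar> \<le> 3 * ?n * ?s powr (- (?n / 2 + 1/2))"
    using 1 unfolding P[symmetric] by (simp only: mult_ac)
  have 2: "\<bar>?n * (?n + 2) * x $ i * x $ j * x $ l * ?s powr (- ?n / 2 - 2)\<bar>
     \<le> ?n * (?n + 2) * ?s powr (- (?n / 2 + 1/2))"
    using 2 unfolding Q[symmetric] by (simp only: mult_ac)
  show ?thesis
    using abs_triangle_ineq[of "- ?n * (of_bool (i = j) * x $ l + of_bool (i = l) * x $ j + of_bool (j = l) * x $ i)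
         * ?s powr (- ?n / 2 - 1)" "?n * (?n + 2) * x $ i * x $ j * x $ l * ?s powr (- ?n / 2 - 2)"] 1 2
    unfolding tker_def by (simp only: distrib_right)
qed

text \<open>Two powers with different centres are both replaced by the power of the smaller base,
  which is one of the two. The product is then dominated by a sum of two translates of a single
  integrable function.\<close>

lemma integrable_shifted_product:
  fixes f g :: "real^'n \<Rightarrow> real"
  assumes \<epsilon>: "0 < \<epsilon>" and "continuous_on UNIV f" "continuous_on UNIV g"
    and f: "\<And>x. \<bar>f x\<bar> \<le> A * regsq \<epsilon> x powr (-p)" and g: "\<And>x. \<bar>g x\<bar> \<le> B * regsq \<epsilon> x powr (-q)"
    and pq: "0 \<le> p" "0 \<le> q" "real CARD('n) < 2 * (p + q)"
  shows "integrable lborel (\<lambda>x. f (x - z) * g (x - z'))"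
proof -
  let ?s = "\<lambda>x::real^'n. regsq \<epsilon> x powr (- (p + q))"
  have [measurable]: "f \<in> borel_measurable borel" "g \<in> borel_measurable borel"
    using assms by (auto intro: borel_measurable_continuous_onI)
  have int: "integrable lborel (\<lambda>x. ?s (x - w))" for w
  proof -
    have "integrable lborel ?s"
      unfolding regsq_def using integrable_norm_powr_add[where 'a="real^'n", OF \<epsilon>, of "p + q"] pq by simp
    moreover have "?s \<in> borel_measurable borel"
      by (intro borel_measurable_continuous_onI continuous_regsq_powr \<epsilon>)
    ultimately show ?thesis using integrable_lborel_shift[of ?s "-w"] by simp
  qed
  have A: "0 \<le> A" using order_trans[OF abs_ge_zero f[of 0]] regsq_pos[OF \<epsilon>, of "0::real^'n"]
    by (auto simp: zero_le_mult_iff)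
  have B: "0 \<le> B" using order_trans[OF abs_ge_zero g[of 0]] regsq_pos[OF \<epsilon>, of "0::real^'n"]
    by (auto simp: zero_le_mult_iff)
  have prod: "a powr (-p) * b powr (-q) \<le> a powr (- (p + q)) + b powr (- (p + q))" if "0 < a" "0 < b" for a b :: real
  proof -
    have "a powr (-p) * b powr (-q) \<le> min a b powr (-p) * min a b powr (-q)"
      using that pq by (intro mult_mono powr_mono2') auto
    also have "\<dots> = min a b powr (- (p + q))"
      using that by (simp add: powr_add[symmetric])
    also have "\<dots> \<le> a powr (- (p + q)) + b powr (- (p + q))"
      by (auto simp: min_def)
    finally show ?thesis .
  qed
  show ?thesis
  proof (rule Bochner_Integration.integrable_bound)
    show "integrable lborel (\<lambda>x. A * B * (?s (x - z) + ?s (x - z')))"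
      using int by simp
    show "AE x in lborel. norm (f (x - z) * g (x - z')) \<le> norm (A * B * (?s (x - z) + ?s (x - z')))"
    proof (intro AE_I2)
      fix x
      have "norm (f (x - z) * g (x - z')) \<le> (A * regsq \<epsilon> (x - z) powr (-p)) * (B * regsq \<epsilon> (x - z') powr (-q))"
        unfolding real_norm_def abs_mult using A by (intro mult_mono f g) auto
      also have "\<dots> = A * B * (regsq \<epsilon> (x - z) powr (-p) * regsq \<epsilon> (x - z') powr (-q))"
        by simp
      also have "\<dots> \<le> A * B * (?s (x - z) + ?s (x - z'))"
        using A B regsq_pos[OF \<epsilon>] by (intro mult_left_mono prod) auto
      finally show "norm (f (x - z) * g (x - z')) \<le> norm (A * B * (?s (x - z) + ?s (x - z')))"
        by simp
    qed
  qed measurable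
qed

text \<open>Both sides are \<open>- \<integral> h\<^sub>j \<partial>\<^sub>i\<partial>\<^sub>j h\<^sub>i\<close>, after moving one derivative off \<open>h\<^sub>j\<close>.\<close>

lemma kker_inner_swap:
  fixes z z' :: "real^'n"
  assumes \<epsilon>: "0 < \<epsilon>" and n: "2 \<le> CARD('n)"
  shows "(LINT x|lborel. kker \<epsilon> i j (x - z) * kker \<epsilon> i j (x - z'))
       = (LINT x|lborel. kker \<epsilon> j j (x - z) * kker \<epsilon> i i (x - z'))"
proof -
  let ?n = "real CARD('n)"
  have n2: "2 \<le> ?n" using n by simp
  note cont = continuous_hker[OF \<epsilon>] continuous_kker[OF \<epsilon>] continuous_tker[OF \<epsilon>]
  note conts = continuous_on_compose2[OF cont(1)] continuous_on_compose2[OF cont(2)] continuous_on_compose2[OF cont(3)]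
  have kk: "integrable lborel (\<lambda>x. kker \<epsilon> a b (x - z) * kker \<epsilon> c d (x - z'))" for a b c d :: 'n
    using n2 by (intro integrable_shifted_product[OF \<epsilon> _ _ kker_bound[OF \<epsilon>] kker_bound[OF \<epsilon>]] cont) auto
  \<comment> \<open>The slowest decay among the three products: the bound is of order
    \<open>|x|^(1-2N)\<close>, integrable at infinity exactly when \<open>N > 1\<close>. Here the
    dimension must be at least two.\<close>
  have hk: "integrable lborel (\<lambda>x. hker \<epsilon> a (x - z) * kker \<epsilon> c d (x - z'))" for a c d :: 'n
    using n2 by (intro integrable_shifted_product[OF \<epsilon>, of _ _ 1, OF _ _ _ kker_bound[OF \<epsilon>]] cont)
      (auto intro!: hker_bound \<epsilon>)
  have ht: "integrable lborel (\<lambda>x. hker \<epsilon> a (x - z) * tker \<epsilon> b c d (x - z'))" for a b c d :: 'n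
    using n2 by (intro integrable_shifted_product[OF \<epsilon>, of _ _ 1, OF _ _ _ tker_bound[OF \<epsilon>]] cont)
      (auto intro!: hker_bound \<epsilon>)
  have ibp: "(LINT x|lborel. kker \<epsilon> l a (x - z) * kker \<epsilon> c d (x - z')) +
      (LINT x|lborel. hker \<epsilon> a (x - z) * tker \<epsilon> l c d (x - z')) = 0" for l a c d :: 'n
  proof -
    have "(LINT x|lborel. kker \<epsilon> l a (x - z) * kker \<epsilon> c d (x - z') + hker \<epsilon> a (x - z) * tker \<epsilon> l c d (x - z')) = 0"
    proof (rule integral_directional_derivative_eq_0[where e = "axis l 1"])
      show "((\<lambda>t. hker \<epsilon> a (x + t *\<^sub>R axis l 1 - z) * kker \<epsilon> c d (x + t *\<^sub>R axis l 1 - z')) has_real_derivative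
          kker \<epsilon> l a (x - z) * kker \<epsilon> c d (x - z') + hker \<epsilon> a (x - z) * tker \<epsilon> l c d (x - z')) (at 0)" for x
        using DERIV_mult[OF hker_deriv[OF \<epsilon>, of a "x - z" l] kker_deriv[OF \<epsilon>, of c d "x - z'" l]]
        by (simp add: algebra_simps)
      show "continuous_on UNIV (\<lambda>x. kker \<epsilon> l a (x - z) * kker \<epsilon> c d (x - z') + hker \<epsilon> a (x - z) * tker \<epsilon> l c d (x - z'))"
        by (intro continuous_intros conts) auto
    qed (use kk hk ht in auto)
    then show ?thesis using kk ht by simp
  qed
  from ibp[of i j i j] ibp[of j j i i] show ?thesis by (simp add: tker_sym[of \<epsilon> i j])
qed

section \<open>The truncated singular integral in mean square\<close>

text \<open>The leading terms cancel because the unregularised potential is harmonic away from 0.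
  What remains is a bump of width \<epsilon> whose integral does not depend on \<epsilon>.\<close>

lemma sum_kker:
  fixes x :: "real^'n"
  assumes "0 < \<epsilon>"
  shows "(\<Sum>i\<in>UNIV. kker \<epsilon> i i x) = real CARD('n) * \<epsilon>\<^sup>2 * regsq \<epsilon> x powr (- (real CARD('n) / 2) - 1)"
proof -
  let ?n = "real CARD('n)" and ?s = "regsq \<epsilon> x"
  have "(\<Sum>i\<in>UNIV. kker \<epsilon> i i x) = ?n * ?s powr (- (?n / 2)) - ?n * (\<Sum>i\<in>UNIV. x $ i * x $ i) * ?s powr (- (?n / 2) - 1)"
    unfolding kker_def by (simp add: sum_subtractf sum_distrib_left sum_distrib_right mult_ac)
  also have "(\<Sum>i\<in>UNIV. x $ i * x $ i) = ?s - \<epsilon>\<^sup>2"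
    by (simp add: regsq_def power2_norm_eq_inner inner_vec_def)
  also have "?s powr (- (?n / 2)) = ?s * ?s powr (- (?n / 2) - 1)"
    using regsq_pos[OF assms, of x] powr_add[of ?s 1 "- (?n / 2) - 1"] by simp
  finally show ?thesis by (simp add: algebra_simps)
qed

text \<open>This is \<open>\<epsilon>^(-N) \<Phi>(x/\<epsilon>)\<close> with
  \<open>\<Phi> = min 1 (|x|^(-N-2))\<close>, so its integral does not depend on \<epsilon>. Up to
  constant factors it dominates both the trace of \<open>kker\<close> and the error between sharp
  truncation and smooth regularisation of the kernel.\<close>

definition majorant :: "real \<Rightarrow> real^'n \<Rightarrow> real" where
  "majorant \<epsilon> x = (if norm x < \<epsilon> then \<epsilon> powr (- real CARD('n))
     else \<epsilon>\<^sup>2 * norm x powr (- (real CARD('n) + 2)))"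

lemma majorant_nonneg: "0 \<le> majorant \<epsilon> x"
  by (simp add: majorant_def)

lemma measurable_majorant [measurable]: "majorant \<epsilon> \<in> borel_measurable borel"
  unfolding majorant_def[abs_def] by measurable

text \<open>The ball of radius \<epsilon> contributes the volume of the unit ball, the outside at
  most \<open>(N + 2) / 2\<close> times it, by \<open>nn_integral_powr_tail\<close> with exponents
  \<open>N\<close> and \<open>N + 2\<close>. An upper bound for the mass of the majorant, not its
  exact value.\<close>

definition majorant_bound :: "'n itself \<Rightarrow> real" where
  "majorant_bound _ = unit_ball_vol (real CARD('n)) * (1 + (real CARD('n) + 2) / 2)"

lemma nn_integral_majorant_le:
  assumes \<epsilon>: "0 < \<epsilon>"
  shows "(\<integral>\<^sup>+x. ennreal (majorant \<epsilon> (x::real^'n)) \<partial>lborel) \<le> ennreal (majorant_bound TYPE('n))"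
proof -
  let ?n = "real CARD('n)" and ?V = "unit_ball_vol (real CARD('n))"
  have V: "emeasure lborel (cball (0::real^'n) r) = ennreal (?V * r powr ?n)" if "\<epsilon> \<le> r" for r
    using emeasure_cball[of r "0::real^'n"] that \<epsilon> by (simp add: powr_realpow)
  have "(\<integral>\<^sup>+x. ennreal (majorant \<epsilon> (x::real^'n)) \<partial>lborel)
     \<le> (\<integral>\<^sup>+x. ennreal (\<epsilon> powr (- ?n)) * indicator (cball 0 \<epsilon>) (x::real^'n) +
        ennreal (\<epsilon>\<^sup>2) * (ennreal (norm x powr (- (?n + 2))) * 1 * indicator {x. \<epsilon> \<le> norm x} x) \<partial>lborel)"
    by (intro nn_integral_mono)
       (auto simp: majorant_def indicator_def ennreal_mult not_less)
  also have "\<dots> = (\<integral>\<^sup>+x. ennreal (\<epsilon> powr (- ?n)) * indicator (cball 0 \<epsilon>) (x::real^'n) \<partial>lborel) +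
      (\<integral>\<^sup>+(x::real^'n). ennreal (\<epsilon>\<^sup>2) * (ennreal (norm x powr (- (?n + 2))) * 1 * indicator {x. \<epsilon> \<le> norm x} x) \<partial>lborel)"
    by (rule nn_integral_add) measurable
  also have "(\<integral>\<^sup>+x. ennreal (\<epsilon> powr (- ?n)) * indicator (cball 0 \<epsilon>) (x::real^'n) \<partial>lborel) = ennreal ?V"
    using V[of \<epsilon>] \<epsilon> by (subst nn_integral_cmult)
      (simp_all add: ennreal_mult[symmetric] powr_add[symmetric] mult_ac del: ennreal_mult)
  also have "(\<integral>\<^sup>+(x::real^'n). ennreal (\<epsilon>\<^sup>2) * (ennreal (norm x powr (- (?n + 2))) * 1 * indicator {x. \<epsilon> \<le> norm x} x) \<partial>lborel)
     = ennreal (\<epsilon>\<^sup>2) * (\<integral>\<^sup>+(x::real^'n). ennreal (norm x powr (- (?n + 2))) * 1 * indicator {x. \<epsilon> \<le> norm x} x \<partial>lborel)"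
    by (rule nn_integral_cmult) measurable
  also have "(\<integral>\<^sup>+(x::real^'n). ennreal (norm x powr (- (?n + 2))) * 1 * indicator {x. \<epsilon> \<le> norm x} x \<partial>lborel)
     \<le> ennreal (?V * (?n + 2) / ((?n + 2) - ?n) * \<epsilon> powr (?n - (?n + 2)))"
    using \<epsilon> V by (intro nn_integral_powr_tail[where f="\<lambda>_. 1" and C="?V" and p="?n"]) auto
  also have "ennreal (\<epsilon>\<^sup>2) * ennreal (?V * (?n + 2) / ((?n + 2) - ?n) * \<epsilon> powr (?n - (?n + 2)))
     = ennreal (?V * (?n + 2) / 2 * (\<epsilon> powr 2 * \<epsilon> powr (-2)))"
    using \<epsilon> by (simp add: ennreal_mult[symmetric] mult_ac)
  also have "\<epsilon> powr 2 * \<epsilon> powr (-2) = 1"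
    unfolding powr_add[symmetric] using \<epsilon> by simp
  finally show ?thesis
    by (simp add: majorant_bound_def ennreal_plus[symmetric] distrib_left mult_left_mono add_left_mono del: ennreal_plus)
qed

lemma nn_integral_majorized_convolution:
  fixes f g :: "real^'n \<Rightarrow> real"
  assumes \<epsilon>: "0 < \<epsilon>" and [measurable]: "f \<in> borel_measurable borel" "g \<in> borel_measurable borel"
    and C: "0 \<le> C" and g: "\<And>x. \<bar>g x\<bar> \<le> C * majorant \<epsilon> x"
  shows "(\<integral>\<^sup>+y. ennreal ((LINT z|lborel. g (y - z) * f z)\<^sup>2) \<partial>lborel)
     \<le> ennreal ((C * majorant_bound TYPE('n))\<^sup>2) * (\<integral>\<^sup>+z. ennreal ((f z)\<^sup>2) \<partial>lborel)"
proof -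
  let ?B = "majorant_bound TYPE('n)"
  have B: "0 \<le> ?B" by (simp add: majorant_bound_def)
  have "ennreal ((LINT z|lborel. g (y - z) * f z)\<^sup>2)
      \<le> (\<integral>\<^sup>+z. ennreal ((C * majorant \<epsilon> (y - z)) * \<bar>f z\<bar>) \<partial>lborel)\<^sup>2" for y
  proof -
    have "ennreal \<bar>LINT z|lborel. g (y - z) * f z\<bar> \<le> (\<integral>\<^sup>+z. ennreal (norm (g (y - z) * f z)) \<partial>lborel)"
    \<comment> \<open>A Bochner integral that does not converge absolutely has the value 0, and the
      bound is then trivial.\<close>
    proof (cases "integrable lborel (\<lambda>z. g (y - z) * f z)")
      case True
      then show ?thesis using integral_norm_bound_ennreal[OF True] by simp
    qed (simp add: not_integrable_integral_eq)
    also have "\<dots> \<le> (\<integral>\<^sup>+z. ennreal ((C * majorant \<epsilon> (y - z)) * \<bar>f z\<bar>) \<partial>lborel)"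
      using g by (intro nn_integral_mono ennreal_leI) (simp add: abs_mult mult_right_mono)
    finally have "(ennreal \<bar>LINT z|lborel. g (y - z) * f z\<bar>)\<^sup>2 \<le> (\<integral>\<^sup>+z. ennreal ((C * majorant \<epsilon> (y - z)) * \<bar>f z\<bar>) \<partial>lborel)\<^sup>2"
      by (rule power_mono) simp
    then show ?thesis by (simp add: ennreal_power)
  qed
  then have "(\<integral>\<^sup>+y. ennreal ((LINT z|lborel. g (y - z) * f z)\<^sup>2) \<partial>lborel)
     \<le> (\<integral>\<^sup>+y. (\<integral>\<^sup>+z. ennreal ((C * majorant \<epsilon> (y - z)) * \<bar>f z\<bar>) \<partial>lborel)\<^sup>2 \<partial>lborel)"
    by (intro nn_integral_mono)
  also have "\<dots> \<le> (\<integral>\<^sup>+(x::real^'n). ennreal (C * majorant \<epsilon> x) \<partial>lborel)\<^sup>2 * (\<integral>\<^sup>+z. ennreal (\<bar>f z\<bar>\<^sup>2) \<partial>lborel)"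
    using nn_integral_convolution_square_le[of "\<lambda>x::real^'n. C * majorant \<epsilon> x" "\<lambda>z. \<bar>f z\<bar>"] C
    by (simp add: majorant_nonneg)
  also have "(\<integral>\<^sup>+(x::real^'n). ennreal (C * majorant \<epsilon> x) \<partial>lborel) = ennreal C * (\<integral>\<^sup>+(x::real^'n). ennreal (majorant \<epsilon> x) \<partial>lborel)"
    using C by (simp add: ennreal_mult majorant_nonneg nn_integral_cmult)
  also have "(ennreal C * (\<integral>\<^sup>+(x::real^'n). ennreal (majorant \<epsilon> x) \<partial>lborel))\<^sup>2 \<le> (ennreal C * ennreal ?B)\<^sup>2"
    by (intro power_mono mult_left_mono nn_integral_majorant_le \<epsilon>) auto
  also have "(ennreal C * ennreal ?B)\<^sup>2 = ennreal ((C * ?B)\<^sup>2)"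
    using B C by (simp add: ennreal_mult[symmetric] ennreal_power)
  finally show ?thesis by (simp add: mult_right_mono)
qed

section \<open>The truncated kernel against the regularised kernel\<close>

lemma powr_minus_diff_le:
  fixes a b p :: real
  assumes "0 < a" "a \<le> b" "0 \<le> p"
  shows "\<bar>a powr (-p) - b powr (-p)\<bar> \<le> p * (b - a) * a powr (-p - 1)"
proof (cases "a = b")
  case False
  then have "a < b" using assms by simp
  then obtain z where z: "a < z" "z < b"
    and e: "b powr (-p) - a powr (-p) = (b - a) * (-p * z powr (-p - 1))"
  proof -
    have "((\<lambda>x. x powr (-p)) has_real_derivative -p * x powr (-p - 1)) (at x)" if "a \<le> x" for x
      using that assms has_real_derivative_powr[of x "-p"] by simp
    then show ?thesis
      using MVT2[of a b "\<lambda>x. x powr (-p)" "\<lambda>x. -p * x powr (-p - 1)"] \<open>a < b\<close> that by blast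
  qed
  have "z powr (-p - 1) \<le> a powr (-p - 1)"
    using z assms by (intro powr_mono2') auto
  then have "p * (b - a) * z powr (-p - 1) \<le> p * (b - a) * a powr (-p - 1)"
    using assms by (intro mult_left_mono) auto
  moreover have "a powr (-p) - b powr (-p) = p * (b - a) * z powr (-p - 1)"
    using e by (simp add: algebra_simps)
  moreover have "0 \<le> p * (b - a) * z powr (-p - 1)" using assms by simp
  ultimately show ?thesis by simp
qed simp

text \<open>Puts \<open>K\<close> into the shape of \<open>kker\<close> at \<epsilon> = 0, up to the
  factor \<open>- \<kappa>\<close>, so that the two can be compared term by term.\<close>

lemma K_eq_powr:
  fixes y :: "real^'n"
  assumes "y \<noteq> 0"
  shows "K \<kappa> i j y = \<kappa> * (real CARD('n) * y $ i * y $ j * ((norm y)\<^sup>2) powr (- (real CARD('n) / 2) - 1)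
     - of_bool (i = j) * ((norm y)\<^sup>2) powr (- (real CARD('n) / 2)))"
proof -
  let ?n = "real CARD('n)"
  have y: "0 < norm y" using assms by simp
  have sq: "((norm y)\<^sup>2) powr p = norm y powr (2 * p)" for p
    using y by (simp add: powr_powr flip: powr_numeral)
  have N: "norm y ^ (CARD('n) + 2) = norm y powr (?n + 2)"
    using y powr_realpow[of "norm y" "CARD('n) + 2"] by (simp add: add.commute)
  have e1: "2 * (- (?n / 2) - 1) = - (?n + 2)" and e2: "2 * (- (?n / 2)) = - ?n" by simp_all
  have "norm y powr - ?n = (norm y)\<^sup>2 * norm y powr (- (?n + 2))"
    using y powr_add[of "norm y" 2 "- (?n + 2)"] by simp
  moreover have "K \<kappa> i j y = \<kappa> * (?n * y $ i * y $ j - (if i = j then (norm y)\<^sup>2 else 0)) * norm y powr (- (?n + 2))"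
    unfolding K_def N powr_minus_divide by simp
  ultimately show ?thesis
    unfolding sq e1 e2 by (cases "i = j") (simp_all add: algebra_simps del: minus_add_distrib)
qed

text \<open>Large enough for both regions of \<open>truncated_K_diff\<close>: \<open>1 + N\<close>
  is needed inside the ball of radius \<epsilon>, and \<open>N * (N/2 + 1) + N/2\<close>
  outside.\<close>

definition kernel_bound :: "'n itself \<Rightarrow> real" where
  "kernel_bound _ = real CARD('n) * (real CARD('n) / 2 + 1) + 2 * real CARD('n) + 1"

text \<open>The plus sign hides a difference, since \<open>K\<close> is \<open>- \<kappa>\<close>
  times the limit of \<open>kker\<close>. Inside the ball only \<open>kker\<close> is left, of size
  \<open>\<epsilon>^(-N)\<close>. Outside, the mean value theorem prices the passage from
  \<open>|y|^2\<close> to \<open>|y|^2 + \<epsilon>^2\<close>, which gains a factor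
  \<open>\<epsilon>^2 / |y|^2\<close>.\<close>

lemma truncated_K_diff:
  fixes y :: "real^'n"
  assumes \<epsilon>: "0 < \<epsilon>"
  shows "\<bar>indicator {y. \<epsilon> \<le> norm y} y * K \<kappa> i j y + \<kappa> * kker \<epsilon> i j y\<bar>
     \<le> \<bar>\<kappa>\<bar> * kernel_bound TYPE('n) * majorant \<epsilon> y"
proof (cases "\<epsilon> \<le> norm y")
  case False
  let ?n = "real CARD('n)"
  have "regsq \<epsilon> y powr (- (?n / 2)) \<le> (\<epsilon>\<^sup>2) powr (- (?n / 2))"
    using \<epsilon> regsq_ge(2)[of \<epsilon> y] by (intro powr_mono2') auto
  also have "\<dots> = \<epsilon> powr (- ?n)"
    using \<epsilon> by (simp add: powr_powr flip: powr_numeral)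
  finally have "(1 + ?n) * regsq \<epsilon> y powr (- (?n / 2)) \<le> kernel_bound TYPE('n) * \<epsilon> powr (- ?n)"
    unfolding kernel_bound_def by (intro mult_mono) auto
  with kker_bound[OF \<epsilon>, of i j y]
  have "\<bar>\<kappa>\<bar> * \<bar>kker \<epsilon> i j y\<bar> \<le> \<bar>\<kappa>\<bar> * (kernel_bound TYPE('n) * \<epsilon> powr (- ?n))"
    by (intro mult_left_mono) auto
  then show ?thesis using False by (simp add: majorant_def abs_mult)
next
  case True
  let ?n = "real CARD('n)" and ?a = "(norm y)\<^sup>2" and ?b = "regsq \<epsilon> y"
  have y: "0 < norm y" and a: "0 < ?a" using True \<epsilon> by auto
  have ab: "?a \<le> ?b" "?b - ?a = \<epsilon>\<^sup>2" by (simp_all add: regsq_def)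
  have sq: "?a powr p = norm y powr (2 * p)" for p
    using y by (simp add: powr_powr flip: powr_numeral)
  let ?m = "\<epsilon>\<^sup>2 * norm y powr (- (?n + 2))"
  have 1: "\<bar>?a powr (- (?n / 2)) - ?b powr (- (?n / 2))\<bar> \<le> (?n / 2) * ?m"
  proof -
    have e: "2 * (- (?n / 2) - 1) = - (?n + 2)" by simp
    show ?thesis
      using powr_minus_diff_le[OF a ab(1), of "?n / 2"] unfolding ab(2) sq[of "- (?n / 2) - 1"] e by simp
  qed
  have 2: "\<bar>?n * y $ i * y $ j * (?a powr (- (?n / 2) - 1) - ?b powr (- (?n / 2) - 1))\<bar> \<le> ?n * (?n / 2 + 1) * ?m"
  proof -
    have "\<bar>?a powr (- (?n / 2 + 1)) - ?b powr (- (?n / 2 + 1))\<bar> \<le> (?n / 2 + 1) * (?b - ?a) * ?a powr (- (?n / 2 + 1) - 1)"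
      using ab a by (intro powr_minus_diff_le) auto
    also have "\<dots> = (?n / 2 + 1) * \<epsilon>\<^sup>2 * norm y powr (- (?n + 2) - 2)"
    proof -
      have e: "2 * (- (?n / 2 + 1) - 1) = - (?n + 2) - 2" by simp
      show ?thesis unfolding sq e ab(2) ..
    qed
    finally have d: "\<bar>?a powr (- (?n / 2) - 1) - ?b powr (- (?n / 2) - 1)\<bar>
        \<le> (?n / 2 + 1) * \<epsilon>\<^sup>2 * norm y powr (- (?n + 2) - 2)" by simp
    have "\<bar>y $ i\<bar> * \<bar>y $ j\<bar> \<le> norm y * norm y"
      by (intro mult_mono component_le_norm_cart) auto
    then have "\<bar>y $ i\<bar> * \<bar>y $ j\<bar> * \<bar>?a powr (- (?n / 2) - 1) - ?b powr (- (?n / 2) - 1)\<bar>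
       \<le> (norm y * norm y) * ((?n / 2 + 1) * \<epsilon>\<^sup>2 * norm y powr (- (?n + 2) - 2))"
      by (rule mult_mono) (use d in auto)
    also have "\<dots> = (?n / 2 + 1) * \<epsilon>\<^sup>2 * ((norm y powr 2) * norm y powr (- (?n + 2) - 2))"
      using y by (simp add: power2_eq_square)
    also have "(norm y powr 2) * norm y powr (- (?n + 2) - 2) = norm y powr (2 + (- (?n + 2) - 2))"
      by (simp only: powr_add)
    also have "2 + (- (?n + 2) - 2) = - (?n + 2)" by simp
    finally have "?n * (\<bar>y $ i\<bar> * \<bar>y $ j\<bar> * \<bar>?a powr (- (?n / 2) - 1) - ?b powr (- (?n / 2) - 1)\<bar>)
       \<le> ?n * ((?n / 2 + 1) * \<epsilon>\<^sup>2 * norm y powr (- (?n + 2)))"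
      by (intro mult_left_mono) auto
    then show ?thesis by (simp add: abs_mult mult.assoc)
  qed
  have "indicator {y. \<epsilon> \<le> norm y} y * K \<kappa> i j y + \<kappa> * kker \<epsilon> i j y
    = \<kappa> * (?n * y $ i * y $ j * (?a powr (- (?n / 2) - 1) - ?b powr (- (?n / 2) - 1))
        - of_bool (i = j) * (?a powr (- (?n / 2)) - ?b powr (- (?n / 2))))"
    using True y unfolding kker_def by (subst K_eq_powr) (auto simp: algebra_simps)
  also have "\<bar>\<dots>\<bar> \<le> \<bar>\<kappa>\<bar> * (?n * (?n / 2 + 1) * ?m + (?n / 2) * ?m)"
    unfolding abs_mult[of \<kappa>]
    using abs_triangle_ineq4[of "?n * y $ i * y $ j * (?a powr (- (?n / 2) - 1) - ?b powr (- (?n / 2) - 1))"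
      "of_bool (i = j) * (?a powr (- (?n / 2)) - ?b powr (- (?n / 2)))"] 1 2
    by (intro mult_left_mono) (auto simp: of_bool_def intro: order_trans)
  also have "\<dots> \<le> \<bar>\<kappa>\<bar> * (kernel_bound TYPE('n) * ?m)"
    unfolding distrib_right[symmetric] kernel_bound_def by (intro mult_left_mono mult_right_mono) auto
  finally show ?thesis using True by (simp add: majorant_def mult.assoc)
qed


section \<open>Uniform mean-square bound for truncated convolutions\<close>

lemma continuous_K:
  "continuous_on (- {0}) (K \<kappa> i j :: real^'n \<Rightarrow> real)"
  unfolding K_def[abs_def] by (cases "i = j") (auto intro!: continuous_intros)

lemma measurable_K [measurable]: "(K \<kappa> i j :: real^'n \<Rightarrow> real) \<in> borel_measurable borel"
  unfolding K_def[abs_def] by measurable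

lemma kker_global_bound:
  fixes x :: "real^'n"
  assumes \<epsilon>: "0 < \<epsilon>"
  shows "\<bar>kker \<epsilon> i j x\<bar> \<le> (1 + real CARD('n)) * (\<epsilon>\<^sup>2) powr (- (real CARD('n) / 2))"
proof -
  have "regsq \<epsilon> x powr (- (real CARD('n) / 2)) \<le> (\<epsilon>\<^sup>2) powr (- (real CARD('n) / 2))"
    using \<epsilon> regsq_ge(2)[of \<epsilon> x] by (intro powr_mono2') auto
  with kker_bound[OF \<epsilon>, of i j x] show ?thesis
    by (smt (verit) mult_left_mono of_nat_0_le_iff)
qed

text \<open>The kernel \<open>kker\<close> is the Hessian of a potential whose Laplacian \<open>\<Sum>\<^sub>i kker \<epsilon> i i\<close> is an
  approximate identity, so \<open>kker_inner_swap\<close> bounds the Hessian by the Laplacian in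
  \<open>L\<^sup>2\<close>.\<close>

lemma kker_convolution_L2:
  fixes f :: "real^'n \<Rightarrow> real" and i j :: 'n
  assumes \<epsilon>: "0 < \<epsilon>" and n: "2 \<le> CARD('n)" and f: "integrable lborel f"
  shows "(\<integral>\<^sup>+y. ennreal ((LINT z|lborel. kker \<epsilon> i j (y - z) * f z)\<^sup>2) \<partial>lborel)
     \<le> ennreal ((real CARD('n) * majorant_bound TYPE('n))\<^sup>2) * (\<integral>\<^sup>+z. ennreal ((f z)\<^sup>2) \<partial>lborel)"
proof -
  let ?n = "real CARD('n)"
  define T where "T i j x = (LINT z|lborel. kker \<epsilon> i j (x - z) * f z)" for i j :: 'n and x
  define D where "D x = (\<Sum>i\<in>UNIV. kker \<epsilon> i i x)" for x :: "real^'n"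
  have [measurable]: "f \<in> borel_measurable borel" using f by (simp add: borel_measurable_integrable)
  have m[measurable]: "kker \<epsilon> i j \<in> borel_measurable borel" for i j :: 'n
    by (intro borel_measurable_continuous_onI continuous_kker \<epsilon>)
  have n2: "2 \<le> ?n" using n by simp
  have k2: "integrable lborel (\<lambda>x. (kker \<epsilon> i j x)\<^sup>2)" for i j :: 'n
  proof -
    have "integrable lborel (\<lambda>x. kker \<epsilon> i j (x - 0) * kker \<epsilon> i j (x - 0))"
      by (rule integrable_shifted_product[OF \<epsilon> continuous_kker[OF \<epsilon>] continuous_kker[OF \<epsilon>]
        kker_bound[OF \<epsilon>] kker_bound[OF \<epsilon>]]) (use n2 in auto)
    then show ?thesis by (simp add: power2_eq_square)
  qed
  note cm = integral_convolution_mult[OF m m kker_global_bound[OF \<epsilon>] kker_global_bound[OF \<epsilon>] k2 k2 f f]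
  have TT: "integrable lborel (\<lambda>x. T a b x * T c d x)" for a b c d
    unfolding T_def by (rule cm(1))
  have swap: "(LINT x|lborel. T a b x * T a b x) = (LINT x|lborel. T b b x * T a a x)" for a b
    unfolding T_def cm(2) kker_inner_swap[OF \<epsilon> n, of a b] ..
  have Tint: "integrable lborel (\<lambda>z. kker \<epsilon> a b (x - z) * f z)" for a b x
    by (intro integrable_bounded_mult[where B = "(1 + ?n) * (\<epsilon>\<^sup>2) powr (- (?n / 2))"] f kker_global_bound \<epsilon>) measurable
  have Dsum: "(LINT z|lborel. D (x - z) * f z) = (\<Sum>a\<in>UNIV. T a a x)" for x
    unfolding D_def T_def using Tint by (simp add: sum_distrib_right)
  \<comment> \<open>A single entry is enlarged to the full sum over index pairs, because only the
    sum turns, after the swap, into the square of the trace.\<close>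
  have "(LINT x|lborel. T i j x * T i j x) \<le> (\<Sum>b\<in>UNIV. LINT x|lborel. T i b x * T i b x)"
    by (rule member_le_sum[of j UNIV "\<lambda>b. LINT x|lborel. T i b x * T i b x"]) auto
  also have "\<dots> \<le> (\<Sum>a\<in>UNIV. \<Sum>b\<in>UNIV. LINT x|lborel. T a b x * T a b x)"
    by (rule member_le_sum[of i UNIV "\<lambda>a. \<Sum>b\<in>UNIV. LINT x|lborel. T a b x * T a b x"]) (auto intro!: sum_nonneg)
  also have "\<dots> = (\<Sum>a\<in>UNIV. \<Sum>b\<in>UNIV. LINT x|lborel. T b b x * T a a x)"
    by (intro sum.cong refl swap)
  also have "\<dots> = (LINT x|lborel. (\<Sum>a\<in>UNIV. \<Sum>b\<in>UNIV. T b b x * T a a x))"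
    using TT by simp
  also have "\<dots> = (LINT x|lborel. (LINT z|lborel. D (x - z) * f z)\<^sup>2)"
    unfolding Dsum power2_eq_square sum_product by (intro Bochner_Integration.integral_cong refl) (simp add: mult.commute)
  finally have le: "(LINT x|lborel. T i j x * T i j x) \<le> (LINT x|lborel. (LINT z|lborel. D (x - z) * f z)\<^sup>2)" .
  have intD: "integrable lborel (\<lambda>x. (LINT z|lborel. D (x - z) * f z)\<^sup>2)"
    unfolding Dsum power2_eq_square sum_product using TT by auto
  have "(\<integral>\<^sup>+y. ennreal ((LINT z|lborel. kker \<epsilon> i j (y - z) * f z)\<^sup>2) \<partial>lborel) = ennreal (LINT x|lborel. T i j x * T i j x)"
    unfolding T_def[symmetric] power2_eq_square by (rule nn_integral_eq_integral[OF TT]) auto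
  also have "\<dots> \<le> ennreal (LINT x|lborel. (LINT z|lborel. D (x - z) * f z)\<^sup>2)"
    using le by (rule ennreal_leI)
  also have "\<dots> = (\<integral>\<^sup>+y. ennreal ((LINT z|lborel. D (y - z) * f z)\<^sup>2) \<partial>lborel)"
    by (rule nn_integral_eq_integral[OF intD, symmetric]) auto
  also have "\<dots> \<le> ennreal ((?n * majorant_bound TYPE('n))\<^sup>2) * (\<integral>\<^sup>+z. ennreal ((f z)\<^sup>2) \<partial>lborel)"
  proof (rule nn_integral_majorized_convolution[OF \<epsilon>])
    show "D \<in> borel_measurable borel" unfolding D_def[abs_def] by measurable
    show "\<bar>D x\<bar> \<le> ?n * majorant \<epsilon> x" for x
    proof -
      let ?s = "regsq \<epsilon> x"
      have D: "D x = ?n * (\<epsilon>\<^sup>2 * ?s powr (- (?n / 2 + 1)))"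
        unfolding D_def sum_kker[OF \<epsilon>] by simp
      have "\<epsilon>\<^sup>2 * ?s powr (- (?n / 2 + 1)) \<le> majorant \<epsilon> x"
      proof (cases "norm x < \<epsilon>")
        case True
        have "\<epsilon>\<^sup>2 * ?s powr (- (?n / 2 + 1)) \<le> \<epsilon>\<^sup>2 * (\<epsilon>\<^sup>2) powr (- (?n / 2 + 1))"
          using \<epsilon> regsq_ge(2)[of \<epsilon> x] by (intro mult_left_mono powr_mono2') auto
        also have "\<dots> = (\<epsilon>\<^sup>2) powr 1 * (\<epsilon>\<^sup>2) powr (- (?n / 2 + 1))" using \<epsilon> by simp
        also have "\<dots> = (\<epsilon>\<^sup>2) powr (- (?n / 2))" unfolding powr_add[symmetric] by simp
        also have "\<dots> = \<epsilon> powr (- ?n)"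
          using \<epsilon> by (simp add: powr_powr flip: powr_numeral)
        finally show ?thesis using True by (simp add: majorant_def)
      next
        case False
        then have "0 < norm x" using \<epsilon> by linarith
        have "?s powr (- (?n / 2 + 1)) \<le> ((norm x)\<^sup>2) powr (- (?n / 2 + 1))"
          using \<open>0 < norm x\<close> regsq_ge(1)[of x \<epsilon>] by (intro powr_mono2') auto
        also have "\<dots> = norm x powr (2 * (- (?n / 2 + 1)))"
          using \<open>0 < norm x\<close> by (simp add: powr_powr flip: powr_numeral)
        also have "2 * (- (?n / 2 + 1)) = - (?n + 2)" by simp
        finally show ?thesis using False by (simp add: majorant_def mult_left_mono)
      qed
      then have "?n * (\<epsilon>\<^sup>2 * ?s powr (- (?n / 2 + 1))) \<le> ?n * majorant \<epsilon> x"
        by (rule mult_left_mono) simp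
      then show ?thesis unfolding D by (simp add: abs_mult)
    qed
  qed auto
  finally show ?thesis .
qed

definition truncated_convolution :: "real \<Rightarrow> 'n \<Rightarrow> 'n \<Rightarrow> real \<Rightarrow> (real^'n \<Rightarrow> real) \<Rightarrow> real^'n \<Rightarrow> real" where
  "truncated_convolution \<kappa> i j \<epsilon> f y =
     (LINT z|lborel. indicator {z. \<epsilon> \<le> dist y z} z * (K \<kappa> i j (y - z) * f z))"

text \<open>Squared operator bounds for the two pieces of the truncated kernel, the error below the
  majorant and \<open>\<kappa>\<close> times \<open>kker\<close>. The factor 2 comes from
  \<open>(a - b)^2 \<le> 2 a^2 + 2 b^2\<close>.\<close>

definition CZ_bound :: "'n itself \<Rightarrow> real \<Rightarrow> real" where
  "CZ_bound T \<kappa> = 2 * ((\<bar>\<kappa>\<bar> * kernel_bound T * majorant_bound T)\<^sup>2 + \<kappa>\<^sup>2 * (real CARD('n) * majorant_bound T)\<^sup>2)"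

text \<open>The truncated kernel is \<open>- \<kappa>\<close> times \<open>kker\<close> plus an
  error dominated by the majorant. The point is that the constant does not depend on \<epsilon>, so
  the bound survives the limit that defines the principal value.\<close>

lemma truncated_convolution_L2:
  fixes f :: "real^'n \<Rightarrow> real" and i j :: 'n
  assumes \<epsilon>: "0 < \<epsilon>" and n: "2 \<le> CARD('n)" and f: "integrable lborel f"
  shows "(\<integral>\<^sup>+y. ennreal ((truncated_convolution \<kappa> i j \<epsilon> f y)\<^sup>2) \<partial>lborel)
     \<le> ennreal (CZ_bound TYPE('n) \<kappa>) * (\<integral>\<^sup>+z. ennreal ((f z)\<^sup>2) \<partial>lborel)"
proof -
  let ?n = "real CARD('n)"
  have [measurable]: "f \<in> borel_measurable borel" using f by (simp add: borel_measurable_integrable)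
  have [measurable]: "kker \<epsilon> i j \<in> borel_measurable borel" for i j :: 'n
    by (intro borel_measurable_continuous_onI continuous_kker \<epsilon>)
  define d where "d y = indicator {y. \<epsilon> \<le> norm y} y * K \<kappa> i j y + \<kappa> * kker \<epsilon> i j y" for y :: "real^'n"
  have [measurable]: "d \<in> borel_measurable borel" unfolding d_def[abs_def] by measurable
  have d: "\<bar>d y\<bar> \<le> \<bar>\<kappa>\<bar> * kernel_bound TYPE('n) * majorant \<epsilon> y" for y
    unfolding d_def by (rule truncated_K_diff[OF \<epsilon>])
  have maj: "majorant \<epsilon> y \<le> \<epsilon> powr (- ?n)" for y :: "real^'n"
  proof (cases "norm y < \<epsilon>")
    case False
    have "\<epsilon>\<^sup>2 * norm y powr (- (?n + 2)) \<le> \<epsilon>\<^sup>2 * \<epsilon> powr (- (?n + 2))"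
      using False \<epsilon> by (intro mult_left_mono powr_mono2') auto
    also have "\<dots> = \<epsilon> powr 2 * \<epsilon> powr (- (?n + 2))" using \<epsilon> by simp
    also have "\<dots> = \<epsilon> powr (- ?n)" unfolding powr_add[symmetric] by simp
    finally show ?thesis using False by (simp add: majorant_def)
  qed (simp add: majorant_def)
  have nonneg: "0 \<le> kernel_bound TYPE('n)" "0 \<le> majorant_bound TYPE('n)"
    by (simp_all add: kernel_bound_def majorant_bound_def)
  have dint: "integrable lborel (\<lambda>z. d (y - z) * f z)" for y
  proof (rule integrable_bounded_mult[OF f])
    show "\<bar>d (y - z)\<bar> \<le> \<bar>\<kappa>\<bar> * kernel_bound TYPE('n) * \<epsilon> powr (- ?n)" for z
      using order_trans[OF d mult_left_mono[OF maj]] nonneg by simp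
  qed measurable
  have kint: "integrable lborel (\<lambda>z. kker \<epsilon> i j (y - z) * f z)" for y
    by (intro integrable_bounded_mult[where B = "(1 + ?n) * (\<epsilon>\<^sup>2) powr (- (?n / 2))"] f kker_global_bound \<epsilon>) measurable
  have eq: "truncated_convolution \<kappa> i j \<epsilon> f y
      = (LINT z|lborel. d (y - z) * f z) - \<kappa> * (LINT z|lborel. kker \<epsilon> i j (y - z) * f z)" for y
  proof -
    have "(LINT z|lborel. d (y - z) * f z) - \<kappa> * (LINT z|lborel. kker \<epsilon> i j (y - z) * f z)
       = (LINT z|lborel. d (y - z) * f z - \<kappa> * (kker \<epsilon> i j (y - z) * f z))"
      using dint kint by simp
    also have "\<dots> = truncated_convolution \<kappa> i j \<epsilon> f y"
      unfolding truncated_convolution_def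
      by (intro Bochner_Integration.integral_cong refl) (simp add: d_def dist_norm indicator_def algebra_simps)
    finally show ?thesis ..
  qed
  have "(\<integral>\<^sup>+y. ennreal ((truncated_convolution \<kappa> i j \<epsilon> f y)\<^sup>2) \<partial>lborel)
     \<le> (\<integral>\<^sup>+y. ennreal 2 * ennreal ((LINT z|lborel. d (y - z) * f z)\<^sup>2) +
           ennreal (2 * \<kappa>\<^sup>2) * ennreal ((LINT z|lborel. kker \<epsilon> i j (y - z) * f z)\<^sup>2) \<partial>lborel)"
  proof (intro nn_integral_mono)
    fix y
    have "(a - b)\<^sup>2 \<le> 2 * a\<^sup>2 + 2 * b\<^sup>2" for a b :: real
      using zero_le_power2[of "a + b"] by (simp add: power2_eq_square algebra_simps)
    from this[of "LINT z|lborel. d (y - z) * f z" "\<kappa> * (LINT z|lborel. kker \<epsilon> i j (y - z) * f z)"]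
    have "((LINT z|lborel. d (y - z) * f z) - \<kappa> * (LINT z|lborel. kker \<epsilon> i j (y - z) * f z))\<^sup>2
        \<le> 2 * (LINT z|lborel. d (y - z) * f z)\<^sup>2 + (2 * \<kappa>\<^sup>2) * (LINT z|lborel. kker \<epsilon> i j (y - z) * f z)\<^sup>2"
      by (simp only: power_mult_distrib mult.assoc)
    from ennreal_leI[OF this]
    show "ennreal ((truncated_convolution \<kappa> i j \<epsilon> f y)\<^sup>2) \<le> ennreal 2 * ennreal ((LINT z|lborel. d (y - z) * f z)\<^sup>2) +
           ennreal (2 * \<kappa>\<^sup>2) * ennreal ((LINT z|lborel. kker \<epsilon> i j (y - z) * f z)\<^sup>2)"
      unfolding eq by (subst (1 2) ennreal_mult[symmetric]; simp?)
  qed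
  also have "\<dots> = ennreal 2 * (\<integral>\<^sup>+y. ennreal ((LINT z|lborel. d (y - z) * f z)\<^sup>2) \<partial>lborel) +
           ennreal (2 * \<kappa>\<^sup>2) * (\<integral>\<^sup>+y. ennreal ((LINT z|lborel. kker \<epsilon> i j (y - z) * f z)\<^sup>2) \<partial>lborel)"
    by (subst nn_integral_add; (subst nn_integral_cmult)?; (subst nn_integral_cmult)?; measurable?)
  also have "\<dots> \<le> ennreal 2 * (ennreal ((\<bar>\<kappa>\<bar> * kernel_bound TYPE('n) * majorant_bound TYPE('n))\<^sup>2) * (\<integral>\<^sup>+z. ennreal ((f z)\<^sup>2) \<partial>lborel))
     + ennreal (2 * \<kappa>\<^sup>2) * (ennreal ((?n * majorant_bound TYPE('n))\<^sup>2) * (\<integral>\<^sup>+z. ennreal ((f z)\<^sup>2) \<partial>lborel))"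
    by (intro add_mono mult_left_mono kker_convolution_L2[OF \<epsilon> n f] nn_integral_majorized_convolution[OF \<epsilon> _ _ _ d])
       (use nonneg in auto)
  also have "\<dots> = ennreal (CZ_bound TYPE('n) \<kappa>) * (\<integral>\<^sup>+z. ennreal ((f z)\<^sup>2) \<partial>lborel)"
  proof -
    have "ennreal 2 * (ennreal a * F) + ennreal (2 * k) * (ennreal b * F) = ennreal (2 * (a + k * b)) * F"
      if "0 \<le> a" "0 \<le> b" "0 \<le> k" for a b k F
    proof -
      have "ennreal (2 * (a + k * b)) = ennreal (2 * a) + ennreal (2 * k * b)"
        using that by (simp add: distrib_left ennreal_plus[symmetric] del: ennreal_plus)
      also have "\<dots> = ennreal 2 * ennreal a + ennreal (2 * k) * ennreal b"
        using that by (intro arg_cong2[where f = "(+)"] ennreal_mult) auto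
      finally show ?thesis by (simp only: distrib_right mult.assoc)
    qed
    then show ?thesis unfolding CZ_bound_def by simp
  qed
  finally show ?thesis .
qed

section \<open>Taylor estimates for the kernel\<close>

text \<open>Along a line the kernel is a function of one real variable, so the Taylor estimates
  reduce to the mean value theorem and avoid second Frechet derivatives. The derivatives are
  existential because only their size matters later; \<open>C\<close> is a crude sum over the terms
  of both of them.\<close>

lemma K_line_derivs:
  fixes x y :: "real^'n" and i j :: 'n
  defines "n \<equiv> real CARD('n)"
  defines "C \<equiv> 2 * n + 8 * n * (n / 2 + 1) + n * (n / 2 + 1) * (4 * (n / 2 + 2) + 2) + (n / 2) * (4 * (n / 2 + 1) + 2)"
  shows "\<exists>g' g''. \<forall>t. x - t *\<^sub>R y \<noteq> 0 \<longrightarrow>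
     ((\<lambda>t. K \<kappa> i j (x - t *\<^sub>R y)) has_real_derivative g' t) (at t) \<and>
     (g' has_real_derivative g'' t) (at t) \<and>
     \<bar>g' t\<bar> \<le> \<bar>\<kappa>\<bar> * C * norm y * norm (x - t *\<^sub>R y) powr (- (n + 1)) \<and>
     \<bar>g'' t\<bar> \<le> \<bar>\<kappa>\<bar> * C * (norm y)\<^sup>2 * norm (x - t *\<^sub>R y) powr (- (n + 2))"
proof -
  define m where "m = n / 2"
  define a where "a k t = x $ k - t * y $ k" for k t
  define s where "s t = (norm (x - t *\<^sub>R y))\<^sup>2" for t
  define s' where "s' t = - 2 * ((x - t *\<^sub>R y) \<bullet> y)" for t
  define d where "d = (of_bool (i = j) :: real)"
  have n: "0 < n" and m: "0 < m" by (simp_all add: n_def m_def)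
  define G where "G t = \<kappa> * (n * (a i t * a j t) * s t powr (- m - 1) - d * s t powr (- m))" for t
  define G' where "G' t = \<kappa> * (n * (- y $ i * a j t - a i t * y $ j) * s t powr (- m - 1)
      - n * (m + 1) * (a i t * a j t) * (s' t * s t powr (- m - 2)) + d * m * (s' t * s t powr (- m - 1)))" for t
  define G'' where "G'' t = \<kappa> * (2 * n * (y $ i * y $ j) * s t powr (- m - 1)
      - 2 * n * (m + 1) * (- y $ i * a j t - a i t * y $ j) * (s' t * s t powr (- m - 2))
      + n * (m + 1) * (a i t * a j t) * ((m + 2) * (s' t)\<^sup>2 * s t powr (- m - 3) - 2 * (norm y)\<^sup>2 * s t powr (- m - 2))
      + d * m * (2 * (norm y)\<^sup>2 * s t powr (- m - 1) - (m + 1) * (s' t)\<^sup>2 * s t powr (- m - 2)))" for t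
  have a_deriv: "(a k has_real_derivative - y $ k) (at t)" for k t
    unfolding a_def[abs_def] by (auto intro!: derivative_eq_intros)
  have s_eq: "s = (\<lambda>t. x \<bullet> x - 2 * t * (x \<bullet> y) + t\<^sup>2 * (y \<bullet> y))"
    unfolding s_def[abs_def] power2_norm_eq_inner
    by (simp add: fun_eq_iff inner_diff_left inner_diff_right inner_commute power2_eq_square algebra_simps)
  have s_deriv: "(s has_real_derivative s' t) (at t)" for t
    unfolding s_eq s'_def by (auto intro!: derivative_eq_intros simp: inner_diff_left inner_diff_right algebra_simps)
  have s'_deriv: "(s' has_real_derivative 2 * (norm y)\<^sup>2) (at t)" for t
    unfolding s'_def[abs_def] inner_diff_left inner_scaleR_left
    by (auto intro!: derivative_eq_intros simp: power2_norm_eq_inner)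
  have p_deriv: "((\<lambda>t. s t powr p) has_real_derivative p * (s' t * s t powr (p - 1))) (at t)" if "0 < s t" for p t
    using DERIV_powr[OF s_deriv that, of "\<lambda>_. p" 0] that by (simp add: powr_diff mult_ac)
  have e: "- m - 1 - 1 = - m - 2" "- m - 2 - 1 = - m - 3" by simp_all
  have G_deriv: "(G has_real_derivative G' t) (at t)" if "0 < s t" for t
    unfolding G_def[abs_def]
    by (rule DERIV_cong[OF DERIV_cmult[OF DERIV_diff[OF DERIV_mult[OF DERIV_cmult[OF DERIV_mult[OF a_deriv a_deriv]]
        p_deriv[OF that]] DERIV_cmult[OF p_deriv[OF that]]]]])
       (simp add: G'_def e algebra_simps)
  have G'_deriv: "(G' has_real_derivative G'' t) (at t)" if "0 < s t" for t
  proof -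
    have 1: "((\<lambda>t. - y $ i * a j t - a i t * y $ j) has_real_derivative 2 * (y $ i * y $ j)) (at t)"
      by (rule DERIV_cong[OF DERIV_diff[OF DERIV_cmult[OF a_deriv] DERIV_cmult_right[OF a_deriv]]]) simp
    note 2 = DERIV_mult[OF DERIV_cmult[OF 1, of n] p_deriv[OF that, of "- m - 1"]]
    note 3 = DERIV_mult[OF DERIV_cmult[OF DERIV_mult[OF a_deriv[of i t] a_deriv[of j t]], of "n * (m + 1)"]
        DERIV_mult[OF s'_deriv p_deriv[OF that, of "- m - 2"]]]
    note 4 = DERIV_cmult[OF DERIV_mult[OF s'_deriv p_deriv[OF that, of "- m - 1"]], of "d * m"]
    show ?thesis
      unfolding G'_def[abs_def]
      by (rule DERIV_cong[OF DERIV_cmult[OF DERIV_add[OF DERIV_diff[OF 2 3] 4]]])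
         (simp add: G''_def e algebra_simps power2_eq_square)
  qed
  have bounds: "\<bar>G' t\<bar> \<le> \<bar>\<kappa>\<bar> * C * norm y * norm (x - t *\<^sub>R y) powr (- (n + 1)) \<and>
     \<bar>G'' t\<bar> \<le> \<bar>\<kappa>\<bar> * C * (norm y)\<^sup>2 * norm (x - t *\<^sub>R y) powr (- (n + 2))" if st: "0 < s t" for t
  proof -
    define r where "r = norm (x - t *\<^sub>R y)"
    define Y where "Y = norm y"
    have r: "0 < r" using st by (simp add: s_def r_def)
    have Y: "0 \<le> Y" by (simp add: Y_def)
    have sr: "s t powr p = r powr (2 * p)" for p
      using r by (simp add: s_def r_def powr_powr flip: powr_numeral)
    define w where "w = r powr (- (n + 2))"
    have w: "0 \<le> w" by (simp add: w_def)
    have w1: "s t powr (- m - 1) = w" unfolding sr w_def by (simp add: m_def)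
    \<comment> \<open>The lowest power of \<open>r\<close> that occurs. With the other powers
      written as \<open>v\<close> times powers of \<open>r * r\<close>, the formulas for
      \<open>G'\<close> and \<open>G''\<close> become polynomial identities.\<close>
    define v where "v = r powr (- (n + 2) - 2 - 2)"
    have w3: "s t powr (- m - 3) = v"
    proof -
      have e: "2 * (- m - 3) = - (n + 2) - 2 - 2" by (simp add: m_def)
      show ?thesis unfolding sr e v_def ..
    qed
    have r2: "r powr 2 = r * r" using r by (simp add: power2_eq_square)
    have w2: "s t powr (- m - 2) = v * (r * r)"
    proof -
      have e: "2 * (- m - 2) = (- (n + 2) - 2 - 2) + 2" by (simp add: m_def)
      show ?thesis unfolding sr e powr_add[of r _ 2] v_def r2 ..
    qed
    have wv: "w = v * (r * r) * (r * r)"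
    proof -
      have e: "- (n + 2) = (- (n + 2) - 2 - 2) + 2 + 2" by simp
      show ?thesis unfolding w_def by (subst e) (simp only: powr_add[of r _ 2] v_def r2)
    qed
    have CC: "C = 2 * n + 8 * (n * (m + 1)) + n * (m + 1) * (4 * (m + 2) + 2) + m * (4 * (m + 1) + 2)"
      unfolding C_def m_def by simp
    \<comment> \<open>After division by \<open>r\<close> the components are bounded by 1 and
      \<open>S\<close> by \<open>2 * Y\<close>, so all dependence on \<open>r\<close> sits in
      explicit prefactors.\<close>
    define X where "X k = a k t / r" for k
    define S where "S = s' t / r"
    have aX: "a k t = r * X k" for k using r by (simp add: X_def)
    have sS: "s' t = r * S" using r by (simp add: S_def)
    have Xb: "\<bar>X k\<bar> \<le> 1" for k
    proof -
      have "\<bar>a k t\<bar> \<le> r" unfolding a_def r_def using component_le_norm_cart[of "x - t *\<^sub>R y" k] by simp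
      then show ?thesis using r by (simp add: X_def)
    qed
    have Sb: "\<bar>S\<bar> \<le> 2 * Y"
    proof -
      have "\<bar>s' t\<bar> \<le> 2 * (r * Y)"
        unfolding s'_def r_def Y_def using Cauchy_Schwarz_ineq2[of "x - t *\<^sub>R y" y] by (simp add: abs_mult)
      then show ?thesis using r by (simp add: S_def field_simps)
    qed
    have yb: "\<bar>y $ k\<bar> \<le> Y" for k unfolding Y_def by (rule component_le_norm_cart)
    have yX: "\<bar>- y $ i * X j - X i * y $ j\<bar> \<le> 2 * Y"
    proof -
      have "\<bar>y $ i * X j\<bar> \<le> Y * 1" "\<bar>X i * y $ j\<bar> \<le> 1 * Y"
        unfolding abs_mult by (intro mult_mono yb Xb Y; simp)+
      then show ?thesis by linarith
    qed
    have XX: "\<bar>X i * X j\<bar> \<le> 1" unfolding abs_mult using mult_mono[OF Xb[of i] Xb[of j]] by simp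
    have yy: "\<bar>y $ i * y $ j\<bar> \<le> Y\<^sup>2" unfolding abs_mult power2_eq_square by (intro mult_mono yb Y) auto
    have SS: "S\<^sup>2 \<le> 4 * Y\<^sup>2" using power_mono[OF Sb, of 2] by (simp add: power_mult_distrib)
    have yXS: "\<bar>(- y $ i * X j - X i * y $ j) * S\<bar> \<le> 4 * Y\<^sup>2"
      unfolding abs_mult using mult_mono[OF yX Sb] Y by (simp add: power2_eq_square)
    have d: "0 \<le> d" "d \<le> 1" by (simp_all add: d_def)
    let ?A = "n * (- y $ i * X j - X i * y $ j) - n * (m + 1) * (X i * X j) * S + d * m * S"
    have 1: "G' t = \<kappa> * (r * w * ?A)"
      unfolding G'_def w1 w2 aX sS wv by (simp add: algebra_simps)
    have "\<bar>?A\<bar> \<le> n * (2 * Y) + n * (m + 1) * (1 * (2 * Y)) + 1 * m * (2 * Y)"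
    proof -
      have "\<bar>n * (- y $ i * X j - X i * y $ j)\<bar> \<le> n * (2 * Y)"
        unfolding abs_mult[of n] using yX n by (intro mult_mono) auto
      moreover have "\<bar>n * (m + 1) * (X i * X j) * S\<bar> \<le> n * (m + 1) * 1 * (2 * Y)"
        unfolding abs_mult[of _ S] abs_mult[of _ "X i * X j"] using XX Sb n m by (intro mult_mono) auto
      moreover have "\<bar>d * m * S\<bar> \<le> 1 * m * (2 * Y)"
        unfolding abs_mult[of _ S] using d m Sb by (intro mult_mono) (auto simp: abs_mult)
      ultimately show ?thesis by linarith
    qed
    also have "\<dots> \<le> C * Y"
    proof -
      have "0 \<le> n * (m + 1)" "0 \<le> n * (m + 1) * (4 * (m + 2) + 2)" "0 \<le> m * (4 * (m + 1))"
        using n m by simp_all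
      then have "2 * n + 2 * (n * (m + 1)) + 2 * m \<le> C" unfolding CC distrib_left[of m] by linarith
      from mult_right_mono[OF this Y] show ?thesis by (simp add: algebra_simps)
    qed
    finally have A: "\<bar>?A\<bar> \<le> C * Y" .
    have rw: "r * w = r powr (- (n + 1))"
    proof -
      have "r powr 1 * w = r powr (1 + - (n + 2))" unfolding w_def powr_add ..
      also have "1 + - (n + 2) = - (n + 1)" by simp
      finally show ?thesis using r by simp
    qed
    have "\<bar>G' t\<bar> = \<bar>\<kappa>\<bar> * (r * w * \<bar>?A\<bar>)" unfolding 1 abs_mult using r w by simp
    also have "\<dots> \<le> \<bar>\<kappa>\<bar> * (r * w * (C * Y))" using r w A by (intro mult_left_mono) auto
    finally have b1: "\<bar>G' t\<bar> \<le> \<bar>\<kappa>\<bar> * C * Y * r powr (- (n + 1))" unfolding rw by (simp add: mult_ac)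
    let ?B = "2 * n * (y $ i * y $ j) - 2 * n * (m + 1) * ((- y $ i * X j - X i * y $ j) * S)
      + n * (m + 1) * ((X i * X j) * ((m + 2) * S\<^sup>2 - 2 * Y\<^sup>2)) + d * m * (2 * Y\<^sup>2 - (m + 1) * S\<^sup>2)"
    have 2: "G'' t = \<kappa> * (w * ?B)"
      unfolding G''_def w1 w2 w3 aX sS Y_def[symmetric] wv by (simp add: algebra_simps power2_eq_square)
    have "\<bar>?B\<bar> \<le> 2 * n * Y\<^sup>2 + 2 * n * (m + 1) * (4 * Y\<^sup>2) + n * (m + 1) * (1 * ((m + 2) * (4 * Y\<^sup>2) + 2 * Y\<^sup>2))
        + 1 * m * (2 * Y\<^sup>2 + (m + 1) * (4 * Y\<^sup>2))"
    proof -
      have "\<bar>2 * n * (y $ i * y $ j)\<bar> \<le> 2 * n * Y\<^sup>2"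
        unfolding abs_mult[of "2 * n"] using yy n by (intro mult_mono) auto
      moreover have "\<bar>2 * n * (m + 1) * ((- y $ i * X j - X i * y $ j) * S)\<bar> \<le> 2 * n * (m + 1) * (4 * Y\<^sup>2)"
        unfolding abs_mult[of "2 * n * (m + 1)"] using yXS n m by (intro mult_mono) auto
      moreover have q: "0 \<le> (m + 2) * S\<^sup>2" "(m + 2) * S\<^sup>2 \<le> (m + 2) * (4 * Y\<^sup>2)" "0 \<le> Y\<^sup>2"
          "0 \<le> (m + 1) * S\<^sup>2" "(m + 1) * S\<^sup>2 \<le> (m + 1) * (4 * Y\<^sup>2)"
        using m SS by (auto intro: mult_left_mono)
      have "\<bar>(m + 2) * S\<^sup>2 - 2 * Y\<^sup>2\<bar> \<le> (m + 2) * (4 * Y\<^sup>2) + 2 * Y\<^sup>2"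
        using q by linarith
      then have "\<bar>n * (m + 1) * ((X i * X j) * ((m + 2) * S\<^sup>2 - 2 * Y\<^sup>2))\<bar>
          \<le> n * (m + 1) * (1 * ((m + 2) * (4 * Y\<^sup>2) + 2 * Y\<^sup>2))"
        unfolding abs_mult[of "n * (m + 1)"] abs_mult[of "X i * X j"] using XX n m by (intro mult_mono) auto
      moreover have "\<bar>2 * Y\<^sup>2 - (m + 1) * S\<^sup>2\<bar> \<le> 2 * Y\<^sup>2 + (m + 1) * (4 * Y\<^sup>2)"
        using q by linarith
      then have "\<bar>d * m * (2 * Y\<^sup>2 - (m + 1) * S\<^sup>2)\<bar> \<le> 1 * m * (2 * Y\<^sup>2 + (m + 1) * (4 * Y\<^sup>2))"
        unfolding abs_mult[of "d * m"] using d m by (intro mult_mono) (auto simp: abs_mult)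
      ultimately show ?thesis by linarith
    qed
    also have "\<dots> \<le> C * Y\<^sup>2"
      unfolding CC by (simp add: algebra_simps)
    finally have B: "\<bar>?B\<bar> \<le> C * Y\<^sup>2" .
    have "\<bar>G'' t\<bar> = \<bar>\<kappa>\<bar> * (w * \<bar>?B\<bar>)" unfolding 2 abs_mult using w by simp
    also have "\<dots> \<le> \<bar>\<kappa>\<bar> * (w * (C * Y\<^sup>2))" using w B by (intro mult_left_mono) auto
    finally have b2: "\<bar>G'' t\<bar> \<le> \<bar>\<kappa>\<bar> * C * Y\<^sup>2 * r powr (- (n + 2))" unfolding w_def by (simp add: mult_ac)
    show ?thesis using b1 b2 unfolding r_def Y_def by simp
  qed
  have KG: "K \<kappa> i j (x - t *\<^sub>R y) = G t" if "x - t *\<^sub>R y \<noteq> 0" for t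
    unfolding K_eq_powr[OF that] G_def s_def a_def m_def d_def n_def by (simp add: mult.assoc)
  show ?thesis
  proof (intro exI allI impI)
    fix t assume t: "x - t *\<^sub>R y \<noteq> 0"
    then have st: "0 < s t" by (simp add: s_def)
    have "open {t. x - t *\<^sub>R y \<noteq> 0}"
      by (intro open_Collect_neq continuous_intros)
    then have "\<forall>\<^sub>F u in nhds t. x - u *\<^sub>R y \<noteq> 0"
      using t eventually_nhds_in_open by fastforce
    then have "\<forall>\<^sub>F u in nhds t. K \<kappa> i j (x - u *\<^sub>R y) = G u"
      by eventually_elim (rule KG)
    then have "((\<lambda>t. K \<kappa> i j (x - t *\<^sub>R y)) has_real_derivative G' t) (at t)"
      using G_deriv[OF st] by (subst DERIV_cong_ev[OF refl _ refl])
    then show "((\<lambda>t. K \<kappa> i j (x - t *\<^sub>R y)) has_real_derivative G' t) (at t) \<and>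
     (G' has_real_derivative G'' t) (at t) \<and>
     \<bar>G' t\<bar> \<le> \<bar>\<kappa>\<bar> * C * norm y * norm (x - t *\<^sub>R y) powr (- (n + 1)) \<and>
     \<bar>G'' t\<bar> \<le> \<bar>\<kappa>\<bar> * C * (norm y)\<^sup>2 * norm (x - t *\<^sub>R y) powr (- (n + 2))"
      using G'_deriv[OF st] bounds[OF st] by blast
  qed
qed

lemma K_minus: "K \<kappa> i j (- x) = K \<kappa> i j x"
  by (simp add: K_def)

lemma differentiable_K:
  fixes z :: "real^'n"
  assumes "z \<noteq> 0"
  shows "K \<kappa> i j differentiable (at z)"
proof -
  have c: "(\<lambda>y::real^'n. y $ k) differentiable (at z)" for k
    by (rule bounded_linear_imp_differentiable[OF bounded_linear_vec_nth])
  have N: "(norm :: real^'n \<Rightarrow> real) differentiable (at z)"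
    using has_derivative_norm[OF assms] by (auto simp: differentiable_def)
  show ?thesis
    unfolding K_def[abs_def]
    by (cases "i = j") (auto intro!: derivative_intros c N simp: assms)
qed

text \<open>The last two bounds are the remainders of the Taylor polynomials of degree 0 and 1 that
  \<open>far_kernel\<close> subtracts in its two cases. Since \<open>K\<close> is even,
  \<open>K (y - z)\<close> is the value at \<open>z - y\<close>, the far end of a segment starting
  at \<open>z\<close>.\<close>

lemma K_taylor:
  fixes i j :: "'n::finite"
  obtains C where "0 \<le> C"
    "\<And>y z :: real^'n. z \<noteq> 0 \<Longrightarrow> \<bar>frechet_derivative (K \<kappa> i j) (at z) y\<bar> \<le> C * norm y * norm z powr (- (real CARD('n) + 1))"
    "\<And>y z :: real^'n. z \<noteq> 0 \<Longrightarrow> 2 * norm y \<le> norm z \<Longrightarrow>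
       \<bar>K \<kappa> i j (y - z) - K \<kappa> i j z\<bar> \<le> C * norm y * norm z powr (- (real CARD('n) + 1))"
    "\<And>y z :: real^'n. z \<noteq> 0 \<Longrightarrow> 2 * norm y \<le> norm z \<Longrightarrow>
       \<bar>K \<kappa> i j (y - z) - (K \<kappa> i j z - frechet_derivative (K \<kappa> i j) (at z) y)\<bar>
          \<le> C * (norm y)\<^sup>2 * norm z powr (- (real CARD('n) + 2))"
proof -
  define n where "n = real CARD('n)"
  define C where "C = \<bar>\<kappa>\<bar> * (2 * n + 8 * n * (n / 2 + 1) + n * (n / 2 + 1) * (4 * (n / 2 + 2) + 2) + (n / 2) * (4 * (n / 2 + 1) + 2))"
  have n: "0 < n" by (simp add: n_def)
  have C: "0 \<le> C" using n by (simp add: C_def)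
  have C2: "C \<le> C * 2 powr (n + 2)" and C1: "C * 2 powr (n + 1) \<le> C * 2 powr (n + 2)"
    using C n by (auto intro!: mult_left_mono mult_right_le_one_le simp: mult_le_cancel_left1 ge_one_powr_ge_zero)
  have main: "\<bar>frechet_derivative (K \<kappa> i j) (at z) y\<bar> \<le> C * norm y * norm z powr (- (n + 1)) \<and>
    (2 * norm y \<le> norm z \<longrightarrow> \<bar>K \<kappa> i j (y - z) - K \<kappa> i j z\<bar> \<le> C * 2 powr (n + 1) * norm y * norm z powr (- (n + 1)) \<and>
     \<bar>K \<kappa> i j (y - z) - (K \<kappa> i j z - frechet_derivative (K \<kappa> i j) (at z) y)\<bar>
          \<le> C * 2 powr (n + 2) * (norm y)\<^sup>2 * norm z powr (- (n + 2)))" if z: "z \<noteq> 0" for y z :: "real^'n"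
  proof -
    let ?D = "frechet_derivative (K \<kappa> i j) (at z)"
    obtain g' g'' where g: "\<And>t. z - t *\<^sub>R y \<noteq> 0 \<Longrightarrow>
       ((\<lambda>t. K \<kappa> i j (z - t *\<^sub>R y)) has_real_derivative g' t) (at t) \<and>
       (g' has_real_derivative g'' t) (at t) \<and>
       \<bar>g' t\<bar> \<le> C * norm y * norm (z - t *\<^sub>R y) powr (- (n + 1)) \<and>
       \<bar>g'' t\<bar> \<le> C * (norm y)\<^sup>2 * norm (z - t *\<^sub>R y) powr (- (n + 2))"
      using K_line_derivs[of z y \<kappa> i j] unfolding C_def n_def by blast
    have KD: "(K \<kappa> i j has_derivative ?D) (at z)"
      using differentiable_K[OF z] by (simp add: frechet_derivative_works)
    have "((\<lambda>t. K \<kappa> i j (z - t *\<^sub>R y)) has_derivative (\<lambda>t. ?D (- (t *\<^sub>R y)))) (at 0)"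
      by (rule has_derivative_compose[of "\<lambda>t. z - t *\<^sub>R y" "\<lambda>t. - (t *\<^sub>R y)" _ _ "K \<kappa> i j" ?D])
         (use KD in \<open>auto intro!: derivative_eq_intros\<close>)
    moreover have "(\<lambda>t. ?D (- (t *\<^sub>R y))) = (*) (- ?D y)"
      using has_derivative_linear[OF KD] by (simp add: fun_eq_iff linear_neg linear_cmul)
    ultimately have "((\<lambda>t. K \<kappa> i j (z - t *\<^sub>R y)) has_real_derivative - ?D y) (at 0)"
      by (simp only: has_field_derivative_def)
    then have g'0: "g' 0 = - ?D y"
      using g[of 0] z DERIV_unique by fastforce
    show ?thesis
    proof (intro conjI impI)
      show "\<bar>?D y\<bar> \<le> C * norm y * norm z powr (- (n + 1))"
        using g[of 0] z g'0 by simp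
    next
      assume yz: "2 * norm y \<le> norm z"
      \<comment> \<open>The segment stays at distance at least \<open>norm z / 2\<close> from the
        singularity, which is the source of the powers of 2 in the constant.\<close>
      have ge: "norm z / 2 \<le> norm (z - t *\<^sub>R y)" if "0 \<le> t" "t \<le> 1" for t
      proof -
        have "norm (t *\<^sub>R y) \<le> norm y" using that by (simp add: mult_left_le_one_le)
        then show ?thesis using norm_triangle_ineq2[of z "t *\<^sub>R y"] yz by linarith
      qed
      have nz: "z - t *\<^sub>R y \<noteq> 0" if "0 \<le> t" "t \<le> 1" for t
        using ge[OF that] z by (metis norm_eq_zero less_le_not_le zero_less_norm_iff half_gt_zero)
      have pw: "norm (z - t *\<^sub>R y) powr (- p) \<le> 2 powr p * norm z powr (- p)" if "0 \<le> t" "t \<le> 1" "0 \<le> p" for t p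
      proof -
        have "norm (z - t *\<^sub>R y) powr (- p) \<le> (norm z / 2) powr (- p)"
          using ge[OF that(1,2)] that z by (intro powr_mono2') auto
        also have "\<dots> = 2 powr p * norm z powr (- p)"
          by (simp add: powr_divide powr_minus field_simps)
        finally show ?thesis .
      qed
      have K1: "K \<kappa> i j (y - z) = K \<kappa> i j (z - 1 *\<^sub>R y)"
        using K_minus[of \<kappa> i j "y - z"] by simp
      have b1: "\<bar>g' t\<bar> \<le> C * 2 powr (n + 1) * norm y * norm z powr (- (n + 1))" if "0 \<le> t" "t \<le> 1" for t
      proof -
        have "\<bar>g' t\<bar> \<le> C * norm y * norm (z - t *\<^sub>R y) powr (- (n + 1))" using g[OF nz[OF that]] by simp
        also have "\<dots> \<le> C * norm y * (2 powr (n + 1) * norm z powr (- (n + 1)))"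
          using pw[OF that, of "n + 1"] C n by (intro mult_left_mono) auto
        finally show ?thesis by (simp only: mult_ac)
      qed
      have b2: "\<bar>g'' t\<bar> \<le> C * 2 powr (n + 2) * (norm y)\<^sup>2 * norm z powr (- (n + 2))" if "0 \<le> t" "t \<le> 1" for t
      proof -
        have "\<bar>g'' t\<bar> \<le> C * (norm y)\<^sup>2 * norm (z - t *\<^sub>R y) powr (- (n + 2))" using g[OF nz[OF that]] by simp
        also have "\<dots> \<le> C * (norm y)\<^sup>2 * (2 powr (n + 2) * norm z powr (- (n + 2)))"
          using pw[OF that, of "n + 2"] C n by (intro mult_left_mono) auto
        finally show ?thesis by (simp only: mult_ac)
      qed
      \<comment> \<open>The mean value theorem is used twice, for the kernel and then for its
        derivative between 0 and \<open>t\<close>. The factor \<open>t\<close> is later bounded by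
        1.\<close>
      obtain t where t: "0 < t" "t < 1" and gt: "K \<kappa> i j (z - 1 *\<^sub>R y) - K \<kappa> i j (z - 0 *\<^sub>R y) = (1 - 0) * g' t"
        using MVT2[of 0 1 "\<lambda>t. K \<kappa> i j (z - t *\<^sub>R y)" g'] g nz by auto
      obtain u where u: "0 < u" "u < t" and gu: "g' t - g' 0 = (t - 0) * g'' u"
        using MVT2[of 0 t g' g''] g nz t by (metis less_imp_le less_trans order_trans)
      show "\<bar>K \<kappa> i j (y - z) - K \<kappa> i j z\<bar> \<le> C * 2 powr (n + 1) * norm y * norm z powr (- (n + 1))"
        using gt b1[of t] t unfolding K1 by simp
      have "K \<kappa> i j (y - z) - (K \<kappa> i j z - ?D y) = t * g'' u"
        using gt gu unfolding K1 by (simp add: g'0)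
      also have "\<bar>t * g'' u\<bar> \<le> 1 * \<bar>g'' u\<bar>"
        unfolding abs_mult using t by (intro mult_right_mono) auto
      finally show "\<bar>K \<kappa> i j (y - z) - (K \<kappa> i j z - ?D y)\<bar>
          \<le> C * 2 powr (n + 2) * (norm y)\<^sup>2 * norm z powr (- (n + 2))"
        using b2[of u] u t by linarith
    qed
  qed
  show thesis
  proof (rule that[of "C * 2 powr (n + 2)"])
    show "0 \<le> C * 2 powr (n + 2)" using C by simp
  next
    fix y z :: "real^'n" assume z: "z \<noteq> 0"
    have "C * (norm y * norm z powr (- (n + 1))) \<le> C * 2 powr (n + 2) * (norm y * norm z powr (- (n + 1)))"
      using C2 by (intro mult_right_mono) auto
    then show "\<bar>frechet_derivative (K \<kappa> i j) (at z) y\<bar> \<le> C * 2 powr (n + 2) * norm y * norm z powr (- (real CARD('n) + 1))"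
      using main[OF z, of y] unfolding n_def[symmetric] by (simp add: mult.assoc)
  next
    fix y z :: "real^'n" assume z: "z \<noteq> 0" and yz: "2 * norm y \<le> norm z"
    have "C * 2 powr (n + 1) * (norm y * norm z powr (- (n + 1))) \<le> C * 2 powr (n + 2) * (norm y * norm z powr (- (n + 1)))"
      using C1 by (intro mult_right_mono) auto
    then show "\<bar>K \<kappa> i j (y - z) - K \<kappa> i j z\<bar> \<le> C * 2 powr (n + 2) * norm y * norm z powr (- (real CARD('n) + 1))"
      using main[OF z, of y] yz unfolding n_def[symmetric] by (simp add: mult.assoc)
    show "\<bar>K \<kappa> i j (y - z) - (K \<kappa> i j z - frechet_derivative (K \<kappa> i j) (at z) y)\<bar>
          \<le> C * 2 powr (n + 2) * (norm y)\<^sup>2 * norm z powr (- (real CARD('n) + 2))"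
      using main[OF z, of y] yz unfolding n_def[symmetric] by simp
  qed
qed

section \<open>The profile equation\<close>

lemma Ck_Suc_differentiable: "Ck (Suc k) f \<Longrightarrow> f differentiable (at x)"
  by simp

lemma Ck_Suc_partial: "Ck (Suc k) f \<Longrightarrow> Ck k (\<lambda>x. frechet_derivative f (at x) (axis i 1))"
  by simp

lemma Ck_continuous: "Ck k f \<Longrightarrow> continuous_on UNIV f"
  by (cases k) (auto simp: continuous_at_imp_continuous_on differentiable_imp_continuous_within)

text \<open>Every point lies in the rescaled ball at some time close to \<open>T\<close>, so
  equations valid on the ball give equations for the profile on the whole space.\<close>

lemma time_near_blowup:
  fixes T \<rho> m b :: real
  assumes "0 < T" "0 < \<rho>" "0 < b" "0 \<le> m"
  obtains t where "0 < t" "t < T" "m * (T - t) powr b < \<rho>"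
proof -
  have "((\<lambda>r. m * r powr b) \<longlongrightarrow> m * 0 powr b) (at_right 0)"
    using assms by (intro tendsto_mult tendsto_const tendsto_powr2) (auto intro: eventually_mono[OF eventually_at_right_less])
  then have "\<forall>\<^sub>F r in at_right 0. m * r powr b < \<rho>"
    using assms by (intro order_tendstoD(2)[of _ "m * 0 powr b"]) auto
  moreover have "\<forall>\<^sub>F r in at_right (0::real). r < T"
    using assms by (intro eventually_at_rightI[of 0 T]) auto
  ultimately have "\<forall>\<^sub>F r in at_right 0. r < T \<and> m * r powr b < \<rho> \<and> 0 < r"
    using eventually_at_right_less by eventually_elim auto
  then obtain r where "r < T" "m * r powr b < \<rho>" "0 < r"
    using eventually_happens[of _ "at_right (0::real)"] by auto
  then show thesis using that[of "T - r"] by auto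
qed

lemma has_derivative_cong_nhds:
  assumes "(f has_derivative D) (at x)" "\<forall>\<^sub>F y in nhds x. f y = g y"
  shows "(g has_derivative D) (at x)"
  using assms by (auto simp: eventually_nhds intro: has_derivative_transform_within_open)

text \<open>Fix \<open>y\<close> and choose a time at which it lies in the rescaled ball. The Euler
  equations at the corresponding space-time point are the profile equations at \<open>y\<close>, up
  to one common power of \<open>T - t\<close>.\<close>

lemma profile_equations:
  fixes u :: "real^'n \<Rightarrow> real^'n" and q :: "real^'n \<Rightarrow> real"
  assumes ss: "locally_self_similar \<kappa> \<alpha> u q v p" and \<alpha>: "-1 < \<alpha>"
    and u: "\<And>x. u differentiable (at x)"
  obtains gq where "\<And>y. GDERIV q y :> gq y"
    "\<And>y. \<alpha> *\<^sub>R u y + frechet_derivative u (at y) y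
        + (1 + \<alpha>) *\<^sub>R (frechet_derivative u (at y) (u y) + gq y) = 0"
    "\<And>y. divergence u y = 0"
proof -
  from ss obtain s T x0 \<rho> d where E: "euler_solution \<kappa> s T v p" and \<rho>: "0 < \<rho>"
    and V: "\<And>t x. t \<in> {0<..<T} \<Longrightarrow> x \<in> cball x0 \<rho> \<Longrightarrow> v t x = (1 / (T - t) powr (\<alpha> / (\<alpha> + 1))) *\<^sub>R
                  u ((1 / (T - t) powr (1 / (\<alpha> + 1))) *\<^sub>R (x - x0))"
    and P: "\<And>t x. t \<in> {0<..<T} \<Longrightarrow> x \<in> cball x0 \<rho> \<Longrightarrow> p t x = (1 / (T - t) powr (2 * \<alpha> / (\<alpha> + 1))) *
                  q ((1 / (T - t) powr (1 / (\<alpha> + 1))) *\<^sub>R (x - x0)) + d t"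
    unfolding locally_self_similar_def by blast
  have T: "0 < T" using E by (simp add: euler_solution_def)
  define b where "b = 1 / (\<alpha> + 1)"
  define a where "a = \<alpha> / (\<alpha> + 1)"
  have b: "0 < b" using \<alpha> by (simp add: b_def)
  have ab: "a + b = 1" using \<alpha> by (simp add: a_def b_def field_simps)
  have inv: "1 / r powr c = r powr (- c)" for r c :: real by (simp add: powr_minus_divide)
  have a2: "2 * \<alpha> / (\<alpha> + 1) = 2 * a" by (simp add: a_def)
  note V = V[folded a_def b_def, unfolded inv]
  note P = P[folded b_def, unfolded a2 inv]
  have "\<exists>gq. GDERIV q y :> gq \<and> \<alpha> *\<^sub>R u y + frechet_derivative u (at y) y
        + (1 + \<alpha>) *\<^sub>R (frechet_derivative u (at y) (u y) + gq) = 0 \<and> divergence u y = 0" for y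
  proof -
    let ?D = "frechet_derivative u (at y)"
    have D: "(u has_derivative ?D) (at y)" using u frechet_derivative_works by blast
    then have lin: "linear ?D" by (rule has_derivative_linear)
    obtain t where t: "0 < t" "t < T" and ty: "norm y * (T - t) powr b < \<rho>"
      using time_near_blowup[OF T \<rho> b norm_ge_zero[of y]] by blast
    define r where "r = T - t"
    have r: "0 < r" using t by (simp add: r_def)
    define x where "x = x0 + r powr b *\<^sub>R y"
    have rr: "r powr (- b) * r powr b = 1" using r by (simp add: powr_minus)
    have xy: "r powr (- b) *\<^sub>R (x - x0) = y" by (simp add: x_def rr)
    have x: "dist x0 x < \<rho>" using ty by (simp add: x_def dist_norm r_def mult.commute)
    have tin: "t \<in> {0<..<T}" "t \<in> {0..<T}" using t by auto
    \<comment> \<open>\<open>x\<close> is interior to the ball, so the self-similar form holds on a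
      neighbourhood and may be differentiated in space.\<close>
    have near: "\<forall>\<^sub>F x' in nhds x. x' \<in> cball x0 \<rho>"
      using eventually_nhds_in_open[OF open_ball, of x x0 \<rho>] x by (auto elim: eventually_mono)
    have nearv: "\<forall>\<^sub>F x' in nhds x. v t x' = r powr (- a) *\<^sub>R u (r powr (- b) *\<^sub>R (x' - x0))"
      using near by eventually_elim (simp add: V[OF tin(1)] r_def)
    have Du': "(u has_derivative ?D) (at (r powr (- b) *\<^sub>R (x - x0)))" using D by (simp add: xy)
    have "((\<lambda>x'. r powr (- a) *\<^sub>R u (r powr (- b) *\<^sub>R (x' - x0))) has_derivative
        (\<lambda>h. r powr (- a) *\<^sub>R ?D (r powr (- b) *\<^sub>R h))) (at x)"
      by (intro has_derivative_scaleR_right has_derivative_compose[of "\<lambda>x'. r powr (- b) *\<^sub>R (x' - x0)" "\<lambda>h. r powr (- b) *\<^sub>R h", OF _ Du'])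
         (auto intro!: derivative_eq_intros)
    then have Dv: "(v t has_derivative (\<lambda>h. r powr (- a) *\<^sub>R ?D (r powr (- b) *\<^sub>R h))) (at x)"
      by (rule has_derivative_cong_nhds) (use nearv in \<open>auto elim: eventually_mono\<close>)
    have Dv': "frechet_derivative (v t) (at x) h = (r powr (- a) * r powr (- b)) *\<^sub>R ?D h" for h
      using lin by (simp add: frechet_derivative_at[OF Dv, symmetric] linear_cmul)
    obtain vt gp where vt: "((\<lambda>\<tau>. v \<tau> x) has_vector_derivative vt) (at t within {0..<T})"
      and gp: "GDERIV (p t) x :> gp" and eul: "vt + frechet_derivative (v t) (at x) (v t x) + gp = 0"
      and div0: "divergence (v t) x = 0"
      using E tin(2) unfolding euler_solution_def by blast
    have "divergence (v t) x = (r powr (- a) * r powr (- b)) * divergence u y"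
      unfolding divergence_def Dv' by (simp add: sum_distrib_left)
    then have divu: "divergence u y = 0" using div0 r by simp
    have vx: "v t x = r powr (- a) *\<^sub>R u y"
      using V[OF tin(1), of x] x by (simp add: xy r_def[symmetric])
    have Dvv: "frechet_derivative (v t) (at x) (v t x) = (r powr (- a) * r powr (- b) * r powr (- a)) *\<^sub>R ?D (u y)"
      unfolding Dv' vx using lin by (simp add: linear_cmul)
    have "((\<lambda>\<tau>. v \<tau> x) has_vector_derivative
        (r powr (- a) *\<^sub>R ?D ((b * r powr (- b - 1)) *\<^sub>R (x - x0)) + (a * r powr (- a - 1)) *\<^sub>R u y)) (at t)"
    proof -
      have pw: "((\<lambda>\<tau>. (T - \<tau>) powr (- c)) has_real_derivative c * r powr (- c - 1)) (at t)" for c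
        using r unfolding r_def by (auto intro!: derivative_eq_intros simp: powr_diff)
      have "((\<lambda>\<tau>. (T - \<tau>) powr (- b) *\<^sub>R (x - x0)) has_derivative
          (\<lambda>h. (h * (b * r powr (- b - 1))) *\<^sub>R (x - x0))) (at t)"
      proof (rule has_derivative_scaleR_left)
        show "((\<lambda>\<tau>. (T - \<tau>) powr (- b)) has_derivative (\<lambda>h. h * (b * r powr (- b - 1)))) (at t)"
          by (rule has_derivative_eq_rhs[OF pw[of b, unfolded has_field_derivative_def]]) (simp add: fun_eq_iff)
      qed
      then have "((\<lambda>\<tau>. u ((T - \<tau>) powr (- b) *\<^sub>R (x - x0))) has_derivative
          (\<lambda>h. ?D ((h * (b * r powr (- b - 1))) *\<^sub>R (x - x0)))) (at t)"
        by (rule has_derivative_compose) (use D in \<open>simp add: xy r_def[symmetric]\<close>)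
      then have "((\<lambda>\<tau>. u ((T - \<tau>) powr (- b) *\<^sub>R (x - x0))) has_vector_derivative
          ?D ((b * r powr (- b - 1)) *\<^sub>R (x - x0))) (at t)"
        unfolding has_vector_derivative_def using lin
        by (auto elim!: has_derivative_eq_rhs simp: linear_cmul fun_eq_iff)
      from has_vector_derivative_scaleR[OF pw[of a] this]
      have "((\<lambda>\<tau>. (T - \<tau>) powr (- a) *\<^sub>R u ((T - \<tau>) powr (- b) *\<^sub>R (x - x0))) has_vector_derivative
        (r powr (- a) *\<^sub>R ?D ((b * r powr (- b - 1)) *\<^sub>R (x - x0)) + (a * r powr (- a - 1)) *\<^sub>R u y)) (at t)"
        by (simp add: xy r_def[symmetric])
      moreover have "\<forall>\<^sub>F \<tau> in nhds t. v \<tau> x = (T - \<tau>) powr (- a) *\<^sub>R u ((T - \<tau>) powr (- b) *\<^sub>R (x - x0))"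
        using eventually_nhds_in_open[OF open_greaterThanLessThan tin(1)]
        by eventually_elim (use V x in auto)
      ultimately show ?thesis
        unfolding has_vector_derivative_def
        by (elim has_derivative_cong_nhds) (auto elim: eventually_mono)
    qed
    \<comment> \<open>The chosen time is interior, so the derivative relative to the half-open time
      interval is the two-sided one.\<close>
    moreover have "at t within {0..<T} = at t"
      using t by (intro at_within_interior) simp
    ultimately have vt_eq: "vt = r powr (- a) *\<^sub>R ?D ((b * r powr (- b - 1)) *\<^sub>R (x - x0)) + (a * r powr (- a - 1)) *\<^sub>R u y"
      using vt vector_derivative_unique_at by fastforce
    \<comment> \<open>As \<open>a + b = 1\<close>, the time derivative, the convective term and the
      pressure gradient all scale with this same power of \<open>r\<close>, which can then be
      divided out.\<close>
    define w where "w = r powr (- a - 1)"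
    have w: "w \<noteq> 0" using r by (simp add: w_def)
    have x0: "x - x0 = r powr b *\<^sub>R y" by (simp add: x_def)
    have e1: "r powr (- a) * (b * r powr (- b - 1) * r powr b) = b * w"
    proof -
      have "r powr (- a) * (r powr (- b - 1) * r powr b) = w"
        unfolding w_def by (simp only: powr_add[symmetric]) simp
      then show ?thesis by (metis mult.assoc mult.left_commute)
    qed
    have e2: "r powr (- a) * r powr (- b) * r powr (- a) = w"
    proof -
      have "- a + - b + - a = - a - 1" using ab by simp
      then show ?thesis unfolding w_def by (simp only: powr_add[symmetric])
    qed
    have vt2: "vt = w *\<^sub>R (b *\<^sub>R ?D y + a *\<^sub>R u y)"
    proof -
      have "?D ((b * r powr (- b - 1)) *\<^sub>R (x - x0)) = (b * r powr (- b - 1) * r powr b) *\<^sub>R ?D y"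
        unfolding x0 scaleR_scaleR using lin by (simp add: linear_cmul)
      then show ?thesis unfolding vt_eq scaleR_scaleR e1 w_def[symmetric]
        by (simp add: scaleR_add_right e1 mult.commute[of w])
    qed
    \<comment> \<open>Inverting the scaling gives
      \<open>q y' = r powr (2 * a) * (p t x' - d t)\<close> at
      \<open>x' = x0 + r powr b *\<^sub>R y'\<close>; the chain rule supplies the further factor
      \<open>r powr b\<close>.\<close>
    define gq where "gq = (r powr (2 * a) * r powr b) *\<^sub>R gp"
    have ww: "(r powr (2 * a) * r powr b) * w = 1"
    proof -
      have "2 * a + b + (- a - 1) = 0" using ab by simp
      then show ?thesis unfolding w_def powr_add[symmetric] using r by simp
    qed
    have "GDERIV q y :> gq"
    proof -
      have neary: "\<forall>\<^sub>F y' in nhds y. q y' = r powr (2 * a) * (p t (x0 + r powr b *\<^sub>R y') - d t)"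
      proof -
        have "open {y'. dist x0 (x0 + r powr b *\<^sub>R y') < \<rho>}"
          by (intro open_Collect_less continuous_intros)
        then have "\<forall>\<^sub>F y' in nhds y. dist x0 (x0 + r powr b *\<^sub>R y') < \<rho>"
          using eventually_nhds_in_open[of "{y'. dist x0 (x0 + r powr b *\<^sub>R y') < \<rho>}" y] x by (simp add: x_def)
        then show ?thesis
        proof eventually_elim
          case (elim y')
          then have "p t (x0 + r powr b *\<^sub>R y') = r powr (- (2 * a)) * q y' + d t"
            using P[OF tin(1), of "x0 + r powr b *\<^sub>R y'"] by (simp add: rr r_def[symmetric])
          then show ?case using r by (simp add: powr_minus)
        qed
      qed
      have Dp: "(p t has_derivative (\<bullet>) gp) (at (x0 + r powr b *\<^sub>R y))"
      proof -
        have "(\<bullet>) gp = (\<lambda>h. h \<bullet> gp)" by (simp add: fun_eq_iff inner_commute)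
        then show ?thesis using gp by (simp add: gderiv_def x_def)
      qed
      have "((\<lambda>y'. p t (x0 + r powr b *\<^sub>R y')) has_derivative (\<lambda>h. gp \<bullet> (r powr b *\<^sub>R h))) (at y)"
        by (rule has_derivative_compose[of "\<lambda>y'. x0 + r powr b *\<^sub>R y'" "\<lambda>h. r powr b *\<^sub>R h" y UNIV "p t" "(\<bullet>) gp", OF _ Dp])
           (auto intro!: derivative_eq_intros)
      then have "((\<lambda>y'. r powr (2 * a) * (p t (x0 + r powr b *\<^sub>R y') - d t)) has_derivative (\<lambda>h. h \<bullet> gq)) (at y)"
        by (auto intro!: derivative_eq_intros simp: gq_def inner_commute)
      then show ?thesis unfolding gderiv_def
        by (rule has_derivative_cong_nhds) (use neary in \<open>auto elim: eventually_mono\<close>)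
    qed
    moreover have "\<alpha> *\<^sub>R u y + ?D y + (1 + \<alpha>) *\<^sub>R (?D (u y) + gq) = 0"
    proof -
      have "gp = w *\<^sub>R gq" unfolding gq_def scaleR_scaleR using ww by (simp add: mult.commute)
      then have "w *\<^sub>R ((b *\<^sub>R ?D y + a *\<^sub>R u y) + ?D (u y) + gq) = 0"
        using eul unfolding vt2 Dvv e2 by (simp add: scaleR_add_right)
      then have "(b *\<^sub>R ?D y + a *\<^sub>R u y) + ?D (u y) + gq = 0" using w by simp
      then have "(1 + \<alpha>) *\<^sub>R ((b *\<^sub>R ?D y + a *\<^sub>R u y) + ?D (u y) + gq) = 0" by simp
      then have "((1 + \<alpha>) * b) *\<^sub>R ?D y + ((1 + \<alpha>) * a) *\<^sub>R u y + (1 + \<alpha>) *\<^sub>R (?D (u y) + gq) = 0"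
        by (simp only: scaleR_add_right scaleR_scaleR add.assoc)
      moreover have "(1 + \<alpha>) * b = 1" "(1 + \<alpha>) * a = \<alpha>" using \<alpha> by (simp_all add: a_def b_def add.commute)
      ultimately show ?thesis by (simp add: add.commute)
    qed
    ultimately show ?thesis using divu by blast
  qed
  then have "\<forall>y. \<exists>gq. GDERIV q y :> gq \<and> \<alpha> *\<^sub>R u y + frechet_derivative u (at y) y
        + (1 + \<alpha>) *\<^sub>R (frechet_derivative u (at y) (u y) + gq) = 0 \<and> divergence u y = 0" ..
  from choice[OF this] show thesis using that by blast
qed

section \<open>The local energy identity\<close>

lemma integrable_continuous_compact_support:
  fixes f :: "'a::euclidean_space \<Rightarrow> real"
  assumes f: "continuous_on UNIV f" and z: "\<And>x. R < norm x \<Longrightarrow> f x = 0"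
  shows "integrable lborel f"
proof -
  have "integrable lborel (\<lambda>x. indicator (cball 0 R) x *\<^sub>R f x)"
    by (rule borel_integrable_compact) (auto intro: continuous_on_subset[OF f])
  moreover have "(\<lambda>x. indicator (cball 0 R) x *\<^sub>R f x) = f"
    using z by (auto simp: fun_eq_iff indicator_def not_le)
  ultimately show ?thesis by simp
qed

text \<open>The weight \<open>\<phi>(y/l)\<close> of the overview is the square of this function.
  The square is continuously differentiable, and its gradient
  \<open>- 4 y / l^2 * cutoff l y\<close> retains one bounded cutoff factor supported in the
  ball.\<close>

definition cutoff :: "real \<Rightarrow> 'a::real_normed_vector \<Rightarrow> real" where
  "cutoff l y = max 0 (1 - (norm y)\<^sup>2 / l\<^sup>2)"

lemma cutoff_nonneg: "0 \<le> cutoff l y" and cutoff_le_1: "cutoff l y \<le> 1"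
  by (simp_all add: cutoff_def)

lemma cutoff_eq_0: "0 < l \<Longrightarrow> l \<le> norm y \<Longrightarrow> cutoff l y = 0"
  by (simp add: cutoff_def max_def power_mono)

lemma continuous_cutoff: "continuous_on S (cutoff l)"
  unfolding cutoff_def[abs_def] divide_inverse by (intro continuous_intros)

lemma cutoff_scale: "0 < l \<Longrightarrow> cutoff l (l *\<^sub>R x) = cutoff 1 x"
  by (simp add: cutoff_def power_mult_distrib)

text \<open>Squaring removes the kink: at 0 the difference quotient is at most
  \<open>\<bar>h\<bar>\<close>, and elsewhere the function is locally 0 or a square.\<close>

lemma DERIV_max_0_square: "((\<lambda>s::real. (max 0 s)\<^sup>2) has_real_derivative 2 * max 0 s) (at s)"
proof -
  consider "s < 0" | "s = 0" | "0 < s" by linarith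
  then show ?thesis
  proof cases
    case 1
    have "((\<lambda>s::real. 0) has_real_derivative 0) (at s)" by simp
    moreover have "\<forall>\<^sub>F x in nhds s. (0::real) = (max 0 x)\<^sup>2"
      using eventually_nhds_in_open[of "{..<0}" s] 1 by (auto elim!: eventually_mono)
    ultimately show ?thesis using 1 by (subst (asm) DERIV_cong_ev[OF refl _ refl]) auto
  next
    case 2
    have "((\<lambda>h::real. (max 0 h)\<^sup>2 / h) \<longlongrightarrow> 0) (at 0)"
    proof (rule Lim_null_comparison[where g = "\<lambda>h. \<bar>h\<bar>"])
      show "\<forall>\<^sub>F h in at 0. norm ((max 0 h)\<^sup>2 / h) \<le> \<bar>h\<bar>"
        by (auto simp: eventually_at_filter max_def power2_eq_square)
      show "((\<lambda>h::real. \<bar>h\<bar>) \<longlongrightarrow> 0) (at 0)" by (rule tendsto_eq_intros refl)+ simp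
    qed
    then show ?thesis using 2 by (simp add: DERIV_def)
  next
    case 3
    have "((\<lambda>s::real. s\<^sup>2) has_real_derivative 2 * s) (at s)" by (auto intro!: derivative_eq_intros)
    moreover have "\<forall>\<^sub>F x in nhds s. x\<^sup>2 = (max 0 x)\<^sup>2"
      using eventually_nhds_in_open[of "{0<..}" s] 3 by (auto elim!: eventually_mono)
    ultimately show ?thesis using 3 by (subst (asm) DERIV_cong_ev[OF refl _ refl]) auto
  qed
qed

lemma cutoff_square_deriv:
  fixes x :: "real^'n"
  assumes "0 < l"
  shows "((\<lambda>t. (cutoff l (x + t *\<^sub>R axis i 1))\<^sup>2) has_real_derivative - 4 * x $ i / l\<^sup>2 * cutoff l x) (at 0)"
proof -
  have e: "(norm (x + t *\<^sub>R axis i 1))\<^sup>2 = (norm x)\<^sup>2 + 2 * t * x $ i + t\<^sup>2" for t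
    unfolding power2_norm_eq_inner
    by (simp add: inner_add_left inner_add_right inner_axis inner_axis' inner_axis_axis power2_eq_square algebra_simps)
  have "((\<lambda>t. 1 - ((norm x)\<^sup>2 + 2 * t * x $ i + t\<^sup>2) * inverse (l\<^sup>2)) has_real_derivative - 2 * x $ i * inverse (l\<^sup>2)) (at 0)"
    by (auto intro!: derivative_eq_intros)
  from DERIV_chain2[OF DERIV_max_0_square this] show ?thesis
    unfolding cutoff_def e by (simp add: mult_ac divide_inverse)
qed

lemma integral_lborel_scale:
  fixes g :: "'a::euclidean_space \<Rightarrow> real"
  assumes [measurable]: "g \<in> borel_measurable borel" and l: "0 < l"
  shows "(LINT x|lborel. g (l *\<^sub>R x)) = l powr (- real DIM('a)) * (LINT y|lborel. g y)"
proof -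
  have "(LINT y|lborel. g y) = (LINT y|density (distr lborel borel (\<lambda>x. 0 + l *\<^sub>R x)) (\<lambda>x. ennreal (\<bar>l\<bar> ^ DIM('a))). g y)"
    using lborel_affine[of l "0::'a"] l by simp
  also have "\<dots> = (LINT x|distr lborel borel (\<lambda>x. 0 + l *\<^sub>R x). l ^ DIM('a) * g x)"
    using l by (subst integral_density) auto
  also have "\<dots> = (LINT x|lborel. l ^ DIM('a) * g (l *\<^sub>R x))"
    by (subst integral_distr) auto
  also have "\<dots> = l powr real DIM('a) * (LINT x|lborel. g (l *\<^sub>R x))"
    using l by (simp add: powr_realpow)
  finally show ?thesis using l by (simp add: powr_minus)
qed

text \<open>The stationary problem that is left once time, blow-up point and ball have been
  eliminated. All further estimates live here.\<close>

locale euler_profile =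
  fixes u :: "real^'n \<Rightarrow> real^'n" and q :: "real^'n \<Rightarrow> real" and gq :: "real^'n \<Rightarrow> real^'n" and \<alpha> :: real
  assumes u_diff: "\<And>x. u differentiable (at x)"
    and Du_cont: "\<And>i. continuous_on UNIV (\<lambda>x. frechet_derivative u (at x) (axis i 1))"
    and q_grad: "\<And>y. GDERIV q y :> gq y"
    and profile_eq: "\<And>y. \<alpha> *\<^sub>R u y + frechet_derivative u (at y) y
        + (1 + \<alpha>) *\<^sub>R (frechet_derivative u (at y) (u y) + gq y) = 0"
    and div_free: "\<And>y. divergence u y = 0"
    and \<alpha>_gt: "-1 < \<alpha>"
begin

abbreviation "Du y h \<equiv> frechet_derivative u (at y) h"

lemma u_deriv: "(u has_derivative Du y) (at y)"
  using u_diff frechet_derivative_works by blast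

lemma Du_linear: "linear (frechet_derivative u (at y))"
  using u_deriv by (rule has_derivative_linear)

text \<open>Continuity of the derivative is available only for the partial derivatives; this
  expansion extends it to variable directions such as \<open>y\<close> and
  \<open>u y\<close>.\<close>

lemma Du_sum: "Du y h = (\<Sum>i\<in>UNIV. h $ i *\<^sub>R Du y (axis i 1))"
proof -
  have "Du y h = Du y (\<Sum>i\<in>UNIV. h $ i *\<^sub>R axis i 1)"
    by (simp add: basis_expansion[of h, simplified scalar_mult_eq_scaleR])
  also have "\<dots> = (\<Sum>i\<in>UNIV. h $ i *\<^sub>R Du y (axis i 1))"
    using Du_linear[of y] by (simp add: linear_sum linear_cmul)
  finally show ?thesis .
qed

lemma u_cont: "continuous_on S u"
  by (meson u_diff continuous_at_imp_continuous_on differentiable_imp_continuous_within)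

lemma u_meas [measurable]: "u \<in> borel_measurable borel"
  by (rule borel_measurable_continuous_onI[OF u_cont])

lemma q_cont: "continuous_on S q"
  using q_grad by (intro continuous_at_imp_continuous_on ballI) (metis gderiv_def has_derivative_continuous)

lemma Du_cont2:
  assumes "continuous_on S f" "continuous_on S g"
  shows "continuous_on S (\<lambda>x. Du (f x) (g x))"
  unfolding Du_sum[of _ "g _"]
  by (intro continuous_on_sum continuous_on_scaleR continuous_on_component assms
      continuous_on_compose2[OF Du_cont assms(1)] subset_UNIV)

text \<open>Differentiability of \<open>q\<close> gives no continuity of its gradient. Dividing the
  profile equation by \<open>1 + \<alpha>\<close>, which is positive, expresses the gradient through
  \<open>u\<close> and its first derivatives.\<close>

lemma gq_cont: "continuous_on S gq"
proof -
  have gq_eq: "gq = (\<lambda>y. (- 1 / (1 + \<alpha>)) *\<^sub>R (\<alpha> *\<^sub>R u y + Du y y) - Du y (u y))"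
  proof
    fix y
    have "(1 + \<alpha>) *\<^sub>R gq y = - (\<alpha> *\<^sub>R u y + Du y y) - (1 + \<alpha>) *\<^sub>R Du y (u y)"
    proof -
      have *: "c = - a - b" if "a + (b + c) = 0" for a b c :: "real^'n"
      proof -
        have "c = (a + (b + c)) - a - b" by simp
        then show ?thesis using that by simp
      qed
      show ?thesis
        by (rule *) (use profile_eq[of y] in \<open>simp only: scaleR_add_right add.assoc\<close>)
    qed
    then have "(1 / (1 + \<alpha>)) *\<^sub>R ((1 + \<alpha>) *\<^sub>R gq y) =
       (1 / (1 + \<alpha>)) *\<^sub>R (- (\<alpha> *\<^sub>R u y + Du y y) - (1 + \<alpha>) *\<^sub>R Du y (u y))" by simp
    then show "gq y = (- 1 / (1 + \<alpha>)) *\<^sub>R (\<alpha> *\<^sub>R u y + Du y y) - Du y (u y)"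
      using \<alpha>_gt by (simp add: scaleR_diff_right scaleR_add_right)
  qed
  show ?thesis
    unfolding gq_eq by (intro continuous_on_diff continuous_on_scaleR continuous_on_const continuous_on_add
      u_cont Du_cont2 continuous_on_id)
qed

text \<open>The divergence theorem for the compactly supported field
  \<open>H (cutoff l)^2 u\<close>. Because \<open>u\<close> is divergence free, the derivative falls
  only on \<open>H\<close> and on the weight.\<close>

lemma integral_transport_cutoff:
  fixes H :: "real^'n \<Rightarrow> real" and G :: "real^'n \<Rightarrow> real^'n"
  assumes H: "\<And>y. (H has_derivative (\<lambda>h. h \<bullet> G y)) (at y)" and G: "continuous_on UNIV G" and l: "0 < l"
  shows "(LINT y|lborel. (u y \<bullet> G y) * (cutoff l y)\<^sup>2) = 4 / l\<^sup>2 * (LINT y|lborel. H y * (u y \<bullet> y) * cutoff l y)"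
proof -
  have Hc: "continuous_on UNIV H"
    using H by (intro continuous_at_imp_continuous_on ballI) (metis has_derivative_continuous)
  note c = u_cont[of UNIV] Hc G Du_cont continuous_cutoff[of UNIV l]
  \<comment> \<open>The partial derivative in direction \<open>i\<close> of
    \<open>u y $ i * H y * (cutoff l y)^2\<close>; each of these integrates to 0 separately, and
    their sum is the identity sought.\<close>
  define f where "f i y = (Du y (axis i 1) $ i * H y + u y $ i * G y $ i) * (cutoff l y)\<^sup>2
      + u y $ i * H y * (- 4 * y $ i / l\<^sup>2 * cutoff l y)" for i y
  have fc: "continuous_on UNIV (f i)" for i
    unfolding f_def[abs_def] divide_inverse by (intro continuous_intros c)
  have fint: "integrable lborel (f i)" for i
    by (intro integrable_continuous_compact_support[OF fc, of l]) (simp add: f_def cutoff_eq_0[OF l less_imp_le])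
  have f0: "(LINT y|lborel. f i y) = 0" for i
  proof (rule integral_directional_derivative_eq_0[where e = "axis i 1", OF _ fc _ fint])
    show "integrable lborel (\<lambda>y. u y $ i * H y * (cutoff l y)\<^sup>2)"
      by (intro integrable_continuous_compact_support[of _ l] continuous_intros c) (simp_all add: cutoff_eq_0[OF l less_imp_le])
    fix x :: "real^'n"
    have line: "((\<lambda>t. x + t *\<^sub>R axis i 1) has_derivative (\<lambda>t. t *\<^sub>R axis i 1)) (at 0)"
      by (auto intro!: derivative_eq_intros)
    have "((\<lambda>t. u (x + t *\<^sub>R axis i 1) $ i) has_derivative (\<lambda>t. Du x (t *\<^sub>R axis i 1) $ i)) (at 0)"
      by (rule bounded_linear.has_derivative[OF bounded_linear_vec_nth], rule has_derivative_compose[OF line])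
         (use u_deriv[of x] in simp)
    then have 1: "((\<lambda>t. u (x + t *\<^sub>R axis i 1) $ i) has_real_derivative Du x (axis i 1) $ i) (at 0)"
      unfolding has_field_derivative_def using Du_linear[of x]
      by (auto elim!: has_derivative_eq_rhs simp: linear_cmul fun_eq_iff)
    have "((\<lambda>t. H (x + t *\<^sub>R axis i 1)) has_derivative (\<lambda>t. (t *\<^sub>R axis i 1) \<bullet> G x)) (at 0)"
      by (rule has_derivative_compose[OF line]) (use H[of x] in simp)
    then have 2: "((\<lambda>t. H (x + t *\<^sub>R axis i 1)) has_real_derivative G x $ i) (at 0)"
      unfolding has_field_derivative_def
      by (auto elim!: has_derivative_eq_rhs simp: inner_axis' fun_eq_iff)
    show "((\<lambda>t. u (x + t *\<^sub>R axis i 1) $ i * H (x + t *\<^sub>R axis i 1) * (cutoff l (x + t *\<^sub>R axis i 1))\<^sup>2)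
        has_real_derivative f i x) (at 0)"
      by (rule DERIV_cong[OF DERIV_mult[OF DERIV_mult[OF 1 2] cutoff_square_deriv[OF l]]])
         (simp add: f_def algebra_simps)
  qed
  have "(LINT y|lborel. (u y \<bullet> G y) * (cutoff l y)\<^sup>2 - 4 / l\<^sup>2 * (H y * (u y \<bullet> y) * cutoff l y)) = (LINT y|lborel. (\<Sum>i\<in>UNIV. f i y))"
  proof (intro Bochner_Integration.integral_cong refl)
    fix y
    have "(\<Sum>i\<in>UNIV. f i y) = (divergence u y * H y + u y \<bullet> G y) * (cutoff l y)\<^sup>2 - 4 / l\<^sup>2 * (H y * (u y \<bullet> y) * cutoff l y)"
      unfolding f_def divergence_def inner_vec_def
      by (simp add: sum.distrib sum_distrib_left sum_distrib_right sum_subtractf sum_negf algebra_simps sum_divide_distrib)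
    then show "(u y \<bullet> G y) * (cutoff l y)\<^sup>2 - 4 / l\<^sup>2 * (H y * (u y \<bullet> y) * cutoff l y) = (\<Sum>i\<in>UNIV. f i y)"
      by (simp add: div_free)
  qed
  also have "\<dots> = 0" using fint f0 by simp
  finally have "(LINT y|lborel. (u y \<bullet> G y) * (cutoff l y)\<^sup>2 - 4 / l\<^sup>2 * (H y * (u y \<bullet> y) * cutoff l y)) = 0" .
  moreover have "integrable lborel (\<lambda>y. (u y \<bullet> G y) * (cutoff l y)\<^sup>2)"
    by (intro integrable_continuous_compact_support[of _ l] continuous_intros c) (simp_all add: cutoff_eq_0[OF l less_imp_le])
  moreover have "integrable lborel (\<lambda>y. 4 / l\<^sup>2 * (H y * (u y \<bullet> y) * cutoff l y))"
    by (intro integrable_continuous_compact_support[of _ l] continuous_intros c) (simp_all add: cutoff_eq_0[OF l less_imp_le])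
  ultimately show ?thesis by simp
qed

text \<open>The transport identity with \<open>H = 1\<close>. It allows an arbitrary constant to be
  subtracted from the pressure inside the flux.\<close>

lemma integral_flux_const:
  assumes "0 < l"
  shows "(LINT y|lborel. (u y \<bullet> y) * cutoff l y) = 0"
  using integral_transport_cutoff[of "\<lambda>_. 1" "\<lambda>_. 0", OF _ _ assms] assms by (simp add: continuous_on_const)

text \<open>The \<open>e(l)\<close> of the overview after the substitution \<open>y = l x\<close>.
  Domain and weight no longer depend on \<open>l\<close>, so differentiation under the integral
  touches only \<open>u (l *\<^sub>R x)\<close>.\<close>

definition rescaled_energy :: "real \<Rightarrow> real" where
  "rescaled_energy l = l powr (2 * \<alpha>) * (LINT x|lborel. (norm (u (l *\<^sub>R x)))\<^sup>2 * (cutoff 1 x)\<^sup>2)"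

text \<open>Proportional to \<open>e'(l)\<close>. Since \<open>(\<nabla>\<phi>)(y/l)\<close> is
  \<open>- 4 (y/l)\<close> times the cutoff, a factor \<open>- 4 / l\<close> has been taken out;
  hence the exponent \<open>2\<alpha> - N - 3\<close> in
  \<open>rescaled_energy_deriv\<close>.\<close>

definition energy_flux :: "real \<Rightarrow> real" where
  "energy_flux l = (LINT y|lborel. ((norm (u y))\<^sup>2 + 2 * q y) * (u y \<bullet> y) * cutoff l y)"

lemma integral_norm_square_deriv:
  assumes l: "0 < l"
  shows "((\<lambda>l. LINT x|lborel. (norm (u (l *\<^sub>R x)))\<^sup>2 * (cutoff 1 x)\<^sup>2) has_real_derivative
     (LINT x|lborel. 2 * (u (l *\<^sub>R x) \<bullet> Du (l *\<^sub>R x) x) * (cutoff 1 x)\<^sup>2)) (at l)"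
proof -
  obtain a :: "real^'n" where a: "cball 0 1 \<subseteq> cbox (- a) a"
    using bounded_subset_cbox_symmetric[OF bounded_cball[of "0::real^'n" 1]] by blast
  let ?f = "\<lambda>l x. (norm (u (l *\<^sub>R x)))\<^sup>2 * (cutoff 1 x)\<^sup>2"
  let ?g = "\<lambda>l x. 2 * (u (l *\<^sub>R x) \<bullet> Du (l *\<^sub>R x) x) * (cutoff 1 x)\<^sup>2"
  \<comment> \<open>The Leibniz rule is applied to integrals over a fixed box. The box contains the
    unit ball, outside of which both integrands vanish.\<close>
  have lint: "(LINT x|lborel. h x) = integral (cbox (- a) a) h"
    if "continuous_on UNIV h" "\<And>x. 1 < norm x \<Longrightarrow> h x = 0" for h :: "real^'n \<Rightarrow> real"
  proof -
    have "(LINT x|lborel. h x) = integral UNIV h"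
      using integral_lborel[OF integrable_continuous_compact_support[OF that]] by simp
    also have "\<dots> = integral UNIV (\<lambda>x. if x \<in> cbox (- a) a then h x else 0)"
    proof (rule arg_cong[of _ _ "integral UNIV"], rule ext)
      fix x
      have "1 < norm x" if "x \<notin> cbox (- a) a" using a that by force
      then show "h x = (if x \<in> cbox (- a) a then h x else 0)" using that(2) by auto
    qed
    also have "\<dots> = integral (cbox (- a) a) h" by (rule integral_restrict_UNIV)
    finally show ?thesis .
  qed
  have uc: "continuous_on S (\<lambda>x. u (f x))" if "continuous_on S f" for S :: "'b::topological_space set" and f
    by (rule continuous_on_compose2[OF u_cont[of UNIV] that]) auto
  have cc: "continuous_on S (\<lambda>x. cutoff 1 (f x))" if "continuous_on S f" for S :: "'b::topological_space set" and f :: "'b \<Rightarrow> real^'n"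
    by (rule continuous_on_compose2[OF continuous_cutoff[of UNIV] that]) auto
  have fc: "continuous_on UNIV (?f k)" and gc: "continuous_on UNIV (?g k)" for k
    by (intro continuous_intros uc cc Du_cont2)+
  have "((\<lambda>l. integral (cbox (- a) a) (?f l)) has_field_derivative integral (cbox (- a) a) (?g l)) (at l within {0<..})"
  proof (rule leibniz_rule_field_derivative)
    show "?f k integrable_on cbox (- a) a" for k
      by (rule integrable_continuous[OF continuous_on_subset[OF fc]]) simp
    show "continuous_on ({0<..} \<times> cbox (- a) a) (\<lambda>(l, x). ?g l x)"
      unfolding split_beta by (intro continuous_intros uc cc Du_cont2)
    fix k x
    have "((\<lambda>k. u (k *\<^sub>R x)) has_derivative (\<lambda>h. Du (k *\<^sub>R x) (h *\<^sub>R x))) (at k)"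
      by (rule has_derivative_compose[OF _ u_deriv]) (auto intro!: derivative_eq_intros)
    from has_derivative_inner[OF this this]
    have "((\<lambda>k. (norm (u (k *\<^sub>R x)))\<^sup>2) has_real_derivative 2 * (u (k *\<^sub>R x) \<bullet> Du (k *\<^sub>R x) x)) (at k)"
      unfolding has_field_derivative_def power2_norm_eq_inner using Du_linear[of "k *\<^sub>R x"]
      by (auto elim!: has_derivative_eq_rhs simp: linear_cmul fun_eq_iff inner_commute)
    from DERIV_cmult_right[OF this, of "(cutoff 1 x)\<^sup>2"]
    show "((\<lambda>k. ?f k x) has_field_derivative ?g k x) (at k within {0<..})"
      by (rule has_field_derivative_at_within)
  qed (use l in auto)
  moreover have "(LINT x|lborel. ?f k x) = integral (cbox (- a) a) (?f k)" for k
    by (rule lint[OF fc]) (simp add: cutoff_eq_0)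
  moreover have "(LINT x|lborel. ?g l x) = integral (cbox (- a) a) (?g l)"
    by (rule lint[OF gc]) (simp add: cutoff_eq_0)
  moreover have "at l within {0<..} = at l" using l by (intro at_within_interior) (simp add: interior_open)
  ultimately show ?thesis by simp
qed

text \<open>Differentiating \<open>l powr (2 * \<alpha>)\<close> and
  \<open>u (l *\<^sub>R x)\<close> produces exactly the pairing of
  \<open>\<alpha> u + y \<cdot> \<nabla>u\<close> with \<open>u\<close>. The profile equation trades
  it for the derivative of \<open>|u|^2 + 2q\<close> along \<open>u\<close>, and
  \<open>integral_transport_cutoff\<close> moves that derivative onto the weight.\<close>

lemma rescaled_energy_deriv:
  assumes l: "0 < l"
  shows "(rescaled_energy has_real_derivative
     - 4 * (1 + \<alpha>) * l powr (2 * \<alpha> - real CARD('n) - 3) * energy_flux l) (at l)"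
proof -
  define H where "H y = (norm (u y))\<^sup>2 + 2 * q y" for y
  define G where "G y = (\<chi> i. 2 * (u y \<bullet> Du y (axis i 1))) + 2 *\<^sub>R gq y" for y
  have Gh: "h \<bullet> G y = 2 * (u y \<bullet> Du y h) + 2 * (h \<bullet> gq y)" for h y
  proof -
    have "h \<bullet> (\<chi> i. 2 * (u y \<bullet> Du y (axis i 1))) = 2 * (u y \<bullet> Du y h)"
      unfolding Du_sum[of y h] inner_vec_def[of h] inner_sum_right
      by (simp add: sum_distrib_left mult_ac)
    then show ?thesis by (simp add: G_def inner_add_right)
  qed
  have Hd: "(H has_derivative (\<lambda>h. h \<bullet> G y)) (at y)" for y
  proof -
    have "(q has_derivative (\<lambda>h. h \<bullet> gq y)) (at y)" using q_grad[of y] by (simp add: gderiv_def)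
    from has_derivative_add[OF has_derivative_inner[OF u_deriv u_deriv] has_derivative_mult_right[OF this, of 2]]
    show ?thesis unfolding H_def[abs_def] power2_norm_eq_inner
      by (rule has_derivative_eq_rhs) (simp add: Gh fun_eq_iff inner_commute)
  qed
  have Gc: "continuous_on UNIV G"
    unfolding G_def[abs_def] by (intro continuous_intros u_cont Du_cont gq_cont)
  let ?A = "LINT x|lborel. (norm (u (l *\<^sub>R x)))\<^sup>2 * (cutoff 1 x)\<^sup>2"
  let ?B = "LINT x|lborel. 2 * (u (l *\<^sub>R x) \<bullet> Du (l *\<^sub>R x) x) * (cutoff 1 x)\<^sup>2"
  have uc: "continuous_on UNIV (\<lambda>x. u (l *\<^sub>R x))"
    by (rule continuous_on_compose2[OF u_cont[of UNIV]]) (auto intro!: continuous_intros)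
  have Aint: "integrable lborel (\<lambda>x. (norm (u (l *\<^sub>R x)))\<^sup>2 * (cutoff 1 x)\<^sup>2)"
    by (rule integrable_continuous_compact_support[of _ 1])
       (auto intro!: continuous_intros uc continuous_cutoff simp: cutoff_eq_0)
  have Bint: "integrable lborel (\<lambda>x. 2 * (u (l *\<^sub>R x) \<bullet> Du (l *\<^sub>R x) x) * (cutoff 1 x)\<^sup>2)"
    by (rule integrable_continuous_compact_support[of _ 1])
       (auto intro!: continuous_intros uc continuous_cutoff Du_cont2 simp: cutoff_eq_0)
  have "2 * \<alpha> * ?A + l * ?B = (LINT x|lborel. 2 * \<alpha> * ((norm (u (l *\<^sub>R x)))\<^sup>2 * (cutoff 1 x)\<^sup>2)
       + l * (2 * (u (l *\<^sub>R x) \<bullet> Du (l *\<^sub>R x) x) * (cutoff 1 x)\<^sup>2))"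
    using Aint Bint by simp
  also have "\<dots> = (LINT x|lborel. - (1 + \<alpha>) * ((\<lambda>y. (u y \<bullet> G y) * (cutoff l y)\<^sup>2) (l *\<^sub>R x)))"
  proof (intro Bochner_Integration.integral_cong refl)
    fix x :: "real^'n"
    define y where "y = l *\<^sub>R x"
    have "l * (u y \<bullet> Du y x) = u y \<bullet> Du y y"
      unfolding y_def using Du_linear[of "l *\<^sub>R x"] by (simp add: linear_cmul)
    moreover have "u y \<bullet> (\<alpha> *\<^sub>R u y + Du y y + (1 + \<alpha>) *\<^sub>R (Du y (u y) + gq y)) = 0"
      unfolding profile_eq by simp
    ultimately have "2 * \<alpha> * (norm (u y))\<^sup>2 + l * (2 * (u y \<bullet> Du y x)) = - (1 + \<alpha>) * (u y \<bullet> G y)"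
      unfolding Gh power2_norm_eq_inner by (simp add: inner_add_right algebra_simps)
    from arg_cong[OF this, of "\<lambda>s. s * (cutoff 1 x)\<^sup>2"]
    show "2 * \<alpha> * ((norm (u (l *\<^sub>R x)))\<^sup>2 * (cutoff 1 x)\<^sup>2)
       + l * (2 * (u (l *\<^sub>R x) \<bullet> Du (l *\<^sub>R x) x) * (cutoff 1 x)\<^sup>2) =
       - (1 + \<alpha>) * ((\<lambda>y. (u y \<bullet> G y) * (cutoff l y)\<^sup>2) (l *\<^sub>R x))"
      unfolding y_def cutoff_scale[OF l] by (simp add: algebra_simps)
  qed
  also have "\<dots> = - (1 + \<alpha>) * (l powr (- real CARD('n)) * (LINT y|lborel. (u y \<bullet> G y) * (cutoff l y)\<^sup>2))"
  proof -
    have "(\<lambda>y. (u y \<bullet> G y) * (cutoff l y)\<^sup>2) \<in> borel_measurable borel"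
      by (intro borel_measurable_continuous_onI continuous_intros u_cont Gc continuous_cutoff)
    from integral_lborel_scale[OF this l] show ?thesis by simp
  qed
  also have "(LINT y|lborel. (u y \<bullet> G y) * (cutoff l y)\<^sup>2) = 4 / l\<^sup>2 * energy_flux l"
    unfolding energy_flux_def using integral_transport_cutoff[OF Hd Gc l] by (simp add: H_def)
  finally have key: "2 * \<alpha> * ?A + l * ?B = - 4 * (1 + \<alpha>) * (l powr (- real CARD('n)) / l\<^sup>2) * energy_flux l"
    by simp
  have "(rescaled_energy has_real_derivative 2 * \<alpha> * l powr (2 * \<alpha> - 1) * ?A + ?B * l powr (2 * \<alpha>)) (at l)"
    unfolding rescaled_energy_def[abs_def]
    by (rule DERIV_mult[OF has_real_derivative_powr[OF l] integral_norm_square_deriv[OF l]])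
  moreover have "2 * \<alpha> * l powr (2 * \<alpha> - 1) * ?A + ?B * l powr (2 * \<alpha>) = l powr (2 * \<alpha> - 1) * (2 * \<alpha> * ?A + l * ?B)"
    using l by (simp add: powr_diff algebra_simps)
  moreover have "l powr (2 * \<alpha> - 1) * (- 4 * (1 + \<alpha>) * (l powr (- real CARD('n)) / l\<^sup>2) * energy_flux l)
      = - 4 * (1 + \<alpha>) * (l powr (2 * \<alpha> - 1) * (l powr (- real CARD('n)) / l\<^sup>2)) * energy_flux l"
    by (simp only: mult_ac)
  moreover have "l powr (2 * \<alpha> - 1) * (l powr (- real CARD('n)) / l\<^sup>2) = l powr (2 * \<alpha> - real CARD('n) - 3)"
  proof -
    have "l powr (2 * \<alpha> - 1) * l powr (- real CARD('n)) * l powr (-2) = l powr (2 * \<alpha> - real CARD('n) - 3)"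
      unfolding powr_add[symmetric] by simp
    then show ?thesis using l by (simp add: powr_minus divide_inverse)
  qed
  ultimately show ?thesis unfolding key by (simp only:)
qed

section \<open>Weighted energy against plain energy of balls\<close>

definition ball_energy :: "real \<Rightarrow> real" where
  "ball_energy r = (LINT y:cball 0 r|lborel. (norm (u y))\<^sup>2)"

lemma ball_energy_integrable: "set_integrable lborel (cball 0 r) (\<lambda>y. (norm (u y))\<^sup>2)"
  unfolding set_integrable_def by (rule borel_integrable_compact) (auto intro!: continuous_intros u_cont)

lemma ball_energy_nonneg: "0 \<le> ball_energy r"
  unfolding ball_energy_def by (simp add: set_lebesgue_integral_def)

lemma rescaled_energy_nonneg: "0 \<le> rescaled_energy l"
  unfolding rescaled_energy_def by simp

lemma rescaled_energy_eq:
  assumes "0 < l"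
  shows "rescaled_energy l = l powr (2 * \<alpha> - real CARD('n)) * (LINT y|lborel. (norm (u y))\<^sup>2 * (cutoff l y)\<^sup>2)"
proof -
  have "(\<lambda>y. (norm (u y))\<^sup>2 * (cutoff l y)\<^sup>2) \<in> borel_measurable borel"
    by (intro borel_measurable_continuous_onI continuous_intros u_cont continuous_cutoff)
  from integral_lborel_scale[OF this assms] show ?thesis
    unfolding rescaled_energy_def by (simp add: cutoff_scale[OF assms] powr_diff powr_minus divide_inverse)
qed

lemma cutoff_energy_integrable:
  assumes "0 < l"
  shows "integrable lborel (\<lambda>y. (norm (u y))\<^sup>2 * (cutoff l y)\<^sup>2)"
  by (rule integrable_continuous_compact_support[of _ l])
     (use assms in \<open>auto intro!: continuous_intros u_cont continuous_cutoff simp: cutoff_eq_0\<close>)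

lemma rescaled_energy_le:
  assumes l: "0 < l"
  shows "rescaled_energy l \<le> l powr (2 * \<alpha> - real CARD('n)) * ball_energy l"
  unfolding rescaled_energy_eq[OF l] ball_energy_def set_lebesgue_integral_def
proof (intro mult_left_mono integral_mono cutoff_energy_integrable[OF l] ball_energy_integrable[unfolded set_integrable_def])
  fix y :: "real^'n"
  have "(cutoff l y)\<^sup>2 \<le> 1" using cutoff_nonneg[of l y] cutoff_le_1[of l y] by (simp add: power_le_one)
  then show "(norm (u y))\<^sup>2 * (cutoff l y)\<^sup>2 \<le> indicat_real (cball 0 l) y *\<^sub>R (norm (u y))\<^sup>2"
    using cutoff_eq_0[OF l, of y] by (auto simp: indicator_def mult_left_le)
qed simp

text \<open>On the ball of radius \<open>l\<close> the function \<open>cutoff (2 * l)\<close> is at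
  least 3/4, so its square is at least 9/16. The power of 2 is left over from rescaling at radius
  \<open>2 * l\<close>.\<close>

lemma ball_energy_le:
  assumes l: "0 < l"
  shows "ball_energy l \<le> (16 / 9 * 2 powr (real CARD('n) - 2 * \<alpha>)) * l powr (real CARD('n) - 2 * \<alpha>) * rescaled_energy (2 * l)"
proof -
  have l2: "0 < 2 * l" using l by simp
  have "ball_energy l \<le> (LINT y|lborel. 16 / 9 * ((norm (u y))\<^sup>2 * (cutoff (2 * l) y)\<^sup>2))"
    unfolding ball_energy_def set_lebesgue_integral_def
  proof (intro integral_mono ball_energy_integrable[unfolded set_integrable_def])
    show "integrable lborel (\<lambda>y. 16 / 9 * ((norm (u y))\<^sup>2 * (cutoff (2 * l) y)\<^sup>2))"
      using cutoff_energy_integrable[OF l2] by simp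
    fix y :: "real^'n"
    have "9 / 16 \<le> (cutoff (2 * l) y)\<^sup>2" if "norm y \<le> l"
    proof -
      have "(norm y)\<^sup>2 / (2 * l)\<^sup>2 \<le> 1 / 4"
        using that l power_mono[OF that norm_ge_zero, of 2] by (simp add: power_mult_distrib field_simps)
      then have "3 / 4 \<le> cutoff (2 * l) y" by (simp add: cutoff_def)
      from power_mono[OF this, of 2] show ?thesis by (simp add: power2_eq_square)
    qed
    then show "indicat_real (cball 0 l) y *\<^sub>R (norm (u y))\<^sup>2 \<le> 16 / 9 * ((norm (u y))\<^sup>2 * (cutoff (2 * l) y)\<^sup>2)"
      using mult_left_mono[of "9 / 16" "(cutoff (2 * l) y)\<^sup>2" "(norm (u y))\<^sup>2"] by (auto simp: indicator_def)
  qed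
  also have "\<dots> = 16 / 9 * (LINT y|lborel. (norm (u y))\<^sup>2 * (cutoff (2 * l) y)\<^sup>2)"
    by (rule integral_mult_right_zero)
  also have "\<dots> = 16 / 9 * ((2 * l) powr (real CARD('n) - 2 * \<alpha>) * rescaled_energy (2 * l))"
  proof -
    have "(2 * l) powr (real CARD('n) - 2 * \<alpha>) * (2 * l) powr (2 * \<alpha> - real CARD('n)) = 1"
      unfolding powr_add[symmetric] using l by simp
    then show ?thesis unfolding rescaled_energy_eq[OF l2] by (simp flip: mult.assoc)
  qed
  finally show ?thesis using l by (simp add: powr_mult mult_ac)
qed

end

section \<open>Splitting the pressure\<close>

text \<open>A non-integrable \<open>f\<close> has Bochner integral 0, so a bound on the nonnegative
  integral is all that the later size estimates have to supply.\<close>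

lemma abs_integral_le_nn_integral:
  fixes f :: "'a \<Rightarrow> real"
  shows "ennreal \<bar>integral\<^sup>L M f\<bar> \<le> (\<integral>\<^sup>+x. ennreal \<bar>f x\<bar> \<partial>M)"
proof (cases "integrable M f")
  case True
  then show ?thesis using integral_norm_bound_ennreal[OF True] by simp
qed (simp add: not_integrable_integral_eq)

lemma abs_integral_le:
  fixes f :: "'a \<Rightarrow> real"
  assumes "(\<integral>\<^sup>+x. ennreal \<bar>f x\<bar> \<partial>M) \<le> ennreal B" "0 \<le> B"
  shows "\<bar>integral\<^sup>L M f\<bar> \<le> B"
  using order_trans[OF abs_integral_le_nn_integral assms(1)] assms(2) by simp

text \<open>The first-order part of the far kernel. It is kept apart because it depends on
  \<open>y\<close>, whereas the zeroth-order part integrates to a constant that drops out of the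
  flux.\<close>

definition linear_correction :: "real \<Rightarrow> real \<Rightarrow> 'n \<Rightarrow> 'n \<Rightarrow> real^'n \<Rightarrow> real^'n \<Rightarrow> real" where
  "linear_correction \<kappa> \<delta> i j y z =
     (if \<delta> < 1/2 then 0 else frechet_derivative (K \<kappa> i j) (at z) y)"

lemma far_kernel_eq: "far_kernel \<kappa> \<delta> i j y z = K \<kappa> i j z - linear_correction \<kappa> \<delta> i j y z"
  by (simp add: far_kernel_def linear_correction_def)

text \<open>For fixed \<open>y\<close> the derivative is a pointwise limit in \<open>z\<close> of
  difference quotients with steps \<open>1/(n+1)\<close>, which are measurable. The indicator keeps
  \<open>z\<close> away from the singularity.\<close>

lemma measurable_indicator_DK [measurable]:
  fixes y :: "real^'n"
  assumes M: "0 < M"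
  shows "(\<lambda>z. indicator {z. M \<le> norm z} z * frechet_derivative (K \<kappa> i j) (at z) y) \<in> borel_measurable borel"
proof (rule borel_measurable_LIMSEQ_real)
  fix z :: "real^'n"
  show "(\<lambda>n. indicator {z. M \<le> norm z} z * ((K \<kappa> i j (z + (1 / real (Suc n)) *\<^sub>R y) - K \<kappa> i j z) / (1 / real (Suc n))))
     \<longlonglongrightarrow> indicator {z. M \<le> norm z} z * frechet_derivative (K \<kappa> i j) (at z) y"
  proof (cases "M \<le> norm z")
    case True
    then have z: "z \<noteq> 0" using M by auto
    let ?D = "frechet_derivative (K \<kappa> i j) (at z)"
    have KD: "(K \<kappa> i j has_derivative ?D) (at z)"
      using differentiable_K[OF z] by (simp add: frechet_derivative_works)
    have "((\<lambda>t. K \<kappa> i j (z + t *\<^sub>R y)) has_derivative (\<lambda>t. ?D (t *\<^sub>R y))) (at 0)"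
      by (rule has_derivative_compose[of "\<lambda>t. z + t *\<^sub>R y" "\<lambda>t. t *\<^sub>R y" _ _ "K \<kappa> i j" ?D])
         (use KD in \<open>auto intro!: derivative_eq_intros\<close>)
    moreover have "(\<lambda>t. ?D (t *\<^sub>R y)) = (*) (?D y)"
      using has_derivative_linear[OF KD] by (simp add: fun_eq_iff linear_cmul)
    ultimately have "((\<lambda>t. K \<kappa> i j (z + t *\<^sub>R y)) has_real_derivative ?D y) (at 0)"
      by (simp only: has_field_derivative_def)
    then have "((\<lambda>h. (K \<kappa> i j (z + h *\<^sub>R y) - K \<kappa> i j z) / h) \<longlongrightarrow> ?D y) (at 0)"
      by (simp add: DERIV_def)
    moreover have "filterlim (\<lambda>n. 1 / real (Suc n)) (at 0) sequentially"
      by (rule filterlim_atI[OF LIMSEQ_Suc[OF lim_1_over_n]]) simp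
    ultimately have "(\<lambda>n. (K \<kappa> i j (z + (1 / real (Suc n)) *\<^sub>R y) - K \<kappa> i j z) / (1 / real (Suc n))) \<longlonglongrightarrow> ?D y"
      by (rule filterlim_compose)
    then show ?thesis using True by simp
  qed simp
qed measurable

lemma continuous_on_K_compose:
  assumes "continuous_on S f" "\<And>x. x \<in> S \<Longrightarrow> f x \<noteq> 0"
  shows "continuous_on S (\<lambda>x. K \<kappa> i j (f x :: real^'n))"
  by (rule continuous_on_compose2[OF continuous_K assms(1)]) (use assms(2) in auto)

lemma compact_shell: "compact {z::real^'n. M \<le> norm z \<and> norm z \<le> R}"
proof -
  have "{z::real^'n. M \<le> norm z \<and> norm z \<le> R} = cball 0 R \<inter> {z. M \<le> norm z}" by auto
  then show ?thesis
    by (simp add: compact_Int_closed closed_Collect_le continuous_on_const continuous_on_norm continuous_on_id)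
qed

lemma quadratic_form_bound:
  fixes a :: "'n::finite \<Rightarrow> 'n \<Rightarrow> real" and w :: "real^'n"
  assumes "\<And>i j. \<bar>a i j\<bar> \<le> c"
  shows "\<bar>\<Sum>i\<in>UNIV. \<Sum>j\<in>UNIV. a i j * w $ i * w $ j\<bar> \<le> (real CARD('n))\<^sup>2 * c * (norm w)\<^sup>2"
proof -
  have c: "0 \<le> c" using order_trans[OF abs_ge_zero assms] .
  have t: "\<bar>a i j * w $ i * w $ j\<bar> \<le> c * norm w * norm w" for i j
    unfolding abs_mult using c by (intro mult_mono assms component_le_norm_cart) auto
  have "\<bar>\<Sum>i\<in>UNIV. \<Sum>j\<in>UNIV. a i j * w $ i * w $ j\<bar> \<le> (\<Sum>i\<in>UNIV. \<bar>\<Sum>j\<in>UNIV. a i j * w $ i * w $ j\<bar>)"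
    by (rule sum_abs)
  also have "\<dots> \<le> (\<Sum>i\<in>(UNIV::'n set). \<Sum>j\<in>(UNIV::'n set). c * norm w * norm w)"
    by (intro sum_mono order_trans[OF sum_abs] t)
  also have "\<dots> = (real CARD('n))\<^sup>2 * c * (norm w)\<^sup>2" by (simp add: power2_eq_square)
  finally show ?thesis .
qed

definition near_part :: "(real^'n \<Rightarrow> real^'n) \<Rightarrow> real \<Rightarrow> 'n \<Rightarrow> 'n \<Rightarrow> real^'n \<Rightarrow> real" where
  "near_part u R i j z = indicator (cball 0 R) z * (u z $ i * u z $ j)"

lemma near_part_integrable:
  assumes "continuous_on UNIV u"
  shows "integrable lborel (near_part u R i j)"
proof -
  have "integrable lborel (\<lambda>z. indicator (cball 0 R) z *\<^sub>R (u z $ i * u z $ j))"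
    by (rule borel_integrable_compact) (auto intro!: continuous_intros continuous_on_subset[OF assms])
  then show ?thesis by (simp add: near_part_def[abs_def])
qed

text \<open>The radius \<open>2 * l\<close> makes every far point satisfy
  \<open>2 * norm y \<le> norm z\<close>, as the Taylor bounds require. On the shell from
  \<open>M\<close> to \<open>2 * l\<close> the subtracted \<open>far_kernel\<close> separates into a
  term independent of \<open>y\<close> and one linear in \<open>y\<close>. Truncation radii run
  through a sequence, so that measurability and Fatou's lemma become available for the
  limit.\<close>

lemma pv_near_far:
  fixes u :: "real^'n \<Rightarrow> real^'n" and y :: "real^'n"
  assumes u: "continuous_on UNIV u" and M: "0 < M" and l: "0 < l" and y: "norm y \<le> l"
    and pv: "has_pv (\<lambda>z. \<Sum>i\<in>UNIV. \<Sum>j\<in>UNIV.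
            (K \<kappa> i j (y - z) - indicator {z. M \<le> norm z} z * far_kernel \<kappa> \<delta> i j y z)
              * (u z $ i) * (u z $ j)) y I"
  defines "X \<equiv> \<lambda>a z. \<Sum>i\<in>UNIV. \<Sum>j\<in>UNIV. a i j z * u z $ i * u z $ j"
  shows "(\<lambda>n. \<Sum>i\<in>UNIV. \<Sum>j\<in>UNIV. truncated_convolution \<kappa> i j (1 / real (Suc n)) (near_part u (2 * l) i j) y)
     \<longlonglongrightarrow> I + (LINT z|lborel. indicator {z. M \<le> norm z \<and> norm z \<le> 2 * l} z * X (K \<kappa>) z)
          - (LINT z|lborel. indicator {z. M \<le> norm z \<and> norm z \<le> 2 * l} z * X (\<lambda>i j. linear_correction \<kappa> \<delta> i j y) z)
          - (LINT z|lborel. indicator {z. 2 * l < norm z} z *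
               X (\<lambda>i j z. K \<kappa> i j (y - z) - indicator {z. M \<le> norm z} z * far_kernel \<kappa> \<delta> i j y z) z)"
proof -
  have [measurable]: "u \<in> borel_measurable borel" using u by (rule borel_measurable_continuous_onI)
  define S where "S = {z::real^'n. M \<le> norm z \<and> norm z \<le> 2 * l}"
  define G where "G = X (\<lambda>i j z. K \<kappa> i j (y - z) - indicator {z. M \<le> norm z} z * far_kernel \<kappa> \<delta> i j y z)"
  define \<epsilon> where "\<epsilon> n = 1 / real (Suc n)" for n
  define D where "D n = {z. \<epsilon> n \<le> dist y z}" for n
  have \<epsilon>: "0 < \<epsilon> n" for n by (simp add: \<epsilon>_def)
  have \<epsilon>lim: "\<epsilon> \<longlonglongrightarrow> 0" unfolding \<epsilon>_def by (rule LIMSEQ_Suc[OF lim_1_over_n])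
  have D_meas[measurable]: "D n \<in> sets borel" for n
    unfolding D_def by (intro borel_closed closed_Collect_le continuous_intros)
  have S_meas[measurable]: "S \<in> sets borel"
    unfolding S_def using compact_shell compact_imp_closed by (intro borel_closed) blast
  have F_meas[measurable]: "{z::real^'n. 2 * l < norm z} \<in> sets borel"
    by (intro borel_open open_Collect_less continuous_intros)
  have Gint: "set_integrable lborel (D n) G" for n
    using pv \<epsilon>[of n] unfolding has_pv_def D_def G_def X_def by blast
  have "((\<lambda>\<epsilon>. LINT z:{z. \<epsilon> \<le> dist y z}|lborel. G z) \<longlongrightarrow> I) (at_right 0)"
    using pv unfolding has_pv_def G_def X_def by blast
  moreover have "filterlim \<epsilon> (at_right 0) sequentially"
    using \<epsilon>lim \<epsilon> by (intro filterlim_at_withinI) auto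
  ultimately have Glim: "(\<lambda>n. LINT z:D n|lborel. G z) \<longlonglongrightarrow> I"
    unfolding D_def by (rule filterlim_compose)
  have Xc: "integrable lborel (\<lambda>z. indicator S z * X (K \<kappa>) z)"
  proof -
    have "integrable lborel (\<lambda>z. indicator S z *\<^sub>R X (K \<kappa>) z)"
    proof (rule borel_integrable_compact)
      show "continuous_on S (X (K \<kappa>))" unfolding X_def S_def
        by (intro continuous_intros continuous_on_subset[OF u] continuous_on_K_compose) (use M in auto)
    qed (simp add: S_def compact_shell)
    then show ?thesis by simp
  qed
  have Xl: "integrable lborel (\<lambda>z. indicator S z * X (\<lambda>i j. linear_correction \<kappa> \<delta> i j y) z)"
  proof (cases "\<delta> < 1/2")
    case True
    then show ?thesis by (simp add: X_def linear_correction_def)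
  next
    case False
    have "integrable lborel (\<lambda>z. (indicator {z. M \<le> norm z} z * frechet_derivative (K \<kappa> i j) (at z) y) * near_part u (2 * l) i j z)" for i j
    proof -
      obtain C where C: "0 \<le> C" "\<And>z::real^'n. z \<noteq> 0 \<Longrightarrow> \<bar>frechet_derivative (K \<kappa> i j) (at z) y\<bar> \<le> C * norm y * norm z powr (- (real CARD('n) + 1))"
        using K_taylor[of \<kappa> i j] by metis
      show ?thesis
      proof (rule integrable_bounded_mult[OF near_part_integrable[OF u]])
        fix z :: "real^'n"
        show "\<bar>indicator {z. M \<le> norm z} z * frechet_derivative (K \<kappa> i j) (at z) y\<bar> \<le> C * norm y * M powr (- (real CARD('n) + 1))"
        proof (cases "M \<le> norm z")
          case True
          then have "\<bar>frechet_derivative (K \<kappa> i j) (at z) y\<bar> \<le> C * norm y * norm z powr (- (real CARD('n) + 1))"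
            using M by (intro C) auto
          also have "\<dots> \<le> C * norm y * M powr (- (real CARD('n) + 1))"
            using True M C by (intro mult_left_mono powr_mono2') auto
          finally show ?thesis using True by simp
        qed (use C in simp)
      qed (use measurable_indicator_DK[OF M] in simp)
    qed
    then have "integrable lborel (\<lambda>z. \<Sum>i\<in>UNIV. \<Sum>j\<in>UNIV.
        (indicator {z. M \<le> norm z} z * frechet_derivative (K \<kappa> i j) (at z) y) * near_part u (2 * l) i j z)"
      by (intro Bochner_Integration.integrable_sum)
    moreover have "(\<lambda>z. \<Sum>i\<in>UNIV. \<Sum>j\<in>UNIV. (indicator {z. M \<le> norm z} z * frechet_derivative (K \<kappa> i j) (at z) y) * near_part u (2 * l) i j z)
       = (\<lambda>z. indicator S z * X (\<lambda>i j. linear_correction \<kappa> \<delta> i j y) z)"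
      using False by (auto simp: fun_eq_iff X_def linear_correction_def near_part_def S_def indicator_def mult.assoc)
    ultimately show ?thesis by simp
  qed
  define W where "W z = indicator S z * X (K \<kappa>) z - indicator S z * X (\<lambda>i j. linear_correction \<kappa> \<delta> i j y) z" for z
  have Wint: "integrable lborel W" unfolding W_def[abs_def] using Xc Xl by simp
  have [measurable]: "W \<in> borel_measurable borel" using Wint by (simp add: borel_measurable_integrable)
  \<comment> \<open>Dominated convergence: \<open>W\<close> has no singularity at \<open>y\<close>,
    and the removed balls shrink to the null set consisting of \<open>y\<close>.\<close>
  have Wlim: "(\<lambda>n. LINT z|lborel. indicator (D n) z * W z) \<longlonglongrightarrow> (LINT z|lborel. W z)"
  proof (rule integral_dominated_convergence[where w = "\<lambda>z. \<bar>W z\<bar>"])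
    show "AE z in lborel. (\<lambda>n. indicator (D n) z * W z) \<longlonglongrightarrow> W z"
    proof -
      have "(\<lambda>n. indicator (D n) z * W z) \<longlonglongrightarrow> W z" if "z \<noteq> y" for z
      proof (rule tendsto_eventually)
        have "\<forall>\<^sub>F n in sequentially. \<epsilon> n < dist y z"
          using that by (intro order_tendstoD(2)[OF \<epsilon>lim]) simp
        then show "\<forall>\<^sub>F n in sequentially. indicator (D n) z * W z = W z"
          by eventually_elim (simp add: D_def)
      qed
      then show ?thesis using AE_lborel_singleton[of y] by (auto elim: eventually_mono)
    qed
    show "AE z in lborel. norm (indicator (D n) z * W z) \<le> \<bar>W z\<bar>" for n
      by (intro AE_I2) (simp add: indicator_def)
  qed (use Wint in auto)
  have tint: "integrable lborel (\<lambda>z. indicator (D n) z * (K \<kappa> i j (y - z) * near_part u (2 * l) i j z))" for n i j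
  proof -
    have "integrable lborel (\<lambda>z. indicator (D n \<inter> cball 0 (2 * l)) z *\<^sub>R (K \<kappa> i j (y - z) * (u z $ i * u z $ j)))"
    proof (rule borel_integrable_compact)
      have "closed (D n)" unfolding D_def by (intro closed_Collect_le continuous_intros)
      then show "compact (D n \<inter> cball 0 (2 * l))" by (simp add: closed_Int_compact)
      show "continuous_on (D n \<inter> cball 0 (2 * l)) (\<lambda>z. K \<kappa> i j (y - z) * (u z $ i * u z $ j))"
        by (intro continuous_intros continuous_on_subset[OF u] continuous_on_K_compose)
           (use \<epsilon>[of n] in \<open>auto simp: D_def\<close>)
    qed
    then show ?thesis by (simp add: near_part_def indicator_inter_arith mult_ac)
  qed
  \<comment> \<open>For radii below \<open>l\<close> the removed ball around \<open>y\<close> lies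
    inside the ball of radius \<open>2 * l\<close>, so truncation does not affect the far
    region.\<close>
  have eq: "(\<Sum>i\<in>UNIV. \<Sum>j\<in>UNIV. truncated_convolution \<kappa> i j (\<epsilon> n) (near_part u (2 * l) i j) y)
     = (LINT z:D n|lborel. G z) + (LINT z|lborel. indicator (D n) z * W z) - (LINT z|lborel. indicator {z. 2 * l < norm z} z * G z)"
    if n: "\<epsilon> n < l" for n
  proof -
    let ?F = "{z::real^'n. 2 * l < norm z}"
    have FD: "?F \<subseteq> D n"
    proof
      fix z assume "z \<in> ?F"
      then have "l < norm (y - z)" using y norm_triangle_ineq2[of z y] by (simp add: norm_minus_commute)
      then show "z \<in> D n" using n by (simp add: D_def dist_norm)
    qed
    have intF: "integrable lborel (\<lambda>z. indicator ?F z * G z)"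
      using set_integrable_subset[OF Gint _ FD] by (simp add: set_integrable_def)
    have intW: "integrable lborel (\<lambda>z. indicator (D n) z * W z)"
      by (rule integrable_bounded_mult[OF Wint, of _ 1]) (auto simp: indicator_def)
    have intT: "integrable lborel (\<lambda>z. \<Sum>i\<in>UNIV. \<Sum>j\<in>UNIV. indicator (D n) z * (K \<kappa> i j (y - z) * near_part u (2 * l) i j z))"
      using tint by (intro Bochner_Integration.integrable_sum)
    have "(\<Sum>i\<in>UNIV. \<Sum>j\<in>UNIV. truncated_convolution \<kappa> i j (\<epsilon> n) (near_part u (2 * l) i j) y)
       = (LINT z|lborel. (\<Sum>i\<in>UNIV. \<Sum>j\<in>UNIV. indicator (D n) z * (K \<kappa> i j (y - z) * near_part u (2 * l) i j z)))"
      unfolding truncated_convolution_def D_def[symmetric]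
      by (simp only: Bochner_Integration.integral_sum Bochner_Integration.integrable_sum tint)
    moreover have "(LINT z:D n|lborel. G z) = (LINT z|lborel.
        ((\<Sum>i\<in>UNIV. \<Sum>j\<in>UNIV. indicator (D n) z * (K \<kappa> i j (y - z) * near_part u (2 * l) i j z))
          - indicator (D n) z * W z) + indicator ?F z * G z)"
      unfolding set_lebesgue_integral_def
    proof (intro Bochner_Integration.integral_cong refl)
      fix z
      show "indicat_real (D n) z *\<^sub>R G z =
        ((\<Sum>i\<in>UNIV. \<Sum>j\<in>UNIV. indicator (D n) z * (K \<kappa> i j (y - z) * near_part u (2 * l) i j z))
          - indicator (D n) z * W z) + indicator ?F z * G z"
      proof (cases "z \<in> ?F")
        case True
        then have "z \<in> D n" "z \<notin> S" "\<And>i j. near_part u (2 * l) i j z = 0"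
          using FD by (auto simp: S_def near_part_def)
        then show ?thesis using True by (simp add: W_def)
      next
        case False
        then have np: "near_part u (2 * l) i j z = u z $ i * u z $ j" for i j
          by (simp add: near_part_def)
        have "G z = (\<Sum>i\<in>UNIV. \<Sum>j\<in>UNIV. K \<kappa> i j (y - z) * (u z $ i * u z $ j)) - W z"
          using False unfolding G_def W_def X_def far_kernel_eq
          by (cases "M \<le> norm z") (simp_all add: S_def sum_subtractf[symmetric] algebra_simps)
        then show ?thesis using False
          by (simp add: np sum_distrib_left[symmetric] right_diff_distrib)
      qed
    qed
    ultimately show ?thesis using intF intW intT by simp
  qed
  have "(\<lambda>n. (LINT z:D n|lborel. G z) + (LINT z|lborel. indicator (D n) z * W z) - (LINT z|lborel. indicator {z. 2 * l < norm z} z * G z))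
     \<longlonglongrightarrow> I + (LINT z|lborel. W z) - (LINT z|lborel. indicator {z. 2 * l < norm z} z * G z)"
    by (intro tendsto_intros Glim Wlim)
  moreover have "\<forall>\<^sub>F n in sequentially. \<epsilon> n < l"
    using l by (intro order_tendstoD(2)[OF \<epsilon>lim])
  then have "\<forall>\<^sub>F n in sequentially. (LINT z:D n|lborel. G z) + (LINT z|lborel. indicator (D n) z * W z) - (LINT z|lborel. indicator {z. 2 * l < norm z} z * G z)
     = (\<Sum>i\<in>UNIV. \<Sum>j\<in>UNIV. truncated_convolution \<kappa> i j (\<epsilon> n) (near_part u (2 * l) i j) y)"
    by eventually_elim (simp add: eq)
  ultimately have "(\<lambda>n. \<Sum>i\<in>UNIV. \<Sum>j\<in>UNIV. truncated_convolution \<kappa> i j (\<epsilon> n) (near_part u (2 * l) i j) y)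
     \<longlonglongrightarrow> I + (LINT z|lborel. W z) - (LINT z|lborel. indicator {z. 2 * l < norm z} z * G z)"
    by (rule Lim_transform_eventually)
  moreover have "(LINT z|lborel. W z) = (LINT z|lborel. indicator S z * X (K \<kappa>) z)
      - (LINT z|lborel. indicator S z * X (\<lambda>i j. linear_correction \<kappa> \<delta> i j y) z)"
    unfolding W_def[abs_def] using Xc Xl by simp
  ultimately show ?thesis unfolding \<epsilon>_def S_def G_def by (simp add: algebra_simps)
qed

text \<open>There are finitely many index pairs and the constants are nonnegative, so their sum
  serves all pairs.\<close>

lemma K_taylor_uniform:
  obtains C where "0 \<le> C"
    "\<And>i j (y :: real^'n) z. z \<noteq> 0 \<Longrightarrow> \<bar>frechet_derivative (K \<kappa> i j) (at z) y\<bar> \<le> C * norm y * norm z powr (- (real CARD('n) + 1))"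
    "\<And>i j (y :: real^'n) z. z \<noteq> 0 \<Longrightarrow> 2 * norm y \<le> norm z \<Longrightarrow>
       \<bar>K \<kappa> i j (y - z) - K \<kappa> i j z\<bar> \<le> C * norm y * norm z powr (- (real CARD('n) + 1))"
    "\<And>i j (y :: real^'n) z. z \<noteq> 0 \<Longrightarrow> 2 * norm y \<le> norm z \<Longrightarrow>
       \<bar>K \<kappa> i j (y - z) - (K \<kappa> i j z - frechet_derivative (K \<kappa> i j) (at z) y)\<bar>
          \<le> C * (norm y)\<^sup>2 * norm z powr (- (real CARD('n) + 2))"
proof -
  let ?P = "\<lambda>i j C. 0 \<le> C \<and> (\<forall>(y :: real^'n) z. z \<noteq> 0 \<longrightarrow>
      \<bar>frechet_derivative (K \<kappa> i j) (at z) y\<bar> \<le> C * (norm y * norm z powr (- (real CARD('n) + 1))) \<and>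
      (2 * norm y \<le> norm z \<longrightarrow> \<bar>K \<kappa> i j (y - z) - K \<kappa> i j z\<bar> \<le> C * (norm y * norm z powr (- (real CARD('n) + 1))) \<and>
       \<bar>K \<kappa> i j (y - z) - (K \<kappa> i j z - frechet_derivative (K \<kappa> i j) (at z) y)\<bar>
          \<le> C * ((norm y)\<^sup>2 * norm z powr (- (real CARD('n) + 2)))))"
  have ex: "\<exists>C. ?P i j C" for i j
  proof -
    obtain C where C: "0 \<le> C"
      "\<And>(y :: real^'n) z. z \<noteq> 0 \<Longrightarrow> \<bar>frechet_derivative (K \<kappa> i j) (at z) y\<bar> \<le> C * norm y * norm z powr (- (real CARD('n) + 1))"
      "\<And>(y :: real^'n) z. z \<noteq> 0 \<Longrightarrow> 2 * norm y \<le> norm z \<Longrightarrow>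
         \<bar>K \<kappa> i j (y - z) - K \<kappa> i j z\<bar> \<le> C * norm y * norm z powr (- (real CARD('n) + 1))"
      "\<And>(y :: real^'n) z. z \<noteq> 0 \<Longrightarrow> 2 * norm y \<le> norm z \<Longrightarrow>
         \<bar>K \<kappa> i j (y - z) - (K \<kappa> i j z - frechet_derivative (K \<kappa> i j) (at z) y)\<bar>
            \<le> C * (norm y)\<^sup>2 * norm z powr (- (real CARD('n) + 2))"
      by (rule K_taylor[of \<kappa> i j]) blast
    show ?thesis using C by (intro exI[of _ C]) (auto simp: mult.assoc)
  qed
  define c where "c i j = (SOME C. ?P i j C)" for i j
  have c: "?P i j (c i j)" for i j unfolding c_def using ex by (rule someI_ex)
  define C where "C = (\<Sum>i\<in>UNIV. \<Sum>j\<in>UNIV. c i j)"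
  have le: "c i j \<le> C" for i j
  proof -
    have "c i j \<le> (\<Sum>j\<in>UNIV. c i j)" using c by (intro member_le_sum) auto
    also have "\<dots> \<le> C" unfolding C_def
      using c by (intro member_le_sum[of i UNIV "\<lambda>i. \<Sum>j\<in>UNIV. c i j"]) (auto intro!: sum_nonneg)
    finally show ?thesis .
  qed
  have leC: "x \<le> C * t" if "x \<le> c i j * t" "0 \<le> t" for x t i j
    using order_trans[OF that(1) mult_right_mono[OF le that(2)]] .
  have C0: "0 \<le> C" using c le order_trans by blast
  show thesis
    by (rule that[OF C0]; unfold mult.assoc; rule leC; use c in fastforce)
qed

text \<open>Writing the truncation as a condition on \<open>y - z\<close> makes the integrand
  jointly measurable in \<open>y\<close> and \<open>z\<close>.\<close>

lemma measurable_truncated_convolution [measurable]: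
  assumes [measurable]: "f \<in> borel_measurable borel"
  shows "truncated_convolution \<kappa> i j \<epsilon> f \<in> borel_measurable borel"
proof -
  have "truncated_convolution \<kappa> i j \<epsilon> f = (\<lambda>y. LINT z|lborel. indicator {w. \<epsilon> \<le> norm w} (y - z) * (K \<kappa> i j (y - z) * f z))"
    by (auto simp: truncated_convolution_def fun_eq_iff dist_norm indicator_def)
  also have "\<dots> \<in> borel_measurable borel" by measurable
  finally show ?thesis .
qed

text \<open>One factor of \<open>u z $ i * u z $ j\<close> is bounded by \<open>s\<close>, so the
  square of the product costs \<open>s^2\<close> times the energy density. The power
  \<open>N^4\<close> is \<open>N^2\<close> from Cauchy-Schwarz over the double sum times the number
  \<open>N^2\<close> of terms.\<close>

lemma near_convolution_L2:
  fixes u :: "real^'n \<Rightarrow> real^'n"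
  assumes n: "2 \<le> CARD('n)" and u: "continuous_on UNIV u" and \<epsilon>: "0 < \<epsilon>"
    and s: "\<And>y. norm y \<le> R \<Longrightarrow> norm (u y) \<le> s"
  shows "(\<integral>\<^sup>+y. ennreal ((\<Sum>i\<in>UNIV. \<Sum>j\<in>UNIV. truncated_convolution \<kappa> i j \<epsilon> (near_part u R i j) y)\<^sup>2) \<partial>lborel)
     \<le> ennreal (real CARD('n) ^ 4 * CZ_bound TYPE('n) \<kappa> * s\<^sup>2 * (LINT y:cball 0 R|lborel. (norm (u y))\<^sup>2))"
proof -
  let ?n = "real CARD('n)" and ?E = "LINT y:cball 0 R|lborel. (norm (u y))\<^sup>2"
  let ?CZ = "CZ_bound TYPE('n) \<kappa>"
  let ?T = "\<lambda>i j. truncated_convolution \<kappa> i j \<epsilon> (near_part u R i j)"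
  have [measurable]: "u \<in> borel_measurable borel" using u by (rule borel_measurable_continuous_onI)
  have np: "integrable lborel (near_part u R i j)" for i j by (rule near_part_integrable[OF u])
  have [measurable]: "near_part u R i j \<in> borel_measurable borel" for i j
    using np by (simp add: borel_measurable_integrable)
  have Ei: "integrable lborel (\<lambda>z. indicator (cball 0 R) z *\<^sub>R (norm (u z))\<^sup>2)"
    by (rule borel_integrable_compact) (auto intro!: continuous_intros continuous_on_subset[OF u])
  have CZ: "0 \<le> ?CZ" by (simp add: CZ_bound_def)
  have E: "0 \<le> ?E" by (simp add: set_lebesgue_integral_def)
  have each: "(\<integral>\<^sup>+y. ennreal ((?T i j y)\<^sup>2) \<partial>lborel) \<le> ennreal (?CZ * (s\<^sup>2 * ?E))" for i j
  proof -
    have "(\<integral>\<^sup>+z. ennreal ((near_part u R i j z)\<^sup>2) \<partial>lborel) \<le> (\<integral>\<^sup>+z. ennreal (s\<^sup>2 * (indicator (cball 0 R) z *\<^sub>R (norm (u z))\<^sup>2)) \<partial>lborel)"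
    proof (intro nn_integral_mono ennreal_leI)
      fix z
      have "(u z $ i * u z $ j)\<^sup>2 \<le> s\<^sup>2 * (norm (u z))\<^sup>2" if "norm z \<le> R"
      proof -
        have "\<bar>u z $ i * u z $ j\<bar> \<le> s * norm (u z)"
          unfolding abs_mult using s[OF that] component_le_norm_cart[of "u z" i] component_le_norm_cart[of "u z" j]
          by (intro mult_mono) auto
        from power_mono[OF this, of 2] show ?thesis by (simp add: power_mult_distrib)
      qed
      then show "(near_part u R i j z)\<^sup>2 \<le> s\<^sup>2 * (indicator (cball 0 R) z *\<^sub>R (norm (u z))\<^sup>2)"
        by (auto simp: near_part_def indicator_def)
    qed
    also have "\<dots> = ennreal (LINT z|lborel. s\<^sup>2 * (indicator (cball 0 R) z *\<^sub>R (norm (u z))\<^sup>2))"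
      using Ei by (intro nn_integral_eq_integral) auto
    also have "(LINT z|lborel. s\<^sup>2 * (indicator (cball 0 R) z *\<^sub>R (norm (u z))\<^sup>2)) = s\<^sup>2 * ?E"
      unfolding set_lebesgue_integral_def by (rule integral_mult_right_zero)
    finally have "ennreal ?CZ * (\<integral>\<^sup>+z. ennreal ((near_part u R i j z)\<^sup>2) \<partial>lborel) \<le> ennreal ?CZ * ennreal (s\<^sup>2 * ?E)"
      by (rule mult_left_mono) simp
    also have "\<dots> = ennreal (?CZ * (s\<^sup>2 * ?E))" using CZ by (rule ennreal_mult'[symmetric])
    finally show ?thesis using truncated_convolution_L2[OF \<epsilon> n np, of \<kappa> i j i j] by (rule order_trans[rotated])
  qed
  have "(\<integral>\<^sup>+y. ennreal ((\<Sum>i\<in>UNIV. \<Sum>j\<in>UNIV. ?T i j y)\<^sup>2) \<partial>lborel)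
     \<le> (\<integral>\<^sup>+y. ennreal (?n\<^sup>2) * (\<Sum>i\<in>UNIV. \<Sum>j\<in>UNIV. ennreal ((?T i j y)\<^sup>2)) \<partial>lborel)"
  proof (intro nn_integral_mono)
    fix y
    have "(\<Sum>i\<in>UNIV. \<Sum>j\<in>UNIV. ?T i j y)\<^sup>2 \<le> (\<Sum>i\<in>UNIV. (\<Sum>j\<in>UNIV. ?T i j y)\<^sup>2) * ?n"
      using sum_squared_le_sum_of_squares[of "\<lambda>i. \<Sum>j\<in>UNIV. ?T i j y" "UNIV :: 'n set"] by simp
    also have "\<dots> \<le> (\<Sum>i\<in>(UNIV::'n set). (\<Sum>j\<in>(UNIV::'n set). (?T i j y)\<^sup>2) * ?n) * ?n"
      using sum_squared_le_sum_of_squares[of "\<lambda>j. ?T _ j y" "UNIV :: 'n set"]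
      by (intro mult_right_mono sum_mono) auto
    also have "\<dots> = ?n\<^sup>2 * (\<Sum>i\<in>UNIV. \<Sum>j\<in>UNIV. (?T i j y)\<^sup>2)"
      by (simp add: sum_distrib_left sum_distrib_right power2_eq_square mult_ac)
    finally have "ennreal ((\<Sum>i\<in>UNIV. \<Sum>j\<in>UNIV. ?T i j y)\<^sup>2) \<le> ennreal (?n\<^sup>2 * (\<Sum>i\<in>UNIV. \<Sum>j\<in>UNIV. (?T i j y)\<^sup>2))"
      by (rule ennreal_leI)
    also have "\<dots> = ennreal (?n\<^sup>2) * (\<Sum>i\<in>UNIV. \<Sum>j\<in>UNIV. ennreal ((?T i j y)\<^sup>2))"
      by (simp add: ennreal_mult sum_nonneg)
    finally show "ennreal ((\<Sum>i\<in>UNIV. \<Sum>j\<in>UNIV. ?T i j y)\<^sup>2) \<le> ennreal (?n\<^sup>2) * (\<Sum>i\<in>UNIV. \<Sum>j\<in>UNIV. ennreal ((?T i j y)\<^sup>2))" .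
  qed
  also have "\<dots> = ennreal (?n\<^sup>2) * (\<Sum>i\<in>UNIV. \<Sum>j\<in>UNIV. \<integral>\<^sup>+y. ennreal ((?T i j y)\<^sup>2) \<partial>lborel)"
    by (simp add: nn_integral_cmult nn_integral_sum del: sum_ennreal)
  also have "\<dots> \<le> ennreal (?n\<^sup>2) * (\<Sum>i\<in>(UNIV::'n set). \<Sum>j\<in>(UNIV::'n set). ennreal (?CZ * (s\<^sup>2 * ?E)))"
    by (intro mult_left_mono sum_mono each) simp
  also have "\<dots> = ennreal (?n\<^sup>2 * (\<Sum>i\<in>(UNIV::'n set). \<Sum>j\<in>(UNIV::'n set). ?CZ * (s\<^sup>2 * ?E)))"
    using CZ E by (simp add: ennreal_mult sum_nonneg ennreal_of_nat_eq_real_of_nat)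
  also have "?n\<^sup>2 * (\<Sum>i\<in>(UNIV::'n set). \<Sum>j\<in>(UNIV::'n set). ?CZ * (s\<^sup>2 * ?E)) = ?n ^ 4 * ?CZ * s\<^sup>2 * ?E"
    by (simp add: power2_eq_square power4_eq_xxxx mult_ac)
  finally show ?thesis .
qed

context euler_profile
begin

section \<open>Growth of the ball energy and a bound for the flux\<close>

lemma ball_energy_mono: "r \<le> r' \<Longrightarrow> ball_energy r \<le> ball_energy r'"
  unfolding ball_energy_def set_lebesgue_integral_def
  by (intro integral_mono ball_energy_integrable[unfolded set_integrable_def]) (auto simp: indicator_def)

lemma ball_energy_nn: "(\<integral>\<^sup>+z. ennreal ((norm (u z))\<^sup>2) * indicator (cball 0 r) z \<partial>lborel) = ennreal (ball_energy r)"
proof -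
  have "(\<integral>\<^sup>+z. ennreal ((norm (u z))\<^sup>2) * indicator (cball 0 r) z \<partial>lborel)
     = (\<integral>\<^sup>+z. ennreal (indicator (cball 0 r) z *\<^sub>R (norm (u z))\<^sup>2) \<partial>lborel)"
    by (intro nn_integral_cong) (simp add: indicator_def)
  also have "\<dots> = ennreal (ball_energy r)"
    unfolding ball_energy_def set_lebesgue_integral_def
    by (rule nn_integral_eq_integral[OF ball_energy_integrable[unfolded set_integrable_def]]) simp
  finally show ?thesis .
qed

text \<open>Moves the start of a growth bound to a prescribed radius. Below \<open>r0\<close>,
  monotonicity bounds the energy, and \<open>r powr p\<close> is at least the smaller of two end
  values; the minimum covers both signs of \<open>p\<close>.\<close>

lemma ball_energy_growth_from:
  assumes P: "\<And>r. r0 \<le> r \<Longrightarrow> ball_energy r \<le> C * r powr p" and R: "0 < R"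
  obtains C' where "0 \<le> C'" "\<And>r. R \<le> r \<Longrightarrow> ball_energy r \<le> C' * r powr p"
proof -
  define S where "S = max r0 R"
  define m where "m = min (R powr p) (S powr p)"
  have S: "0 < S" using R by (simp add: S_def)
  have m: "0 < m" using R S by (simp add: m_def)
  define C' where "C' = max \<bar>C\<bar> (ball_energy S / m)"
  have "ball_energy r \<le> C' * r powr p" if r: "R \<le> r" for r
  proof (cases "r0 \<le> r")
    case True
    have "C * r powr p \<le> C' * r powr p" by (intro mult_right_mono) (auto simp: C'_def)
    then show ?thesis using P[OF True] by linarith
  next
    case False
    have "m \<le> r powr p"
    proof (cases "0 \<le> p")
      case True
      then have "R powr p \<le> r powr p" using R r by (intro powr_mono2) auto
      then show ?thesis by (simp add: m_def)
    next
      case False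
      then have "S powr p \<le> r powr p" using R r \<open>\<not> r0 \<le> r\<close> by (intro powr_mono2') (auto simp: S_def)
      then show ?thesis by (simp add: m_def)
    qed
    have "ball_energy r \<le> ball_energy S" using False by (intro ball_energy_mono) (simp add: S_def)
    also have "\<dots> = ball_energy S / m * m" using m by simp
    also have "\<dots> \<le> C' * r powr p"
      using \<open>m \<le> r powr p\<close> m ball_energy_nonneg[of S] by (intro mult_mono) (auto simp: C'_def)
    finally show ?thesis .
  qed
  moreover have "0 \<le> C'" by (simp add: C'_def)
  ultimately show thesis using that by blast
qed

lemma u_tail:
  assumes R: "0 < R" and C: "0 \<le> C" "\<And>r. R \<le> r \<Longrightarrow> ball_energy r \<le> C * r powr p" and p: "p < p'" "0 < p'"
  shows "(\<integral>\<^sup>+z. ennreal (norm z powr (-p')) * ennreal ((norm (u z))\<^sup>2) * indicator {z. R \<le> norm z} z \<partial>lborel)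
     \<le> ennreal (C * p' / (p' - p) * R powr (p - p'))"
  using C R p by (intro nn_integral_powr_tail) (auto simp: ball_energy_nn ennreal_leI)

text \<open>The constant \<open>k\<close> is free by \<open>integral_flux_const\<close>, and
  \<open>u y \<bullet> y\<close> supplies the factor \<open>l\<close>. In \<open>4 * s\<close>,
  three units come from \<open>|u|^2 + 2 |u|^2\<close> and one from
  \<open>2 |Loc| |u| \<le> Loc^2 / s + s |u|^2\<close>. This splitting is balanced when
  \<open>Loc\<close> is \<open>s\<close> times as large as \<open>u\<close> in \<open>L2\<close>, as
  \<open>near_convolution_L2\<close> provides.\<close>

lemma energy_flux_le:
  assumes l: "0 < l" and s: "0 < s" "\<And>y. norm y \<le> l \<Longrightarrow> norm (u y) \<le> s"
    and [measurable]: "Loc \<in> borel_measurable borel" and S: "0 \<le> S" and X: "0 \<le> X"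
    and Loc: "(\<integral>\<^sup>+y. ennreal ((Loc y)\<^sup>2) * indicator (cball 0 l) y \<partial>lborel) \<le> ennreal S"
    and q: "\<And>y. norm y \<le> l \<Longrightarrow> \<bar>q y - k\<bar> \<le> (norm (u y))\<^sup>2 + \<bar>Loc y\<bar> + X"
  shows "\<bar>energy_flux l\<bar> \<le> l * (4 * s * ball_energy l + S / s + 2 * X * (LINT y:cball 0 l|lborel. norm (u y)))"
proof -
  let ?U = "LINT y:cball 0 l|lborel. norm (u y)"
  let ?I = "indicator (cball 0 l) :: real^'n \<Rightarrow> ennreal"
  have U: "0 \<le> ?U" by (simp add: set_lebesgue_integral_def)
  have nnU: "(\<integral>\<^sup>+z. ennreal (norm (u z)) * ?I z \<partial>lborel) = ennreal ?U"
  proof -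
    have i: "integrable lborel (\<lambda>z. indicator (cball 0 l) z *\<^sub>R norm (u z))"
      by (rule borel_integrable_compact) (auto intro!: continuous_intros u_cont)
    have "(\<integral>\<^sup>+z. ennreal (norm (u z)) * ?I z \<partial>lborel)
       = (\<integral>\<^sup>+z. ennreal (indicator (cball 0 l) z *\<^sub>R norm (u z)) \<partial>lborel)"
      by (intro nn_integral_cong) (simp add: indicator_def)
    also have "\<dots> = ennreal ?U"
      unfolding set_lebesgue_integral_def by (rule nn_integral_eq_integral[OF i]) simp
    finally show ?thesis .
  qed
  note c = u_cont[of UNIV] q_cont[of UNIV] continuous_cutoff[of UNIV l]
  have i1: "integrable lborel (\<lambda>y. ((norm (u y))\<^sup>2 + 2 * q y) * (u y \<bullet> y) * cutoff l y)"
    by (intro integrable_continuous_compact_support[of _ l] continuous_intros c) (simp add: cutoff_eq_0[OF l less_imp_le])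
  have i2: "integrable lborel (\<lambda>y. (u y \<bullet> y) * cutoff l y)"
    by (intro integrable_continuous_compact_support[of _ l] continuous_intros c) (simp add: cutoff_eq_0[OF l less_imp_le])
  have "energy_flux l = energy_flux l - 2 * k * (LINT y|lborel. (u y \<bullet> y) * cutoff l y)"
    by (simp add: integral_flux_const[OF l])
  also have "\<dots> = (LINT y|lborel. ((norm (u y))\<^sup>2 + 2 * q y) * (u y \<bullet> y) * cutoff l y - 2 * k * ((u y \<bullet> y) * cutoff l y))"
    unfolding energy_flux_def using i1 i2 by simp
  also have "\<dots> = (LINT y|lborel. ((norm (u y))\<^sup>2 + 2 * (q y - k)) * (u y \<bullet> y) * cutoff l y)"
    by (simp add: algebra_simps)
  also have "\<bar>\<dots>\<bar> \<le> l * (4 * s * ball_energy l + S / s + 2 * X * ?U)"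
  proof (rule abs_integral_le)
    have "(\<integral>\<^sup>+y. ennreal \<bar>((norm (u y))\<^sup>2 + 2 * (q y - k)) * (u y \<bullet> y) * cutoff l y\<bar> \<partial>lborel)
       \<le> (\<integral>\<^sup>+y. ennreal (l * (4 * s)) * (ennreal ((norm (u y))\<^sup>2) * ?I y) + (ennreal (l / s) * (ennreal ((Loc y)\<^sup>2) * ?I y)
            + ennreal (l * (2 * X)) * (ennreal (norm (u y)) * ?I y)) \<partial>lborel)"
    proof (intro nn_integral_mono)
      fix y
      show "ennreal \<bar>((norm (u y))\<^sup>2 + 2 * (q y - k)) * (u y \<bullet> y) * cutoff l y\<bar>
        \<le> ennreal (l * (4 * s)) * (ennreal ((norm (u y))\<^sup>2) * ?I y) + (ennreal (l / s) * (ennreal ((Loc y)\<^sup>2) * ?I y)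
            + ennreal (l * (2 * X)) * (ennreal (norm (u y)) * ?I y))"
      proof (cases "norm y \<le> l")
        case False
        then show ?thesis by (simp add: cutoff_eq_0[OF l])
      next
        case True
        let ?a = "norm (u y)" and ?b = "\<bar>Loc y\<bar>"
        have 1: "\<bar>(norm (u y))\<^sup>2 + 2 * (q y - k)\<bar> \<le> 3 * ?a\<^sup>2 + 2 * ?b + 2 * X"
        proof -
          have "\<bar>(norm (u y))\<^sup>2 + 2 * (q y - k)\<bar> \<le> ?a\<^sup>2 + 2 * \<bar>q y - k\<bar>"
            using abs_triangle_ineq[of "?a\<^sup>2" "2 * (q y - k)"] abs_mult[of 2 "q y - k"] by simp
          then show ?thesis using q[OF True] by simp
        qed
        have "\<bar>u y \<bullet> y\<bar> \<le> ?a * l"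
          using Cauchy_Schwarz_ineq2[of "u y" y] mult_left_mono[OF True, of ?a] by simp
        then have 2: "\<bar>u y \<bullet> y\<bar> * cutoff l y \<le> ?a * l * 1"
          using l by (intro mult_mono cutoff_le_1) (auto simp: cutoff_nonneg)
        have "\<bar>((norm (u y))\<^sup>2 + 2 * (q y - k)) * (u y \<bullet> y) * cutoff l y\<bar>
           = \<bar>(norm (u y))\<^sup>2 + 2 * (q y - k)\<bar> * (\<bar>u y \<bullet> y\<bar> * cutoff l y)"
          by (simp add: abs_mult cutoff_nonneg)
        also have "\<dots> \<le> (3 * ?a\<^sup>2 + 2 * ?b + 2 * X) * (?a * l * 1)"
          by (rule mult_mono[OF 1 2]) (use X in \<open>auto simp: cutoff_nonneg\<close>)
        also have "\<dots> = l * (3 * ?a * ?a\<^sup>2 + 2 * ?b * ?a + 2 * X * ?a)"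
          by (simp add: algebra_simps)
        also have "\<dots> \<le> l * (3 * s * ?a\<^sup>2 + ((Loc y)\<^sup>2 / s + s * ?a\<^sup>2) + 2 * X * ?a)"
        proof -
          have "3 * ?a * ?a\<^sup>2 \<le> 3 * s * ?a\<^sup>2" using s(2)[OF True] by (intro mult_right_mono) auto
          moreover have "2 * ?b * ?a \<le> (Loc y)\<^sup>2 / s + s * ?a\<^sup>2"
          proof -
            have "0 \<le> (?b - s * ?a)\<^sup>2 / s" using s by simp
            also have "\<dots> = (Loc y)\<^sup>2 / s + s * ?a\<^sup>2 - 2 * ?b * ?a"
              using s by (simp add: power2_diff field_simps power2_eq_square)
            finally show ?thesis by simp
          qed
          ultimately have "3 * ?a * ?a\<^sup>2 + 2 * ?b * ?a + 2 * X * ?a \<le> 3 * s * ?a\<^sup>2 + ((Loc y)\<^sup>2 / s + s * ?a\<^sup>2) + 2 * X * ?a"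
            by linarith
          then show ?thesis using l by (intro mult_left_mono) auto
        qed
        also have "\<dots> = l * (4 * s) * ?a\<^sup>2 + ((l / s) * (Loc y)\<^sup>2 + l * (2 * X) * ?a)"
          by (simp add: algebra_simps)
        finally have "ennreal \<bar>((norm (u y))\<^sup>2 + 2 * (q y - k)) * (u y \<bullet> y) * cutoff l y\<bar>
           \<le> ennreal (l * (4 * s) * ?a\<^sup>2 + ((l / s) * (Loc y)\<^sup>2 + l * (2 * X) * ?a))"
          by (rule ennreal_leI)
        also have "\<dots> = ennreal (l * (4 * s)) * ennreal (?a\<^sup>2) + (ennreal (l / s) * ennreal ((Loc y)\<^sup>2) + ennreal (l * (2 * X)) * ennreal ?a)"
          using l s X by (simp add: ennreal_mult'[symmetric] ennreal_plus[symmetric] del: ennreal_plus)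
        finally show ?thesis using True by simp
      qed
    qed
    also have "\<dots> = ennreal (l * (4 * s)) * (\<integral>\<^sup>+y. ennreal ((norm (u y))\<^sup>2) * ?I y \<partial>lborel)
        + (ennreal (l / s) * (\<integral>\<^sup>+y. ennreal ((Loc y)\<^sup>2) * ?I y \<partial>lborel) + ennreal (l * (2 * X)) * (\<integral>\<^sup>+y. ennreal (norm (u y)) * ?I y \<partial>lborel))"
      by (simp add: nn_integral_add nn_integral_cmult)
    also have "\<dots> \<le> ennreal (l * (4 * s)) * ennreal (ball_energy l) + (ennreal (l / s) * ennreal S + ennreal (l * (2 * X)) * ennreal ?U)"
      unfolding ball_energy_nn nnU by (intro add_mono mult_left_mono Loc) auto
    also have "\<dots> = ennreal (l * (4 * s * ball_energy l + S / s + 2 * X * ?U))"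
      using l s X S U ball_energy_nonneg[of l]
      by (simp add: ennreal_mult'[symmetric] ennreal_plus[symmetric] distrib_left mult_ac del: ennreal_plus)
    finally show "(\<integral>\<^sup>+y. ennreal \<bar>((norm (u y))\<^sup>2 + 2 * (q y - k)) * (u y \<bullet> y) * cutoff l y\<bar> \<partial>lborel)
       \<le> ennreal (l * (4 * s * ball_energy l + S / s + 2 * X * ?U))" .
    show "0 \<le> l * (4 * s * ball_energy l + S / s + 2 * X * ?U)"
      using l s X S U ball_energy_nonneg[of l] by (intro mult_nonneg_nonneg add_nonneg_nonneg) auto
  qed
  finally show ?thesis .
qed

end

section \<open>Far field, linear part and full decomposition of the pressure\<close>

context euler_profile
begin

text \<open>Here \<open>m\<close> is the order of the Taylor remainder. Its decay
  \<open>|z|^(-N-m)\<close> beats the energy growth of exponent \<open>N + 2\<gamma>\<close> exactly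
  when \<open>2\<gamma> < m\<close>, and the tail beyond \<open>2 * l\<close> leaves
  \<open>l^m l^(2\<gamma>-m)\<close>.\<close>

lemma far_integral_bound:
  assumes M: "0 < M" and l: "1 \<le> l" "M \<le> l" and y: "norm y \<le> l"
    and CT: "0 \<le> CT"
    and CE: "0 \<le> CE" "\<And>r. M \<le> r \<Longrightarrow> ball_energy r \<le> CE * r powr (real CARD('n) + 2 * \<gamma>)"
    and m: "0 < m" "2 * \<gamma> < m"
    and a: "\<And>i j z. 2 * l < norm z \<Longrightarrow> \<bar>a i j z\<bar> \<le> CT * l powr m * norm z powr (- (real CARD('n) + m))"
  shows "\<bar>LINT z|lborel. indicator {z. 2 * l < norm z} z * (\<Sum>i\<in>UNIV. \<Sum>j\<in>UNIV. a i j z * u z $ i * u z $ j)\<bar>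
     \<le> (real CARD('n))\<^sup>2 * CT * CE * (real CARD('n) + m) / (m - 2 * \<gamma>) * l powr (2 * \<gamma>)"
proof (rule abs_integral_le)
  let ?n = "real CARD('n)"
  let ?c = "?n\<^sup>2 * CT * l powr m"
  have c: "0 \<le> ?c" using CT by simp
  have l0: "0 < 2 * l" using l by simp
  have pw: "l powr m * (2 * l) powr (2 * \<gamma> - m) \<le> l powr (2 * \<gamma>)"
  proof -
    have "(2 * l) powr (2 * \<gamma> - m) \<le> l powr (2 * \<gamma> - m)" using l m by (intro powr_mono2') auto
    then have "l powr m * (2 * l) powr (2 * \<gamma> - m) \<le> l powr m * l powr (2 * \<gamma> - m)" by (intro mult_left_mono) auto
    then show ?thesis by (simp add: powr_add[symmetric])
  qed
  have "(\<integral>\<^sup>+z. ennreal \<bar>indicator {z. 2 * l < norm z} z * (\<Sum>i\<in>UNIV. \<Sum>j\<in>UNIV. a i j z * u z $ i * u z $ j)\<bar> \<partial>lborel)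
     \<le> (\<integral>\<^sup>+z. ennreal ?c * (ennreal (norm z powr (- (?n + m))) * ennreal ((norm (u z))\<^sup>2) * indicator {z. 2 * l \<le> norm z} z) \<partial>lborel)"
  proof (intro nn_integral_mono)
    fix z :: "real^'n"
    show "ennreal \<bar>indicator {z. 2 * l < norm z} z * (\<Sum>i\<in>UNIV. \<Sum>j\<in>UNIV. a i j z * u z $ i * u z $ j)\<bar>
       \<le> ennreal ?c * (ennreal (norm z powr (- (?n + m))) * ennreal ((norm (u z))\<^sup>2) * indicator {z. 2 * l \<le> norm z} z)"
    proof (cases "2 * l < norm z")
      case True
      have "\<bar>\<Sum>i\<in>UNIV. \<Sum>j\<in>UNIV. a i j z * u z $ i * u z $ j\<bar> \<le> ?n\<^sup>2 * (CT * l powr m * norm z powr (- (?n + m))) * (norm (u z))\<^sup>2"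
        by (rule quadratic_form_bound[OF a[OF True]])
      also have "\<dots> = ?c * (norm z powr (- (?n + m)) * (norm (u z))\<^sup>2)" by simp
      finally have "ennreal \<bar>\<Sum>i\<in>UNIV. \<Sum>j\<in>UNIV. a i j z * u z $ i * u z $ j\<bar> \<le> ennreal (?c * (norm z powr (- (?n + m)) * (norm (u z))\<^sup>2))"
        by (rule ennreal_leI)
      then show ?thesis using True c by (simp add: ennreal_mult'[symmetric])
    qed simp
  qed
  also have "\<dots> = ennreal ?c * (\<integral>\<^sup>+z. ennreal (norm z powr (- (?n + m))) * ennreal ((norm (u z))\<^sup>2) * indicator {z. 2 * l \<le> norm z} z \<partial>lborel)"
    by (rule nn_integral_cmult) measurable
  also have "\<dots> \<le> ennreal ?c * ennreal (CE * (?n + m) / ((?n + m) - (?n + 2 * \<gamma>)) * (2 * l) powr ((?n + 2 * \<gamma>) - (?n + m)))"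
    by (intro mult_left_mono u_tail[OF l0 CE(1)] CE(2)) (use l m in auto)
  also have "\<dots> = ennreal (?c * (CE * (?n + m) / (m - 2 * \<gamma>) * (2 * l) powr (2 * \<gamma> - m)))"
    unfolding ennreal_mult'[OF c] by simp
  also have "\<dots> \<le> ennreal (?n\<^sup>2 * CT * CE * (?n + m) / (m - 2 * \<gamma>) * l powr (2 * \<gamma>))"
  proof (rule ennreal_leI)
    have "?c * (CE * (?n + m) / (m - 2 * \<gamma>) * (2 * l) powr (2 * \<gamma> - m))
       = ?n\<^sup>2 * CT * CE * (?n + m) / (m - 2 * \<gamma>) * (l powr m * (2 * l) powr (2 * \<gamma> - m))" by simp
    also have "\<dots> \<le> ?n\<^sup>2 * CT * CE * (?n + m) / (m - 2 * \<gamma>) * l powr (2 * \<gamma>)"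
      using CT CE m by (intro mult_left_mono pw) auto
    finally show "?c * (CE * (?n + m) / (m - 2 * \<gamma>) * (2 * l) powr (2 * \<gamma> - m)) \<le> ?n\<^sup>2 * CT * CE * (?n + m) / (m - 2 * \<gamma>) * l powr (2 * \<gamma>)" .
  qed
  finally show "(\<integral>\<^sup>+z. ennreal \<bar>indicator {z. 2 * l < norm z} z * (\<Sum>i\<in>UNIV. \<Sum>j\<in>UNIV. a i j z * u z $ i * u z $ j)\<bar> \<partial>lborel)
     \<le> ennreal (?n\<^sup>2 * CT * CE * (?n + m) / (m - 2 * \<gamma>) * l powr (2 * \<gamma>))" .
  show "0 \<le> ?n\<^sup>2 * CT * CE * (?n + m) / (m - 2 * \<gamma>) * l powr (2 * \<gamma>)"
    using CT CE m by simp
qed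

text \<open>When \<open>2\<gamma> \<ge> 1\<close>, the energy growth leaves no convergence at
  infinity against \<open>|z|^(-N-1)\<close>, hence the restriction to a shell. The extra
  \<open>\<theta>\<close> makes the comparison power decay strictly faster than the energy grows and
  avoids a logarithm at \<open>2\<gamma> = 1\<close>; its price is
  \<open>l powr (2 * \<gamma> + \<theta>)\<close> beside \<open>l\<close>.\<close>

lemma linear_integral_bound:
  assumes M: "0 < M" and l: "1 \<le> l" "M \<le> l" and \<theta>: "0 < \<theta>" and \<gamma>: "0 \<le> \<gamma>"
    and CT: "0 \<le> CT"
    and CE: "0 \<le> CE" "\<And>r. M \<le> r \<Longrightarrow> ball_energy r \<le> CE * r powr (real CARD('n) + 2 * \<gamma>)"
    and a: "\<And>i j z. M \<le> norm z \<Longrightarrow> \<bar>a i j z\<bar> \<le> CT * l * norm z powr (- (real CARD('n) + 1))"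
  shows "\<bar>LINT z|lborel. indicator {z. M \<le> norm z \<and> norm z \<le> 2 * l} z * (\<Sum>i\<in>UNIV. \<Sum>j\<in>UNIV. a i j z * u z $ i * u z $ j)\<bar>
     \<le> (real CARD('n))\<^sup>2 * CT * (CE * (real CARD('n) + 2 * \<gamma> + \<theta>) / \<theta> * M powr (- \<theta>))
         * (M powr (2 * \<gamma> + \<theta> - 1) + 2 powr (2 * \<gamma> + \<theta> - 1)) * (l + l powr (2 * \<gamma> + \<theta>))"
proof (rule abs_integral_le)
  let ?n = "real CARD('n)"
  define \<beta> where "\<beta> = 2 * \<gamma> + \<theta> - 1"
  define p where "p = ?n + 2 * \<gamma> + \<theta>"
  let ?w = "M powr \<beta> + (2 * l) powr \<beta>"
  let ?c = "?n\<^sup>2 * CT * l * ?w"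
  let ?e = "CE * p / \<theta> * M powr (- \<theta>)"
  have c: "0 \<le> ?c" using CT l by simp
  have p: "0 < p" using \<theta> \<gamma> by (simp add: p_def)
  have e: "0 \<le> ?e" using CE \<theta> p by simp
  have "(\<integral>\<^sup>+z. ennreal \<bar>indicator {z. M \<le> norm z \<and> norm z \<le> 2 * l} z * (\<Sum>i\<in>UNIV. \<Sum>j\<in>UNIV. a i j z * u z $ i * u z $ j)\<bar> \<partial>lborel)
     \<le> (\<integral>\<^sup>+z. ennreal ?c * (ennreal (norm z powr (- p)) * ennreal ((norm (u z))\<^sup>2) * indicator {z. M \<le> norm z} z) \<partial>lborel)"
  proof (intro nn_integral_mono)
    fix z :: "real^'n"
    show "ennreal \<bar>indicator {z. M \<le> norm z \<and> norm z \<le> 2 * l} z * (\<Sum>i\<in>UNIV. \<Sum>j\<in>UNIV. a i j z * u z $ i * u z $ j)\<bar>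
       \<le> ennreal ?c * (ennreal (norm z powr (- p)) * ennreal ((norm (u z))\<^sup>2) * indicator {z. M \<le> norm z} z)"
    proof (cases "M \<le> norm z \<and> norm z \<le> 2 * l")
      case True
      \<comment> \<open>The sign of \<open>\<beta>\<close> is not known. The sum of the two end
        values covers an increasing as well as a decreasing power.\<close>
      have "norm z powr \<beta> \<le> ?w"
      proof (cases "0 \<le> \<beta>")
        case True
        then have "norm z powr \<beta> \<le> (2 * l) powr \<beta>"
          using \<open>M \<le> norm z \<and> norm z \<le> 2 * l\<close> by (intro powr_mono2) auto
        then show ?thesis by (simp add: add_increasing)
      next
        case False
        then have "norm z powr \<beta> \<le> M powr \<beta>"
          using \<open>M \<le> norm z \<and> norm z \<le> 2 * l\<close> M by (intro powr_mono2') auto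
        then show ?thesis by (simp add: add_increasing2)
      qed
      then have "norm z powr \<beta> * norm z powr (- p) \<le> ?w * norm z powr (- p)" by (intro mult_right_mono) auto
      moreover have "norm z powr \<beta> * norm z powr (- p) = norm z powr (- (?n + 1))"
        by (simp add: powr_add[symmetric] \<beta>_def p_def)
      ultimately have zw: "norm z powr (- (?n + 1)) \<le> ?w * norm z powr (- p)" by simp
      have "\<bar>\<Sum>i\<in>UNIV. \<Sum>j\<in>UNIV. a i j z * u z $ i * u z $ j\<bar> \<le> ?n\<^sup>2 * (CT * l * norm z powr (- (?n + 1))) * (norm (u z))\<^sup>2"
        by (rule quadratic_form_bound) (use a True in blast)
      also have "\<dots> \<le> ?n\<^sup>2 * (CT * l * (?w * norm z powr (- p))) * (norm (u z))\<^sup>2"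
        using zw CT l by (intro mult_right_mono mult_left_mono) auto
      also have "\<dots> = ?c * (norm z powr (- p) * (norm (u z))\<^sup>2)" by simp
      finally have "ennreal \<bar>\<Sum>i\<in>UNIV. \<Sum>j\<in>UNIV. a i j z * u z $ i * u z $ j\<bar> \<le> ennreal (?c * (norm z powr (- p) * (norm (u z))\<^sup>2))"
        by (rule ennreal_leI)
      then show ?thesis using True c by (simp add: ennreal_mult'[symmetric])
    qed simp
  qed
  also have "\<dots> = ennreal ?c * (\<integral>\<^sup>+z. ennreal (norm z powr (- p)) * ennreal ((norm (u z))\<^sup>2) * indicator {z. M \<le> norm z} z \<partial>lborel)"
    by (rule nn_integral_cmult) measurable
  also have "\<dots> \<le> ennreal ?c * ennreal (CE * p / (p - (?n + 2 * \<gamma>)) * M powr ((?n + 2 * \<gamma>) - p))"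
    by (intro mult_left_mono u_tail[OF M CE(1)] CE(2)) (use \<theta> p in \<open>auto simp: p_def\<close>)
  also have "\<dots> = ennreal (?c * ?e)"
    unfolding ennreal_mult'[OF c] by (simp add: p_def)
  also have "\<dots> \<le> ennreal (?n\<^sup>2 * CT * ?e * (M powr \<beta> + 2 powr \<beta>) * (l + l powr (2 * \<gamma> + \<theta>)))"
  proof (rule ennreal_leI)
    have "l * l powr \<beta> = l powr (1 + \<beta>)" using l by (simp add: powr_add)
    then have lb: "l * l powr \<beta> = l powr (2 * \<gamma> + \<theta>)" by (simp add: \<beta>_def)
    have "l * ?w = M powr \<beta> * l + 2 powr \<beta> * l powr (2 * \<gamma> + \<theta>)"
      using l unfolding lb[symmetric] by (simp add: powr_mult algebra_simps)
    also have "\<dots> \<le> (M powr \<beta> + 2 powr \<beta>) * (l + l powr (2 * \<gamma> + \<theta>))"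
      using l by (simp add: algebra_simps)
    finally have "?n\<^sup>2 * CT * ?e * (l * ?w) \<le> ?n\<^sup>2 * CT * ?e * ((M powr \<beta> + 2 powr \<beta>) * (l + l powr (2 * \<gamma> + \<theta>)))"
      by (rule mult_left_mono) (intro mult_nonneg_nonneg e CT zero_le_power2)
    then show "?c * ?e \<le> ?n\<^sup>2 * CT * ?e * (M powr \<beta> + 2 powr \<beta>) * (l + l powr (2 * \<gamma> + \<theta>))"
      by (simp only: mult_ac)
  qed
  finally show "(\<integral>\<^sup>+z. ennreal \<bar>indicator {z. M \<le> norm z \<and> norm z \<le> 2 * l} z * (\<Sum>i\<in>UNIV. \<Sum>j\<in>UNIV. a i j z * u z $ i * u z $ j)\<bar> \<partial>lborel)
     \<le> ennreal (?n\<^sup>2 * CT * (CE * (?n + 2 * \<gamma> + \<theta>) / \<theta> * M powr (- \<theta>))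
         * (M powr (2 * \<gamma> + \<theta> - 1) + 2 powr (2 * \<gamma> + \<theta> - 1)) * (l + l powr (2 * \<gamma> + \<theta>)))"
    unfolding p_def \<beta>_def .
  show "0 \<le> ?n\<^sup>2 * CT * (CE * (?n + 2 * \<gamma> + \<theta>) / \<theta> * M powr (- \<theta>))
         * (M powr (2 * \<gamma> + \<theta> - 1) + 2 powr (2 * \<gamma> + \<theta> - 1)) * (l + l powr (2 * \<gamma> + \<theta>))"
    using CT CE \<theta> \<gamma> l by simp
qed

text \<open>The constant \<open>k\<close> collects the additive constant of \<open>q\<close> and the
  shell integral of \<open>K\<close>; \<open>Loc\<close> is the singular part, for which only a
  mean-square bound is available. The \<open>of_bool\<close> factor switches on the linear term
  unless both \<open>A\<close> and the first-order correction vanish.\<close>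

lemma pressure_decomposition:
  assumes n: "2 \<le> CARD('n)" and pressure: "pressure_representation \<kappa> \<alpha> \<delta> u q"
    and \<delta>: "\<delta> < 1" and \<gamma>: "0 \<le> \<gamma>" "\<gamma> \<le> \<delta>" and \<theta>: "0 < \<theta>"
    and P: "\<And>r. r0 \<le> r \<Longrightarrow> ball_energy r \<le> C0 * r powr (real CARD('n) + 2 * \<gamma>)"
  shows "\<exists>C l0. 0 \<le> C \<and> 1 \<le> l0 \<and> (\<forall>l s. l0 \<le> l \<longrightarrow> (\<forall>y. norm y \<le> 2 * l \<longrightarrow> norm (u y) \<le> s) \<longrightarrow>
     (\<exists>k Loc. Loc \<in> borel_measurable borel \<and>
        (\<integral>\<^sup>+y. ennreal ((Loc y)\<^sup>2) * indicator (cball 0 l) y \<partial>lborel) \<le> ennreal (C * s\<^sup>2 * ball_energy (2 * l)) \<and>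
        (\<forall>y. norm y \<le> l \<longrightarrow> \<bar>q y - k\<bar> \<le> (norm (u y))\<^sup>2 + \<bar>Loc y\<bar>
            + C * (l powr (2 * \<gamma> + \<theta>) + of_bool (\<not> (\<alpha> > -1/2 \<and> \<delta> < 1/2)) * l))))"
proof -
  let ?n = "real CARD('n)"
  define a where "a = (of_bool (\<not> (\<alpha> > -1/2 \<and> \<delta> < 1/2)) :: real)"
  have a: "0 \<le> a" by (simp add: a_def)
  define X where "X c z = (\<Sum>i\<in>UNIV. \<Sum>j\<in>UNIV. c i j z * u z $ i * u z $ j)" for c :: "'n \<Rightarrow> 'n \<Rightarrow> real^'n \<Rightarrow> real" and z
  define G where "G M y = (\<lambda>i j z. K \<kappa> i j (y - z) - indicator {z. M \<le> norm z} z * far_kernel \<kappa> \<delta> i j y z)" for M and y :: "real^'n"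
  from pressure obtain M c A where M: "0 < M" and A: "\<alpha> > -1/2 \<and> \<delta> < 1/2 \<Longrightarrow> A = 0"
    and ex: "\<forall>y. \<exists>I. has_pv (X (G M y)) y I \<and> q y = - (norm (u y))\<^sup>2 / ?n + I + A \<bullet> y + c"
    unfolding pressure_representation_def X_def G_def by blast
  from choice[OF ex] obtain I where I: "\<And>y. has_pv (X (G M y)) y (I y)"
    and qI: "\<And>y. q y = - (norm (u y))\<^sup>2 / ?n + I y + A \<bullet> y + c" by blast
  obtain CE where CE: "0 \<le> CE" "\<And>r. M \<le> r \<Longrightarrow> ball_energy r \<le> CE * r powr (?n + 2 * \<gamma>)"
    using ball_energy_growth_from[OF P M] by blast
  obtain CT where CT: "0 \<le> CT"
    and CT1: "\<And>i j (y :: real^'n) z. z \<noteq> 0 \<Longrightarrow> \<bar>frechet_derivative (K \<kappa> i j) (at z) y\<bar> \<le> CT * norm y * norm z powr (- (?n + 1))"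
    and CT2: "\<And>i j (y :: real^'n) z. z \<noteq> 0 \<Longrightarrow> 2 * norm y \<le> norm z \<Longrightarrow>
       \<bar>K \<kappa> i j (y - z) - K \<kappa> i j z\<bar> \<le> CT * norm y * norm z powr (- (?n + 1))"
    and CT3: "\<And>i j (y :: real^'n) z. z \<noteq> 0 \<Longrightarrow> 2 * norm y \<le> norm z \<Longrightarrow>
       \<bar>K \<kappa> i j (y - z) - (K \<kappa> i j z - frechet_derivative (K \<kappa> i j) (at z) y)\<bar> \<le> CT * (norm y)\<^sup>2 * norm z powr (- (?n + 2))"
    by (rule K_taylor_uniform[of \<kappa>]) blast
  \<comment> \<open>Larger than \<open>2 * \<gamma>\<close> in both cases, because
    \<open>\<gamma> \<le> \<delta>\<close> and \<delta> is below 1/2 or below 1.\<close>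
  define m :: real where "m = (if \<delta> < 1/2 then 1 else 2)"
  have m: "0 < m" "2 * \<gamma> < m" using \<gamma> \<delta> by (auto simp: m_def)
  define Cf where "Cf = ?n\<^sup>2 * CT * CE * (?n + m) / (m - 2 * \<gamma>)"
  define Cl where "Cl = ?n\<^sup>2 * CT * (CE * (?n + 2 * \<gamma> + \<theta>) / \<theta> * M powr (- \<theta>))
         * (M powr (2 * \<gamma> + \<theta> - 1) + 2 powr (2 * \<gamma> + \<theta> - 1))"
  define Cz where "Cz = ?n ^ 4 * CZ_bound TYPE('n) \<kappa>"
  define C where "C = Cf + Cl + Cz + norm A"
  have nonneg: "0 \<le> Cf" "0 \<le> Cl" "0 \<le> Cz" "0 \<le> norm A"
    using CT CE m \<theta> \<gamma> by (simp_all add: Cf_def Cl_def Cz_def CZ_bound_def)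
  have main: "\<exists>k Loc. Loc \<in> borel_measurable borel \<and>
        (\<integral>\<^sup>+y. ennreal ((Loc y)\<^sup>2) * indicator (cball 0 l) y \<partial>lborel) \<le> ennreal (C * s\<^sup>2 * ball_energy (2 * l)) \<and>
        (\<forall>y. norm y \<le> l \<longrightarrow> \<bar>q y - k\<bar> \<le> (norm (u y))\<^sup>2 + \<bar>Loc y\<bar> + C * (l powr (2 * \<gamma> + \<theta>) + a * l))"
    if lM: "max 1 M \<le> l" and s: "\<forall>y. norm y \<le> 2 * l \<longrightarrow> norm (u y) \<le> s" for l s
  proof -
    have l: "1 \<le> l" "M \<le> l" "0 < l" using lM by auto
    define T where "T n y = (\<Sum>i\<in>UNIV. \<Sum>j\<in>UNIV. truncated_convolution \<kappa> i j (1 / real (Suc n)) (near_part u (2 * l) i j) y)" for n y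
    define cl where "cl = (LINT z|lborel. indicator {z. M \<le> norm z \<and> norm z \<le> 2 * l} z * X (K \<kappa>) z)"
    define bl where "bl y = (LINT z|lborel. indicator {z. M \<le> norm z \<and> norm z \<le> 2 * l} z * X (\<lambda>i j. linear_correction \<kappa> \<delta> i j y) z)" for y
    define Fl where "Fl y = (LINT z|lborel. indicator {z. 2 * l < norm z} z * X (G M y) z)" for y
    \<comment> \<open>\<open>I\<close> is chosen point by point and brings no measurability.
      \<open>Loc\<close> gets it as the pointwise limit of the measurable functions
      \<open>T n\<close> cut off to the ball.\<close>
    define Loc where "Loc y = indicator (cball 0 l) y * (I y + cl - bl y - Fl y)" for y
    have lim: "(\<lambda>n. indicator (cball 0 l) y * T n y) \<longlonglongrightarrow> Loc y" for y
    proof (cases "norm y \<le> l")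
      case True
      have "(\<lambda>n. T n y) \<longlonglongrightarrow> I y + cl - bl y - Fl y"
        unfolding T_def cl_def bl_def Fl_def X_def G_def
        by (rule pv_near_far[OF u_cont M l(3) True]) (use I[of y] in \<open>simp add: X_def[abs_def] G_def\<close>)
      then show ?thesis using True by (simp add: Loc_def)
    qed (simp add: Loc_def)
    have [measurable]: "near_part u (2 * l) i j \<in> borel_measurable borel" for i j
      using near_part_integrable[OF u_cont] by (simp add: borel_measurable_integrable)
    have T_meas[measurable]: "T n \<in> borel_measurable borel" for n
      unfolding T_def[abs_def] by measurable
    have Loc_meas: "Loc \<in> borel_measurable borel"
      by (rule borel_measurable_LIMSEQ_real[OF lim]) measurable
    have "(\<integral>\<^sup>+y. ennreal ((Loc y)\<^sup>2) * indicator (cball 0 l) y \<partial>lborel)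
       = (\<integral>\<^sup>+y. liminf (\<lambda>n. ennreal ((indicator (cball 0 l) y * T n y)\<^sup>2)) \<partial>lborel)"
    proof (intro nn_integral_cong)
      fix y
      have "(\<lambda>n. ennreal ((indicator (cball 0 l) y * T n y)\<^sup>2)) \<longlonglongrightarrow> ennreal ((Loc y)\<^sup>2)"
        by (intro tendsto_ennrealI tendsto_power lim)
      then have "liminf (\<lambda>n. ennreal ((indicator (cball 0 l) y * T n y)\<^sup>2)) = ennreal ((Loc y)\<^sup>2)"
        by (intro lim_imp_Liminf) auto
      then show "ennreal ((Loc y)\<^sup>2) * indicator (cball 0 l) y = liminf (\<lambda>n. ennreal ((indicator (cball 0 l) y * T n y)\<^sup>2))"
        by (auto simp: Loc_def indicator_def)
    qed
    \<comment> \<open>Fatou's lemma; the bound on the right is the same for every truncation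
      radius.\<close>
    also have "\<dots> \<le> liminf (\<lambda>n. \<integral>\<^sup>+y. ennreal ((indicator (cball 0 l) y * T n y)\<^sup>2) \<partial>lborel)"
      by (rule nn_integral_liminf) measurable
    also have "\<dots> \<le> liminf (\<lambda>n. ennreal (Cz * s\<^sup>2 * ball_energy (2 * l)))"
    proof (intro Liminf_mono always_eventually allI)
      fix n :: nat
      have "(\<integral>\<^sup>+y. ennreal ((indicator (cball 0 l) y * T n y)\<^sup>2) \<partial>lborel) \<le> (\<integral>\<^sup>+y. ennreal ((T n y)\<^sup>2) \<partial>lborel)"
        by (intro nn_integral_mono ennreal_leI) (simp add: indicator_def)
      also have "\<dots> \<le> ennreal (Cz * s\<^sup>2 * ball_energy (2 * l))"
        unfolding T_def Cz_def ball_energy_def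
        by (rule near_convolution_L2[OF n u_cont]) (use s in auto)
      finally show "(\<integral>\<^sup>+y. ennreal ((indicator (cball 0 l) y * T n y)\<^sup>2) \<partial>lborel) \<le> ennreal (Cz * s\<^sup>2 * ball_energy (2 * l))" .
    qed
    also have "\<dots> = ennreal (Cz * s\<^sup>2 * ball_energy (2 * l))"
      by (simp add: Liminf_const)
    also have "\<dots> \<le> ennreal (C * s\<^sup>2 * ball_energy (2 * l))"
      using nonneg ball_energy_nonneg by (intro ennreal_leI mult_right_mono) (auto simp: C_def)
    finally have L2: "(\<integral>\<^sup>+y. ennreal ((Loc y)\<^sup>2) * indicator (cball 0 l) y \<partial>lborel) \<le> ennreal (C * s\<^sup>2 * ball_energy (2 * l))" .
    have "\<bar>q y - (c - cl)\<bar> \<le> (norm (u y))\<^sup>2 + \<bar>Loc y\<bar> + C * (l powr (2 * \<gamma> + \<theta>) + a * l)" if y: "norm y \<le> l" for y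
    proof -
      have far: "\<bar>Fl y\<bar> \<le> Cf * l powr (2 * \<gamma> + \<theta>)"
      proof -
        have "\<bar>Fl y\<bar> \<le> Cf * l powr (2 * \<gamma>)"
          unfolding Fl_def X_def Cf_def
        proof (rule far_integral_bound[OF M l(1,2) y CT CE m])
          fix i j z assume z: "2 * l < norm (z :: real^'n)"
          then have z0: "z \<noteq> 0" and yz: "2 * norm y \<le> norm z" and Mz: "M \<le> norm z" using l y by auto
          show "\<bar>G M y i j z\<bar> \<le> CT * l powr m * norm z powr (- (?n + m))"
          proof (cases "\<delta> < 1/2")
            case True
            have "CT * norm y * norm z powr (- (?n + 1)) \<le> CT * l * norm z powr (- (?n + 1))"
              using y CT by (intro mult_right_mono mult_left_mono) auto
            then show ?thesis
              using CT2[OF z0 yz, of i j] True Mz l by (simp add: G_def far_kernel_def m_def)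
          next
            case False
            have "CT * (norm y)\<^sup>2 * norm z powr (- (?n + 2)) \<le> CT * l powr 2 * norm z powr (- (?n + 2))"
              using y CT l power_mono[OF y, of 2] by (intro mult_right_mono mult_left_mono) auto
            then show ?thesis
              using CT3[OF z0 yz, of i j] False Mz by (simp add: G_def far_kernel_def m_def)
          qed
        qed
        also have "\<dots> \<le> Cf * l powr (2 * \<gamma> + \<theta>)"
          using l \<theta> nonneg by (intro mult_left_mono powr_mono) auto
        finally show ?thesis .
      qed
      have lin: "\<bar>bl y\<bar> \<le> Cl * (l powr (2 * \<gamma> + \<theta>) + a * l)"
      proof (cases "\<delta> < 1/2")
        case True
        then show ?thesis using nonneg a l by (simp add: bl_def X_def linear_correction_def)
      next
        case False
        then have a1: "a = 1" by (simp add: a_def)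
        have "\<bar>bl y\<bar> \<le> Cl * (l + l powr (2 * \<gamma> + \<theta>))"
          unfolding bl_def X_def Cl_def
        proof (rule linear_integral_bound[OF M l(1,2) \<theta> \<gamma>(1) CT CE])
          fix i j z assume z: "M \<le> norm (z :: real^'n)"
          then have "z \<noteq> 0" using M by auto
          have "CT * norm y * norm z powr (- (?n + 1)) \<le> CT * l * norm z powr (- (?n + 1))"
            using y CT by (intro mult_right_mono mult_left_mono) auto
          then show "\<bar>linear_correction \<kappa> \<delta> i j y z\<bar> \<le> CT * l * norm z powr (- (?n + 1))"
            using CT1[OF \<open>z \<noteq> 0\<close>, of i j y] False by (simp add: linear_correction_def)
        qed
        then show ?thesis by (simp add: a1 add.commute)
      qed
      have Ay: "\<bar>A \<bullet> y\<bar> \<le> norm A * (l powr (2 * \<gamma> + \<theta>) + a * l)"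
      proof (cases "\<alpha> > -1/2 \<and> \<delta> < 1/2")
        case True
        then show ?thesis using A a l by simp
      next
        case False
        then have "a = 1" by (simp add: a_def)
        have "\<bar>A \<bullet> y\<bar> \<le> norm A * norm y" by (rule Cauchy_Schwarz_ineq2)
        also have "\<dots> \<le> norm A * (l powr (2 * \<gamma> + \<theta>) + a * l)"
          using y \<open>a = 1\<close> by (intro mult_left_mono) (auto intro: add_increasing)
        finally show ?thesis .
      qed
      have un: "(norm (u y))\<^sup>2 / ?n \<le> (norm (u y))\<^sup>2"
        using n by (simp add: divide_le_eq mult_le_cancel_left1)
      have "q y - (c - cl) = - ((norm (u y))\<^sup>2 / ?n) + Loc y + bl y + Fl y + A \<bullet> y"
        unfolding qI Loc_def using y by simp
      moreover have "Cf * l powr (2 * \<gamma> + \<theta>) \<le> Cf * (l powr (2 * \<gamma> + \<theta>) + a * l)"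
        using a l nonneg by (intro mult_left_mono) auto
      moreover have "0 \<le> Cz * (l powr (2 * \<gamma> + \<theta>) + a * l)" using a l nonneg by simp
      moreover have "0 \<le> (norm (u y))\<^sup>2 / ?n" by simp
      ultimately show ?thesis
        unfolding C_def distrib_right[of _ _ "l powr (2 * \<gamma> + \<theta>) + a * l"]
        using far lin Ay un by linarith
    qed
    then show ?thesis using L2 Loc_meas by blast
  qed
  have "0 \<le> C" using nonneg by (simp add: C_def)
  then show ?thesis using main unfolding a_def by (intro exI[of _ C] exI[of _ "max 1 M"]) auto
qed

end

section \<open>Iteration of the growth exponent\<close>

lemma powr_exponent_le:
  fixes a b c C l0 :: real
  assumes c: "0 < c" and le: "\<And>l. l0 \<le> l \<Longrightarrow> c * l powr a \<le> C * l powr b"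
  shows "a \<le> b"
proof (rule ccontr)
  assume "\<not> a \<le> b"
  then have "filterlim (\<lambda>l::real. l powr (a - b)) at_top at_top"
    by (intro real_powr_at_top) simp
  then have "\<forall>\<^sub>F l in at_top. C / c < l powr (a - b)"
    by (simp add: filterlim_at_top_dense)
  moreover have "\<forall>\<^sub>F l in at_top. max l0 1 \<le> l" by (rule eventually_ge_at_top)
  ultimately have "\<forall>\<^sub>F l in at_top. C / c < l powr (a - b) \<and> max l0 1 \<le> l"
    by (rule eventually_conj)
  then obtain l where l: "C / c < l powr (a - b)" "max l0 1 \<le> l"
    using eventually_happens'[OF trivial_limit_at_top_linorder] by blast
  then have "C * l powr b < c * (l powr (a - b) * l powr b)"
    using c by (simp add: field_simps mult_strict_right_mono)
  also have "l powr (a - b) * l powr b = l powr a" by (simp add: powr_add[symmetric])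
  finally show False using le[of l] l by simp
qed

text \<open>Subtracting or adding the antiderivative \<open>C / \<beta> * l powr \<beta>\<close>
  makes \<open>e\<close> monotone. Both signs of \<open>\<beta>\<close> are used: positive to bound
  growth, negative to bound what can still change beyond \<open>l\<close>.\<close>

lemma increment_le_of_powr_derivative:
  fixes e e' :: "real \<Rightarrow> real"
  assumes der: "\<And>l. l0 \<le> l \<Longrightarrow> (e has_real_derivative e' l) (at l)"
    and bd: "\<And>l. l0 \<le> l \<Longrightarrow> \<bar>e' l\<bar> \<le> C * l powr (\<beta> - 1)"
    and \<beta>: "\<beta> \<noteq> 0" and l: "0 < l0" "l0 \<le> l" "l \<le> m"
  shows "\<bar>e m - e l\<bar> \<le> C / \<beta> * (m powr \<beta> - l powr \<beta>)"
proof -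
  have p: "((\<lambda>x. C / \<beta> * x powr \<beta>) has_real_derivative C * x powr (\<beta> - 1)) (at x)" if "l \<le> x" for x
    using that l \<beta> by (auto intro!: derivative_eq_intros)
  have "e m - C / \<beta> * m powr \<beta> \<le> e l - C / \<beta> * l powr \<beta>"
  proof (rule DERIV_nonpos_imp_nonincreasing[OF l(3)])
    fix x assume x: "l \<le> x" "x \<le> m"
    show "\<exists>y. ((\<lambda>x. e x - C / \<beta> * x powr \<beta>) has_real_derivative y) (at x) \<and> y \<le> 0"
      using DERIV_diff[OF der p, of x] bd[of x] x l by fastforce
  qed
  moreover have "e l + C / \<beta> * l powr \<beta> \<le> e m + C / \<beta> * m powr \<beta>"
  proof (rule DERIV_nonneg_imp_nondecreasing[OF l(3)])
    fix x assume x: "l \<le> x" "x \<le> m"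
    show "\<exists>y. ((\<lambda>x. e x + C / \<beta> * x powr \<beta>) has_real_derivative y) (at x) \<and> 0 \<le> y"
      using DERIV_add[OF der p, of x] bd[of x] x l by fastforce
  qed
  ultimately show ?thesis by (simp add: right_diff_distrib)
qed

text \<open>The Euler equations are hidden in \<open>rate\<close>: a growth exponent \<gamma> for
  \<open>E\<close> controls \<open>e'\<close> with a surplus of \<open>4 * \<eta>\<close>. The lower
  bound makes \<epsilon> a floor, since by \<open>P_ge\<close> no smaller exponent is possible;
  every descent ends after finitely many steps, either at its goal or in a contradiction.\<close>

lemma energy_scaling_dichotomy:
  fixes E e e' :: "real \<Rightarrow> real" and N \<alpha> \<delta> \<epsilon> \<eta> :: real
  defines "P \<equiv> \<lambda>\<gamma>. \<exists>C l0. \<forall>l\<ge>l0. E l \<le> C * l powr (N + 2 * \<gamma>)"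
  assumes \<eta>: "0 < \<eta>" and \<epsilon>\<delta>: "\<epsilon> < \<delta>"
    and e_nonneg: "\<And>l. 0 \<le> e l"
    and e_le: "\<And>l. 1 \<le> l \<Longrightarrow> e l \<le> l powr (2 * \<alpha> - N) * E l"
    and E_le: "\<And>l. 1 \<le> l \<Longrightarrow> E l \<le> B * l powr (N - 2 * \<alpha>) * e (2 * l)" and B: "0 \<le> B"
    and der: "\<And>l. 1 \<le> l \<Longrightarrow> (e has_real_derivative e' l) (at l)"
    and rate: "\<And>\<gamma>. \<epsilon> \<le> \<gamma> \<Longrightarrow> \<gamma> \<le> \<delta> \<Longrightarrow> P \<gamma> \<Longrightarrow>
        \<exists>C l0. \<forall>l\<ge>l0. \<bar>e' l\<bar> \<le> C * l powr (2 * (\<alpha> + \<gamma>) - 1 - 4 * \<eta>)"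
    and P\<delta>: "P \<delta>"
    and lower: "0 < c" "\<And>l. L \<le> l \<Longrightarrow> c * l powr (N + 2 * \<epsilon>) \<le> E l"
  shows "- \<delta> \<le> \<alpha> \<and> \<alpha> \<le> - \<epsilon> \<and>
     (\<exists>c' C l0. 0 < c' \<and> (\<forall>l\<ge>l0. c' * l powr (N - 2 * \<alpha>) \<le> E l \<and> E l \<le> C * l powr (N - 2 * \<alpha>)))"
proof -
  have P_ge: "\<epsilon> \<le> \<gamma>" if "P \<gamma>" for \<gamma>
  proof -
    from that obtain C l0 where C: "\<And>l. l0 \<le> l \<Longrightarrow> E l \<le> C * l powr (N + 2 * \<gamma>)" unfolding P_def by blast
    have *: "c * l powr (N + 2 * \<epsilon>) \<le> C * l powr (N + 2 * \<gamma>)" if "max L l0 \<le> l" for l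
      using lower(2)[of l] C[of l] that by simp
    have "N + 2 * \<epsilon> \<le> N + 2 * \<gamma>"
      by (rule powr_exponent_le[OF lower(1)]) (erule *)
    then show ?thesis by simp
  qed
  have P_mono: "P \<gamma>'" if P: "P \<gamma>" and le: "\<gamma> \<le> \<gamma>'" for \<gamma> \<gamma>'
  proof -
    from P obtain C l0 where C: "\<And>l. l0 \<le> l \<Longrightarrow> E l \<le> C * l powr (N + 2 * \<gamma>)" unfolding P_def by blast
    have "E l \<le> \<bar>C\<bar> * l powr (N + 2 * \<gamma>')" if "max l0 1 \<le> l" for l
    proof -
      have "E l \<le> C * l powr (N + 2 * \<gamma>)" using C that by simp
      also have "\<dots> \<le> \<bar>C\<bar> * l powr (N + 2 * \<gamma>')"
        using that le by (intro mult_mono powr_mono) auto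
      finally show ?thesis .
    qed
    then show ?thesis unfolding P_def by blast
  qed
  have P_of_e: "P \<gamma>" if ebd: "\<And>l. l0 \<le> l \<Longrightarrow> e l \<le> C * l powr (2 * (\<alpha> + \<gamma>))" for \<gamma> C l0
  proof -
    have "E l \<le> B * C * 2 powr (2 * (\<alpha> + \<gamma>)) * l powr (N + 2 * \<gamma>)" if l: "max l0 1 \<le> l" for l
    proof -
      have "E l \<le> B * l powr (N - 2 * \<alpha>) * e (2 * l)" using l by (intro E_le) simp
      also have "\<dots> \<le> B * l powr (N - 2 * \<alpha>) * (C * (2 * l) powr (2 * (\<alpha> + \<gamma>)))"
        using l B ebd[of "2 * l"] by (intro mult_left_mono) auto
      also have "\<dots> = B * C * 2 powr (2 * (\<alpha> + \<gamma>)) * (l powr (N - 2 * \<alpha>) * l powr (2 * (\<alpha> + \<gamma>)))"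
        using l by (simp add: powr_mult)
      also have "l powr (N - 2 * \<alpha>) * l powr (2 * (\<alpha> + \<gamma>)) = l powr (N + 2 * \<gamma>)"
        by (simp add: powr_add[symmetric] algebra_simps)
      finally show ?thesis .
    qed
    then show ?thesis unfolding P_def by blast
  qed
  have rate': "\<exists>C l0. 1 \<le> l0 \<and> 0 \<le> C \<and> (\<forall>l\<ge>l0. \<bar>e' l\<bar> \<le> C * l powr (\<beta> - 1))"
    if P: "P \<gamma>" and "\<gamma> \<le> \<delta>" and \<beta>: "2 * (\<alpha> + \<gamma>) - 4 * \<eta> \<le> \<beta>" for \<gamma> \<beta>
  proof -
    from rate[OF P_ge[OF P] that(2) P] obtain C l0
      where C: "\<And>l. l0 \<le> l \<Longrightarrow> \<bar>e' l\<bar> \<le> C * l powr (2 * (\<alpha> + \<gamma>) - 1 - 4 * \<eta>)" by blast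
    have "\<bar>e' l\<bar> \<le> \<bar>C\<bar> * l powr (\<beta> - 1)" if "max l0 1 \<le> l" for l
    proof -
      have "\<bar>e' l\<bar> \<le> C * l powr (2 * (\<alpha> + \<gamma>) - 1 - 4 * \<eta>)" using C that by simp
      also have "\<dots> \<le> \<bar>C\<bar> * l powr (\<beta> - 1)"
        using that \<beta> by (intro mult_mono powr_mono) auto
      finally show ?thesis .
    qed
    then show ?thesis by (intro exI[of _ "\<bar>C\<bar>"] exI[of _ "max l0 1"]) auto
  qed
  have grow: "\<exists>C l0. \<forall>l\<ge>l0. e l \<le> C * l powr \<beta>"
    if l0: "1 \<le> l0" and C: "0 \<le> C" "\<And>l. l0 \<le> l \<Longrightarrow> \<bar>e' l\<bar> \<le> C * l powr (\<beta> - 1)" and \<beta>: "0 < \<beta>" for C l0 \<beta>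
  proof -
    have "e l \<le> (e l0 + C / \<beta>) * l powr \<beta>" if l: "l0 \<le> l" for l
    proof -
      have "\<bar>e l - e l0\<bar> \<le> C / \<beta> * (l powr \<beta> - l0 powr \<beta>)"
        by (rule increment_le_of_powr_derivative[of l0 e e']) (use der C \<beta> l0 l in auto)
      also have "\<dots> \<le> C / \<beta> * l powr \<beta>" using C \<beta> by (intro mult_left_mono) auto
      finally have "e l \<le> e l0 * 1 + C / \<beta> * l powr \<beta>" by simp
      also have "e l0 * 1 \<le> e l0 * l powr \<beta>"
        using l l0 \<beta> e_nonneg by (intro mult_left_mono ge_one_powr_ge_zero) auto
      finally show ?thesis by (simp add: distrib_right)
    qed
    then show ?thesis by blast
  qed
  have decay: "\<bar>e m - e l\<bar> \<le> C / (- \<beta>) * l powr \<beta>"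
    if l0: "1 \<le> l0" and C: "0 \<le> C" "\<And>l. l0 \<le> l \<Longrightarrow> \<bar>e' l\<bar> \<le> C * l powr (\<beta> - 1)"
      and \<beta>: "\<beta> < 0" and lm: "l0 \<le> l" "l \<le> m" for C l0 \<beta> l m
  proof -
    have "\<bar>e m - e l\<bar> \<le> C / \<beta> * (m powr \<beta> - l powr \<beta>)"
      by (rule increment_le_of_powr_derivative[of l0 e e']) (use der C \<beta> l0 lm in auto)
    also have "\<dots> = C / (- \<beta>) * (l powr \<beta> - m powr \<beta>)" using \<beta> by (simp add: field_simps)
    also have "\<dots> \<le> C / (- \<beta>) * l powr \<beta>" using C \<beta> by (intro mult_left_mono) (auto simp: divide_nonneg_neg)
    finally show ?thesis .
  qed
  \<comment> \<open>\<open>n\<close> bounds the number of steps of size \<open>\<eta>\<close> that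
    still fit above the floor. For \<open>n = 0\<close> the premises contradict
    \<open>P_ge\<close>.\<close>
  have descend: "P (- \<alpha>)" if "P \<gamma>" "\<gamma> \<le> \<delta>" "\<gamma> < \<epsilon> + real n * \<eta>" for n \<gamma>
    using that
  proof (induction n arbitrary: \<gamma>)
    case 0
    then show ?case using P_ge by fastforce
  next
    case (Suc n)
    show ?case
    \<comment> \<open>A step by \<open>\<eta>\<close> spends half of the surplus. Above the
      threshold the resulting exponent \<open>2 * (\<alpha> + (\<gamma> - \<eta>))\<close> is still
      positive and \<open>grow\<close> applies. Below it the full surplus makes the exponent
      negative, and \<open>e\<close> is bounded at once.\<close>
    proof (cases "2 * \<eta> \<le> \<alpha> + \<gamma>")
      case True
      from rate'[OF Suc.prems(1,2), of "2 * (\<alpha> + (\<gamma> - \<eta>))"] \<eta>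
      obtain C l0 where "1 \<le> l0" "0 \<le> C" "\<And>l. l0 \<le> l \<Longrightarrow> \<bar>e' l\<bar> \<le> C * l powr (2 * (\<alpha> + (\<gamma> - \<eta>)) - 1)"
        by auto
      from grow[OF this] True \<eta>
      obtain D l1 where "\<And>l. l1 \<le> l \<Longrightarrow> e l \<le> D * l powr (2 * (\<alpha> + (\<gamma> - \<eta>)))"
        by auto
      then have "P (\<gamma> - \<eta>)" by (rule P_of_e)
      then show ?thesis using Suc.IH[of "\<gamma> - \<eta>"] Suc.prems \<eta> by (simp add: algebra_simps)
    next
      case False
      define \<beta> where "\<beta> = 2 * (\<alpha> + \<gamma>) - 4 * \<eta>"
      have \<beta>: "\<beta> < 0" using False by (simp add: \<beta>_def)
      from rate'[OF Suc.prems(1,2), of \<beta>] obtain C l0 where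
        l0: "1 \<le> l0" and C: "0 \<le> C" "\<And>l. l0 \<le> l \<Longrightarrow> \<bar>e' l\<bar> \<le> C * l powr (\<beta> - 1)"
        by (auto simp: \<beta>_def)
      have "e l \<le> (e l0 + C / (- \<beta>) * l0 powr \<beta>) * l powr (2 * (\<alpha> + - \<alpha>))" if "l0 \<le> l" for l
        using decay[OF l0 C \<beta> order_refl that] l0 that by simp
      then show ?thesis by (rule P_of_e)
    qed
  qed
  obtain n where "(\<delta> - \<epsilon>) / \<eta> < real n" using reals_Archimedean2 by blast
  then have "\<delta> < \<epsilon> + real n * \<eta>" using \<eta> by (simp add: field_simps)
  then have P\<alpha>: "P (- \<alpha>)" by (rule descend[OF P\<delta> order_refl])
  then have \<alpha>\<epsilon>: "\<alpha> \<le> - \<epsilon>" using P_ge by fastforce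
  \<comment> \<open>The bound by \<delta> keeps \<open>rate\<close> available, the bound by
    \<open>- \<alpha>\<close> makes the exponents of \<open>e'\<close> integrable at
    infinity.\<close>
  define \<gamma>0 where "\<gamma>0 = min \<delta> (- \<alpha>)"
  have \<gamma>0: "P \<gamma>0" "\<gamma>0 \<le> \<delta>" "\<alpha> + \<gamma>0 \<le> 0"
    using P\<delta> P\<alpha> by (auto simp: \<gamma>0_def min_def)
  \<comment> \<open>Of the limit only a positive eventual lower bound is used. If there is none,
    \<open>e\<close> is arbitrarily small at arbitrarily large arguments, and \<open>decay\<close>
    from \<open>l\<close> to such an argument bounds \<open>e l\<close> itself by a negative power
    of \<open>l\<close>.\<close>
  have lim: "\<exists>m. 0 < m \<and> (\<exists>l0. \<forall>l\<ge>l0. m \<le> e l)"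
  proof (rule ccontr)
    assume no: "\<not> ?thesis"
    have False if "P \<gamma>" "\<gamma> \<le> \<gamma>0" "\<gamma> < \<epsilon> + real n * (2 * \<eta>)" for n \<gamma>
      using that
    proof (induction n arbitrary: \<gamma>)
      case 0
      then show ?case using P_ge by fastforce
    next
      case (Suc n)
      \<comment> \<open>No positivity has to be preserved here, so the full surplus is spent and
        \<gamma> drops by \<open>2 * \<eta>\<close> in each step.\<close>
      define \<beta> where "\<beta> = 2 * (\<alpha> + (\<gamma> - 2 * \<eta>))"
      have \<beta>: "\<beta> < 0" using Suc.prems \<gamma>0 \<eta> by (simp add: \<beta>_def)
      have "\<gamma> \<le> \<delta>" using Suc.prems \<gamma>0 by simp
      from rate'[OF Suc.prems(1) this, of \<beta>] obtain C l0 where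
        l0: "1 \<le> l0" and C: "0 \<le> C" "\<And>l. l0 \<le> l \<Longrightarrow> \<bar>e' l\<bar> \<le> C * l powr (\<beta> - 1)"
        by (auto simp: \<beta>_def)
      have "e l \<le> C / (- \<beta>) * l powr \<beta>" if l: "l0 \<le> l" for l
      proof (rule field_le_epsilon)
        fix m :: real assume "0 < m"
        with no have "\<not> (\<forall>k\<ge>l. m \<le> e k)" by blast
        then obtain k where "l \<le> k" "e k < m" by force
        then show "e l \<le> C / (- \<beta>) * l powr \<beta> + m" using decay[OF l0 C \<beta> l, of k] by simp
      qed
      then have "P (\<gamma> - 2 * \<eta>)" unfolding \<beta>_def by (rule P_of_e)
      then show ?case using Suc.IH[of "\<gamma> - 2 * \<eta>"] Suc.prems \<eta> by (simp add: algebra_simps)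
    qed
    moreover obtain n where "(\<gamma>0 - \<epsilon>) / (2 * \<eta>) < real n" using reals_Archimedean2 by blast
    then have "\<gamma>0 < \<epsilon> + real n * (2 * \<eta>)" using \<eta> by (simp add: field_simps)
    ultimately show False using \<gamma>0 by blast
  qed
  then obtain m l1 where m: "0 < m" "\<And>l. l1 \<le> l \<Longrightarrow> m \<le> e l" by blast
  from P\<alpha> obtain C l0 where up: "\<And>l. l0 \<le> l \<Longrightarrow> E l \<le> C * l powr (N - 2 * \<alpha>)" unfolding P_def by auto
  have low: "m * l powr (N - 2 * \<alpha>) \<le> E l" if l: "max l1 1 \<le> l" for l
  proof -
    have "m * l powr (N - 2 * \<alpha>) \<le> (l powr (2 * \<alpha> - N) * E l) * l powr (N - 2 * \<alpha>)"
      using order_trans[OF m(2) e_le, of l] l by (intro mult_right_mono) auto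
    also have "\<dots> = (l powr (2 * \<alpha> - N) * l powr (N - 2 * \<alpha>)) * E l" by simp
    also have "l powr (2 * \<alpha> - N) * l powr (N - 2 * \<alpha>) = 1" using l by (simp add: powr_add[symmetric])
    finally show ?thesis by simp
  qed
  \<comment> \<open>The lower growth just found, against the a priori exponent \<delta>, yields
    \<open>- \<delta> \<le> \<alpha>\<close>. The other inequality came from the floor applied to
    \<open>P (- \<alpha>)\<close>.\<close>
  from P\<delta> obtain C' l' where C': "\<And>l. l' \<le> l \<Longrightarrow> E l \<le> C' * l powr (N + 2 * \<delta>)" unfolding P_def by blast
  have *: "m * l powr (N - 2 * \<alpha>) \<le> C' * l powr (N + 2 * \<delta>)" if "max l' (max l1 1) \<le> l" for l
    using low[of l] C'[of l] that by simp
  have "N - 2 * \<alpha> \<le> N + 2 * \<delta>"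
    by (rule powr_exponent_le[OF m(1)]) (erule *)
  then have "- \<delta> \<le> \<alpha>" by simp
  moreover have "\<exists>c' C l0. 0 < c' \<and> (\<forall>l\<ge>l0. c' * l powr (N - 2 * \<alpha>) \<le> E l \<and> E l \<le> C * l powr (N - 2 * \<alpha>))"
    using up low m(1) by (intro exI[of _ m] exI[of _ C] exI[of _ "max l0 (max l1 1)"]) auto
  ultimately show ?thesis using \<alpha>\<epsilon> by blast
qed

section \<open>Conclusion\<close>

context euler_profile
begin

text \<open>Turns the bound near infinity into a supremum bound on balls, the form in which
  \<open>s\<close> is needed. Compactness handles the inner ball, and
  \<open>r powr \<delta> \<ge> 1\<close> absorbs the resulting constant.\<close>

lemma u_sup_growth:
  assumes \<delta>: "0 \<le> \<delta>" and g: "\<And>y. R0 \<le> norm y \<Longrightarrow> norm (u y) \<le> Cu * norm y powr \<delta>"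
  obtains Cs where "0 < Cs" "\<And>r y. 1 \<le> r \<Longrightarrow> norm y \<le> r \<Longrightarrow> norm (u y) \<le> Cs * r powr \<delta>"
proof -
  have "bounded (u ` cball 0 R0)"
    by (intro compact_imp_bounded compact_continuous_image u_cont) simp
  then obtain B where "\<forall>x\<in>u ` cball 0 R0. norm x \<le> B" unfolding bounded_iff ..
  then have B: "norm (u y) \<le> B" if "norm y \<le> R0" for y using that by simp
  define Cs where "Cs = 1 + \<bar>B\<bar> + \<bar>Cu\<bar>"
  have "norm (u y) \<le> Cs * r powr \<delta>" if r: "1 \<le> r" "norm y \<le> r" for r y
  proof -
    have r1: "1 \<le> r powr \<delta>" using r \<delta> by (rule_tac ge_one_powr_ge_zero) auto
    have "norm (u y) \<le> \<bar>B\<bar> * r powr \<delta> + \<bar>Cu\<bar> * r powr \<delta>"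
    proof (cases "norm y \<le> R0")
      case True
      have "norm (u y) \<le> \<bar>B\<bar> * 1" using B[OF True] by simp
      also have "\<dots> \<le> \<bar>B\<bar> * r powr \<delta>" using r1 by (intro mult_left_mono) auto
      finally show ?thesis by (simp add: add_increasing2)
    next
      case False
      then have "norm (u y) \<le> Cu * norm y powr \<delta>" by (intro g) simp
      also have "\<dots> \<le> \<bar>Cu\<bar> * r powr \<delta>" using r \<delta> by (intro mult_mono powr_mono2) auto
      finally show ?thesis by (simp add: add_increasing)
    qed
    also have "\<dots> \<le> Cs * r powr \<delta>" using r1 by (simp add: Cs_def distrib_right)
    finally show ?thesis .
  qed
  moreover have "0 < Cs" by (simp add: Cs_def add_pos_nonneg)
  ultimately show thesis using that by blast
qed

text \<open>Stated for free \<open>c\<close> and \<open>d\<close> because two choices occur in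
  \<open>flux_rate\<close>: a supremum bound with \<open>d = 0\<close>, and an energy bound with
  \<open>c = l powr \<gamma>\<close> and \<open>d = l powr (- \<gamma>)\<close>.\<close>

lemma integral_norm_u_le:
  assumes l: "0 \<le> l" and b: "\<And>y. norm y \<le> l \<Longrightarrow> norm (u y) \<le> c + d * (norm (u y))\<^sup>2"
  shows "(LINT y:cball 0 l|lborel. norm (u y)) \<le> c * (unit_ball_vol (real CARD('n)) * l powr real CARD('n)) + d * ball_energy l"
proof (cases "l = 0")
  case True
  have "cball (0::real^'n) 0 = {0}" by auto
  moreover have "AE y in lborel. y \<noteq> (0::real^'n)" by (rule AE_lborel_singleton)
  then have "(LINT y:{0::real^'n}|lborel. f y) = 0" for f :: "real^'n \<Rightarrow> real"
    unfolding set_lebesgue_integral_def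
    by (intro integral_eq_zero_AE) (auto elim!: eventually_mono)
  ultimately show ?thesis using True by (simp add: ball_energy_def)
next
  case False
  then have l: "0 < l" using l by simp
  have i0: "integrable lborel (\<lambda>y::real^'n. indicator (cball 0 l) y *\<^sub>R c)"
    by (rule borel_integrable_compact) auto
  have i1: "integrable lborel (\<lambda>y. indicator (cball 0 l) y *\<^sub>R norm (u y))"
    by (rule borel_integrable_compact) (auto intro!: continuous_intros u_cont)
  have i2: "integrable lborel (\<lambda>y. indicator (cball 0 l) y *\<^sub>R (norm (u y))\<^sup>2)"
    using ball_energy_integrable[of l] by (simp add: set_integrable_def)
  have "(LINT y:cball 0 l|lborel. norm (u y))
     \<le> (LINT y|lborel. indicator (cball 0 l) y *\<^sub>R c + d * (indicator (cball 0 l) y *\<^sub>R (norm (u y))\<^sup>2))"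
    unfolding set_lebesgue_integral_def
    by (intro integral_mono i1 Bochner_Integration.integrable_add i0 integrable_mult_right i2) (use b in \<open>auto simp: indicator_def\<close>)
  also have "\<dots> = (LINT y|lborel. indicator (cball (0::real^'n) l) y *\<^sub>R c) + d * ball_energy l"
    using i0 i2 by (simp add: ball_energy_def set_lebesgue_integral_def)
  also have "(LINT y|lborel. indicator (cball (0::real^'n) l) y *\<^sub>R c) = c * measure lborel (cball (0::real^'n) l)"
    by simp
  also have "measure lborel (cball (0::real^'n) l) = unit_ball_vol (real CARD('n)) * l powr real CARD('n)"
    using content_cball[of l "0::real^'n"] l by (simp add: powr_realpow)
  finally show ?thesis .
qed

text \<open>Power counting: the cubic terms are of order
  \<open>l * l^\<delta> * l^(N+2\<gamma>)\<close>, that is \<open>l^(N+2+2\<gamma>)\<close> times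
  \<open>l^(\<delta>-1)\<close>. Half of this gap, \<open>\<theta> = (1 - \<delta>) / 2\<close>,
  pays for the loss in the pressure bound, the other half is kept as gain. The linear pressure,
  paired with an integral of \<open>|u|\<close> of order \<open>l^(N+\<gamma>)\<close>, gives the
  last term.\<close>

lemma flux_rate:
  assumes n: "2 \<le> CARD('n)" and pressure: "pressure_representation \<kappa> \<alpha> \<delta> u q"
    and \<delta>: "0 < \<delta>" "\<delta> < 1" and \<gamma>: "0 \<le> \<gamma>" "\<gamma> \<le> \<delta>"
    and Cs: "0 < Cs" "\<And>r y. 1 \<le> r \<Longrightarrow> norm y \<le> r \<Longrightarrow> norm (u y) \<le> Cs * r powr \<delta>"
    and P: "\<And>r. r0 \<le> r \<Longrightarrow> ball_energy r \<le> C0 * r powr (real CARD('n) + 2 * \<gamma>)"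
  shows "\<exists>C l0. 1 \<le> l0 \<and> (\<forall>l\<ge>l0. \<bar>energy_flux l\<bar> \<le> C * l powr (real CARD('n) + 2) *
     (l powr (2 * \<gamma> - (1 - \<delta>) / 2) + of_bool (\<not> (\<alpha> > -1/2 \<and> \<delta> < 1/2)) * l powr \<gamma>))"
proof -
  let ?n = "real CARD('n)" and ?V = "unit_ball_vol (real CARD('n))"
  define \<theta> where "\<theta> = (1 - \<delta>) / 2"
  define a where "a = (of_bool (\<not> (\<alpha> > -1/2 \<and> \<delta> < 1/2)) :: real)"
  have a: "0 \<le> a" by (simp add: a_def)
  have \<theta>: "0 < \<theta>" using \<delta> by (simp add: \<theta>_def)
  obtain C l1 where C: "0 \<le> C" and l1: "1 \<le> l1"
    and dec: "\<And>l s. l1 \<le> l \<Longrightarrow> (\<forall>y. norm y \<le> 2 * l \<longrightarrow> norm (u y) \<le> s) \<Longrightarrow>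
     \<exists>k Loc. Loc \<in> borel_measurable borel \<and>
        (\<integral>\<^sup>+y. ennreal ((Loc y)\<^sup>2) * indicator (cball 0 l) y \<partial>lborel) \<le> ennreal (C * s\<^sup>2 * ball_energy (2 * l)) \<and>
        (\<forall>y. norm y \<le> l \<longrightarrow> \<bar>q y - k\<bar> \<le> (norm (u y))\<^sup>2 + \<bar>Loc y\<bar> + C * (l powr (2 * \<gamma> + \<theta>) + a * l))"
    using pressure_decomposition[OF n pressure \<delta>(2) \<gamma> \<theta> P] unfolding a_def by blast
  obtain CE where CE: "0 \<le> CE" "\<And>r. 1 \<le> r \<Longrightarrow> ball_energy r \<le> CE * r powr (?n + 2 * \<gamma>)"
    using ball_energy_growth_from[OF P zero_less_one] by blast
  define CE2 where "CE2 = CE * 2 powr (?n + 2 * \<gamma>)"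
  define s0 where "s0 = Cs * 2 powr \<delta>"
  define D where "D = (4 + C) * (s0 * CE2) + 2 * C * (s0 * ?V) + 2 * C * (?V + CE)"
  have "\<bar>energy_flux l\<bar> \<le> D * l powr (?n + 2) * (l powr (2 * \<gamma> - \<theta>) + a * l powr \<gamma>)" if l: "l1 \<le> l" for l
  proof -
    have l1': "1 \<le> l" "0 < l" using l l1 by auto
    define s where "s = s0 * l powr \<delta>"
    have s0: "0 < s0" using Cs by (simp add: s0_def)
    have s: "0 < s" using s0 l1' by (simp add: s_def)
    have us: "norm (u y) \<le> s" if "norm y \<le> 2 * l" for y
      using Cs(2)[OF _ that] l1' by (simp add: s_def s0_def powr_mult mult.assoc)
    obtain k Loc where Loc: "Loc \<in> borel_measurable borel"
        "(\<integral>\<^sup>+y. ennreal ((Loc y)\<^sup>2) * indicator (cball 0 l) y \<partial>lborel) \<le> ennreal (C * s\<^sup>2 * ball_energy (2 * l))"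
        "\<And>y. norm y \<le> l \<Longrightarrow> \<bar>q y - k\<bar> \<le> (norm (u y))\<^sup>2 + \<bar>Loc y\<bar> + C * (l powr (2 * \<gamma> + \<theta>) + a * l)"
      using dec[OF l] us by blast
    let ?U = "LINT y:cball 0 l|lborel. norm (u y)" and ?X = "C * (l powr (2 * \<gamma> + \<theta>) + a * l)"
    have X: "0 \<le> ?X" using C a l1' by simp
    have S: "0 \<le> C * s\<^sup>2 * ball_energy (2 * l)" using C ball_energy_nonneg by simp
    have U: "0 \<le> ?U" by (simp add: set_lebesgue_integral_def)
    have flux: "\<bar>energy_flux l\<bar> \<le> l * (4 * s * ball_energy l + C * s\<^sup>2 * ball_energy (2 * l) / s + 2 * ?X * ?U)"
      by (rule energy_flux_le[OF l1'(2) s _ Loc(1) S X Loc(2,3)]) (use us l1' in auto)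
    define L where "L = l powr (?n + 1 + 2 * \<gamma> - \<theta>)"
    define L' where "L' = l powr (?n + 1 + \<gamma>)"
    have E2: "ball_energy (2 * l) \<le> CE2 * l powr (?n + 2 * \<gamma>)"
      using CE(2)[of "2 * l"] l1' by (simp add: CE2_def powr_mult mult.assoc)
    have E1: "ball_energy l \<le> ball_energy (2 * l)" using l1' by (intro ball_energy_mono) simp
    have sE: "s * ball_energy (2 * l) \<le> s0 * CE2 * L"
    proof -
      have "s * ball_energy (2 * l) \<le> s0 * l powr \<delta> * (CE2 * l powr (?n + 2 * \<gamma>))"
        unfolding s_def using E2 s0 by (intro mult_left_mono) auto
      also have "\<dots> = s0 * CE2 * l powr (\<delta> + (?n + 2 * \<gamma>))" by (simp add: powr_add)
      also have "\<dots> \<le> s0 * CE2 * L"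
        unfolding L_def using l1' s0 CE \<delta> by (intro mult_left_mono powr_mono) (auto simp: CE2_def \<theta>_def field_simps)
      finally show ?thesis .
    qed
    have U1: "?U \<le> s * (?V * l powr ?n)"
      using integral_norm_u_le[of l s 0] us l1' by simp
    \<comment> \<open>In \<open>|u| \<le> g + |u|^2 / g\<close> the choice
      \<open>g = l powr \<gamma>\<close> balances volume against energy. It replaces the exponent
      \<delta> of \<open>U1\<close> by \<gamma>, which the linear pressure term requires.\<close>
    have U2: "?U \<le> (?V + CE) * l powr (?n + \<gamma>)"
    proof -
      have "norm (u y) \<le> l powr \<gamma> + l powr (- \<gamma>) * (norm (u y))\<^sup>2" for y
      proof -
        define g where "g = l powr \<gamma>"
        have g: "0 < g" using l1' by (simp add: g_def)
        have "0 \<le> (norm (u y) - g)\<^sup>2 / g" using g by simp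
        also have "\<dots> = (norm (u y))\<^sup>2 / g - 2 * norm (u y) + g"
          using g by (simp add: power2_diff field_simps power2_eq_square)
        finally have "norm (u y) \<le> g + (norm (u y))\<^sup>2 / g"
          using norm_ge_zero[of "u y"] by linarith
        then show ?thesis by (simp add: g_def powr_minus divide_inverse mult.commute)
      qed
      then have "?U \<le> l powr \<gamma> * (?V * l powr ?n) + l powr (- \<gamma>) * ball_energy l"
        using l1' by (intro integral_norm_u_le) auto
      also have "\<dots> \<le> l powr \<gamma> * (?V * l powr ?n) + l powr (- \<gamma>) * (CE * l powr (?n + 2 * \<gamma>))"
        using CE(2)[OF l1'(1)] by (intro add_left_mono mult_left_mono) auto
      also have "\<dots> = ?V * (l powr \<gamma> * l powr ?n) + CE * (l powr (- \<gamma>) * l powr (?n + 2 * \<gamma>))"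
        by (simp only: mult_ac)
      also have "l powr \<gamma> * l powr ?n = l powr (?n + \<gamma>)"
        by (subst add.commute) (rule powr_add[symmetric])
      also have "l powr (- \<gamma>) * l powr (?n + 2 * \<gamma>) = l powr (?n + \<gamma>)"
        unfolding powr_add[symmetric] by (rule arg_cong[of _ _ "\<lambda>e. l powr e"]) simp
      also have "?V * l powr (?n + \<gamma>) + CE * l powr (?n + \<gamma>) = (?V + CE) * l powr (?n + \<gamma>)"
        by (rule distrib_right[symmetric])
      finally show ?thesis .
    qed
    have XU1: "l powr (2 * \<gamma> + \<theta>) * ?U \<le> s0 * ?V * L"
    proof -
      have "l powr (2 * \<gamma> + \<theta>) * ?U \<le> l powr (2 * \<gamma> + \<theta>) * (s * (?V * l powr ?n))"
        using U1 by (intro mult_left_mono) auto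
      also have "\<dots> = s0 * ?V * l powr (2 * \<gamma> + \<theta> + (\<delta> + ?n))" by (simp add: s_def powr_add)
      also have "2 * \<gamma> + \<theta> + (\<delta> + ?n) = ?n + 1 + 2 * \<gamma> - \<theta>" by (simp add: \<theta>_def field_simps)
      finally show ?thesis by (simp add: L_def)
    qed
    have XU2: "l * ?U \<le> (?V + CE) * L'"
    proof -
      have "l * ?U \<le> l powr 1 * ((?V + CE) * l powr (?n + \<gamma>))" using U2 l1' by simp
      also have "\<dots> = (?V + CE) * l powr (1 + (?n + \<gamma>))" unfolding powr_add[of l 1] by simp
      also have "1 + (?n + \<gamma>) = ?n + 1 + \<gamma>" by simp
      finally show ?thesis by (simp only: L'_def)
    qed
    have L: "0 \<le> L" "0 \<le> a * L'" using a by (simp_all add: L_def L'_def)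
    have c0: "0 \<le> (4 + C) * (s0 * CE2)" "0 \<le> 2 * C * (s0 * ?V)" "0 \<le> 2 * C * (?V + CE)"
      using C s0 CE by (simp_all add: CE2_def)
    have "4 * s * ball_energy l + C * s\<^sup>2 * ball_energy (2 * l) / s + 2 * ?X * ?U
       = 4 * (s * ball_energy l) + C * (s * ball_energy (2 * l)) + 2 * C * (l powr (2 * \<gamma> + \<theta>) * ?U) + 2 * C * (a * (l * ?U))"
      using s by (simp add: power2_eq_square algebra_simps)
    also have "\<dots> \<le> 4 * (s0 * CE2 * L) + C * (s0 * CE2 * L) + 2 * C * (s0 * ?V * L) + 2 * C * (a * ((?V + CE) * L'))"
    proof (intro add_mono)
      show "4 * (s * ball_energy l) \<le> 4 * (s0 * CE2 * L)"
      proof -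
        have "s * ball_energy l \<le> s * ball_energy (2 * l)" using E1 s by (intro mult_left_mono) auto
        with sE show ?thesis by linarith
      qed
      show "C * (s * ball_energy (2 * l)) \<le> C * (s0 * CE2 * L)" using sE C by (rule mult_left_mono)
      show "2 * C * (l powr (2 * \<gamma> + \<theta>) * ?U) \<le> 2 * C * (s0 * ?V * L)"
        using XU1 C by (intro mult_left_mono) auto
      show "2 * C * (a * (l * ?U)) \<le> 2 * C * (a * ((?V + CE) * L'))"
        using XU2 C a by (intro mult_left_mono) auto
    qed
    also have "\<dots> = (4 + C) * (s0 * CE2) * L + 2 * C * (s0 * ?V) * L + 2 * C * (?V + CE) * (a * L')"
      by (simp add: algebra_simps)
    also have "\<dots> \<le> D * (L + a * L')"
    proof -
      have "0 \<le> (4 + C) * (s0 * CE2) * (a * L')" "0 \<le> 2 * C * (s0 * ?V) * (a * L')" "0 \<le> 2 * C * (?V + CE) * L"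
        by (rule mult_nonneg_nonneg[OF c0(1) L(2)] mult_nonneg_nonneg[OF c0(2) L(2)] mult_nonneg_nonneg[OF c0(3) L(1)])+
      then show ?thesis unfolding D_def distrib_right distrib_left by linarith
    qed
    finally have "\<bar>energy_flux l\<bar> \<le> l * (D * (L + a * L'))"
      using order_trans[OF flux mult_left_mono] l1' by simp
    also have "\<dots> = D * (l powr 1 * L + a * (l powr 1 * L'))" using l1' by (simp add: algebra_simps)
    also have "l powr 1 * L = l powr (?n + 2) * l powr (2 * \<gamma> - \<theta>)"
    proof -
      have "1 + (?n + 1 + 2 * \<gamma> - \<theta>) = (?n + 2) + (2 * \<gamma> - \<theta>)" by simp
      then show ?thesis unfolding L_def by (simp only: powr_add[symmetric])
    qed
    also have "l powr 1 * L' = l powr (?n + 2) * l powr \<gamma>"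
    proof -
      have "1 + (?n + 1 + \<gamma>) = (?n + 2) + \<gamma>" by simp
      then show ?thesis unfolding L'_def by (simp only: powr_add[symmetric])
    qed
    finally show ?thesis by (simp add: algebra_simps)
  qed
  then show ?thesis using l1 unfolding \<theta>_def a_def by blast
qed

text \<open>The linear contribution \<open>l powr \<gamma>\<close> fits below
  \<open>l powr (2 * \<gamma> - 4 * \<eta>)\<close> for large \<open>l\<close> only if
  \<open>4 * \<eta> \<le> \<gamma>\<close>. Whenever linear pressure can occur, \<gamma> must
  therefore have a positive lower bound.\<close>

lemma rescaled_energy_rate:
  assumes n: "2 \<le> CARD('n)" and pressure: "pressure_representation \<kappa> \<alpha> \<delta> u q"
    and \<delta>: "0 < \<delta>" "\<delta> < 1" and \<gamma>: "0 \<le> \<gamma>" "\<gamma> \<le> \<delta>"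
    and Cs: "0 < Cs" "\<And>r y. 1 \<le> r \<Longrightarrow> norm y \<le> r \<Longrightarrow> norm (u y) \<le> Cs * r powr \<delta>"
    and \<eta>: "4 * \<eta> \<le> (1 - \<delta>) / 2" "\<alpha> > -1/2 \<and> \<delta> < 1/2 \<or> 4 * \<eta> \<le> \<gamma>"
    and P: "\<exists>C l0. \<forall>r\<ge>l0. ball_energy r \<le> C * r powr (real CARD('n) + 2 * \<gamma>)"
  shows "\<exists>C l0. \<forall>l\<ge>l0. \<bar>- 4 * (1 + \<alpha>) * l powr (2 * \<alpha> - real CARD('n) - 3) * energy_flux l\<bar>
       \<le> C * l powr (2 * (\<alpha> + \<gamma>) - 1 - 4 * \<eta>)"
proof -
  let ?n = "real CARD('n)"
  let ?a = "of_bool (\<not> (\<alpha> > -1/2 \<and> \<delta> < 1/2)) :: real"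
  from P obtain C0 r0 where "\<And>r. r0 \<le> r \<Longrightarrow> ball_energy r \<le> C0 * r powr (?n + 2 * \<gamma>)" by blast
  from flux_rate[OF n pressure \<delta> \<gamma> Cs this] obtain C l0 where l0: "1 \<le> l0"
    and C: "\<And>l. l0 \<le> l \<Longrightarrow> \<bar>energy_flux l\<bar> \<le> C * l powr (?n + 2) * (l powr (2 * \<gamma> - (1 - \<delta>) / 2) + ?a * l powr \<gamma>)"
    by blast
  have "\<bar>- 4 * (1 + \<alpha>) * l powr (2 * \<alpha> - ?n - 3) * energy_flux l\<bar> \<le> 8 * (1 + \<alpha>) * \<bar>C\<bar> * l powr (2 * (\<alpha> + \<gamma>) - 1 - 4 * \<eta>)"
    if l: "l0 \<le> l" for l
  proof -
    have l1: "1 \<le> l" using l l0 by simp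
    have le: "l powr (2 * \<gamma> - (1 - \<delta>) / 2) + ?a * l powr \<gamma> \<le> 2 * l powr (2 * \<gamma> - 4 * \<eta>)"
    proof -
      have "l powr (2 * \<gamma> - (1 - \<delta>) / 2) \<le> l powr (2 * \<gamma> - 4 * \<eta>)"
        using l1 \<eta> by (intro powr_mono) auto
      moreover have "?a * l powr \<gamma> \<le> l powr (2 * \<gamma> - 4 * \<eta>)"
      proof (cases "\<alpha> > -1/2 \<and> \<delta> < 1/2")
        case False
        then have "l powr \<gamma> \<le> l powr (2 * \<gamma> - 4 * \<eta>)" using l1 \<eta>(2) by (intro powr_mono) auto
        then show ?thesis by simp
      qed simp
      ultimately show ?thesis by simp
    qed
    have "\<bar>energy_flux l\<bar> \<le> C * l powr (?n + 2) * (l powr (2 * \<gamma> - (1 - \<delta>) / 2) + ?a * l powr \<gamma>)"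
      by (rule C[OF l])
    also have "\<dots> \<le> \<bar>C\<bar> * l powr (?n + 2) * (2 * l powr (2 * \<gamma> - 4 * \<eta>))"
      using le by (intro mult_mono) auto
    finally have f: "\<bar>energy_flux l\<bar> \<le> \<bar>C\<bar> * l powr (?n + 2) * (2 * l powr (2 * \<gamma> - 4 * \<eta>))" .
    have "\<bar>- 4 * (1 + \<alpha>) * l powr (2 * \<alpha> - ?n - 3) * energy_flux l\<bar> = 4 * (1 + \<alpha>) * l powr (2 * \<alpha> - ?n - 3) * \<bar>energy_flux l\<bar>"
      using \<alpha>_gt by (simp add: abs_mult)
    also have "\<dots> \<le> 4 * (1 + \<alpha>) * l powr (2 * \<alpha> - ?n - 3) * (\<bar>C\<bar> * l powr (?n + 2) * (2 * l powr (2 * \<gamma> - 4 * \<eta>)))"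
      using f \<alpha>_gt by (intro mult_left_mono) auto
    also have "\<dots> = 8 * (1 + \<alpha>) * \<bar>C\<bar> * (l powr (2 * \<alpha> - ?n - 3) * l powr (?n + 2) * l powr (2 * \<gamma> - 4 * \<eta>))"
      by (simp add: mult_ac)
    also have "l powr (2 * \<alpha> - ?n - 3) * l powr (?n + 2) * l powr (2 * \<gamma> - 4 * \<eta>) = l powr (2 * (\<alpha> + \<gamma>) - 1 - 4 * \<eta>)"
    proof -
      have "(2 * \<alpha> - ?n - 3) + (?n + 2) + (2 * \<gamma> - 4 * \<eta>) = 2 * (\<alpha> + \<gamma>) - 1 - 4 * \<eta>" by simp
      then show ?thesis by (simp only: powr_add[symmetric])
    qed
    finally show ?thesis .
  qed
  then show ?thesis by blast
qed

text \<open>The shell between radii \<open>l / 2\<close> and \<open>l\<close> suffices: it avoids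
  the ball of radius \<open>R\<close> once \<open>l \<ge> 2 * R\<close>, \<open>|u|\<close> is at
  least \<open>c (l/2)^\<epsilon>\<close> on it, and it fills the fraction \<open>1 - 2^(-N)\<close>
  of the ball.\<close>

lemma ball_energy_lower:
  assumes c: "0 < c" and \<epsilon>: "0 \<le> \<epsilon>" and low: "\<And>y. R \<le> norm y \<Longrightarrow> c * norm y powr \<epsilon> \<le> norm (u y)"
  obtains c' L where "0 < c'" "\<And>l. L \<le> l \<Longrightarrow> c' * l powr (real CARD('n) + 2 * \<epsilon>) \<le> ball_energy l"
proof -
  let ?n = "real CARD('n)" and ?V = "unit_ball_vol (real CARD('n))"
  have V: "0 < ?V" by simp
  define c' where "c' = c\<^sup>2 * (1/2) powr (2 * \<epsilon>) * (?V * (1 - (1/2) powr ?n))"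
  have half: "(1/2::real) powr ?n < 1" by (simp add: powr_realpow power_less_one_iff)
  have "c' * l powr (?n + 2 * \<epsilon>) \<le> ball_energy l" if l: "max 1 (2 * R) \<le> l" for l
  proof -
    have l1: "1 \<le> l" "R \<le> l / 2" using l by auto
    let ?S = "cball (0::real^'n) l - cball 0 (l / 2)"
    let ?k = "c\<^sup>2 * (l / 2) powr (2 * \<epsilon>)"
    have i: "integrable lborel (\<lambda>y::real^'n. indicator ?S y *\<^sub>R ?k)"
    proof -
      have "emeasure lborel ?S \<le> emeasure lborel (cball (0::real^'n) l)" by (intro emeasure_mono) auto
      also have "\<dots> < \<infinity>" using emeasure_bounded_finite[OF bounded_cball] by simp
      finally show ?thesis by simp
    qed
    have "measure lborel ?S * ?k = (LINT y|lborel. indicator ?S y *\<^sub>R ?k)" by simp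
    also have "\<dots> \<le> ball_energy l"
      unfolding ball_energy_def set_lebesgue_integral_def
    proof (intro integral_mono i ball_energy_integrable[unfolded set_integrable_def])
      fix y :: "real^'n"
      show "indicator ?S y *\<^sub>R ?k \<le> indicator (cball 0 l) y *\<^sub>R (norm (u y))\<^sup>2"
      proof (cases "y \<in> ?S")
        case True
        then have y: "l / 2 < norm y" by simp
        have "c * (l / 2) powr \<epsilon> \<le> c * norm y powr \<epsilon>" using y c \<epsilon> l1 by (intro mult_left_mono powr_mono2) auto
        also have "\<dots> \<le> norm (u y)" using y l1 by (intro low) auto
        finally have "(c * (l / 2) powr \<epsilon>)\<^sup>2 \<le> (norm (u y))\<^sup>2" using c by (intro power_mono) auto
        moreover have "(c * (l / 2) powr \<epsilon>)\<^sup>2 = ?k"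
          unfolding power_mult_distrib power2_eq_square[of "(l / 2) powr \<epsilon>"] powr_add[symmetric] by simp
        ultimately show ?thesis using True by simp
      qed (auto simp: indicator_def)
    qed
    finally have le: "measure lborel ?S * ?k \<le> ball_energy l" .
    have meas: "measure lborel ?S = ?V * (1 - (1/2) powr ?n) * l powr ?n"
    proof -
      have "measure lborel ?S = measure lborel (cball (0::real^'n) l) - measure lborel (cball (0::real^'n) (l / 2))"
        using l1 emeasure_bounded_finite[OF bounded_cball[of "0::real^'n" l]] by (intro measure_Diff) auto
      also have "\<dots> = ?V * l powr ?n - ?V * (l / 2) powr ?n"
        using l1 content_cball[of l "0::real^'n"] content_cball[of "l / 2" "0::real^'n"] by (simp add: powr_realpow)
      also have "(l / 2) powr ?n = (1/2) powr ?n * l powr ?n"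
        using l1 powr_mult[of "1/2" l ?n] by simp
      finally show ?thesis by (simp add: algebra_simps)
    qed
    have half_l: "(l / 2) powr (2 * \<epsilon>) = (1/2) powr (2 * \<epsilon>) * l powr (2 * \<epsilon>)"
      using l1 powr_mult[of "1/2" l "2 * \<epsilon>"] by simp
    have "c' * l powr (?n + 2 * \<epsilon>) = measure lborel ?S * ?k"
      unfolding meas half_l c'_def powr_add by (simp only: mult_ac)
    with le show ?thesis by simp
  qed
  moreover have "0 < c'" using c V half by (simp add: c'_def)
  ultimately show thesis using that by blast
qed

lemma energy_dichotomy:
  assumes n: "2 \<le> CARD('n)" and pressure: "pressure_representation \<kappa> \<alpha> \<delta> u q"
    and \<delta>: "0 < \<delta>" "\<delta> < 1"
    and growth: "\<And>y. R0 \<le> norm y \<Longrightarrow> norm (u y) \<le> Cu * norm y powr \<delta>"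
    and \<epsilon>: "0 \<le> \<epsilon>" "\<epsilon> < \<delta>" "\<alpha> > -1/2 \<and> \<delta> < 1/2 \<or> 0 < \<epsilon>"
    and low: "0 < c" "\<And>y. R \<le> norm y \<Longrightarrow> c * norm y powr \<epsilon> \<le> norm (u y)"
  shows "- \<delta> \<le> \<alpha> \<and> \<alpha> \<le> - \<epsilon> \<and>
     (\<exists>c' C l0. 0 < c' \<and> (\<forall>l\<ge>l0. c' * l powr (real CARD('n) - 2 * \<alpha>) \<le> ball_energy l \<and> ball_energy l \<le> C * l powr (real CARD('n) - 2 * \<alpha>)))"
proof -
  let ?n = "real CARD('n)" and ?V = "unit_ball_vol (real CARD('n))"
  obtain Cs where Cs: "0 < Cs" "\<And>r y. 1 \<le> r \<Longrightarrow> norm y \<le> r \<Longrightarrow> norm (u y) \<le> Cs * r powr \<delta>"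
    using u_sup_growth[OF _ growth] \<delta> by (metis less_imp_le)
  obtain c' L where low': "0 < c'" "\<And>l. L \<le> l \<Longrightarrow> c' * l powr (?n + 2 * \<epsilon>) \<le> ball_energy l"
    using ball_energy_lower[OF low(1) \<epsilon>(1) low(2)] by blast
  \<comment> \<open>A quarter of the smaller of the two gains. If \<epsilon> = 0, the linear
    pressure is absent by the disjunction in the hypotheses, and only the gap
    \<open>1 - \<delta>\<close> limits \<open>\<eta>\<close>.\<close>
  define \<eta> where "\<eta> = (if 0 < \<epsilon> then min ((1 - \<delta>) / 2) \<epsilon> else (1 - \<delta>) / 2) / 4"
  have \<eta>: "0 < \<eta>" "4 * \<eta> \<le> (1 - \<delta>) / 2" "\<alpha> > -1/2 \<and> \<delta> < 1/2 \<or> 4 * \<eta> \<le> \<epsilon>"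
    using \<delta> \<epsilon> by (auto simp: \<eta>_def min_def)
  show ?thesis
  proof (rule energy_scaling_dichotomy[where e = rescaled_energy and \<eta> = \<eta> and L = L and c = c' and
      B = "16 / 9 * 2 powr (?n - 2 * \<alpha>)" and
      e' = "\<lambda>l. - 4 * (1 + \<alpha>) * l powr (2 * \<alpha> - ?n - 3) * energy_flux l"])
    fix \<gamma> assume \<gamma>: "\<epsilon> \<le> \<gamma>" "\<gamma> \<le> \<delta>" and P: "\<exists>C l0. \<forall>l\<ge>l0. ball_energy l \<le> C * l powr (?n + 2 * \<gamma>)"
    show "\<exists>C l0. \<forall>l\<ge>l0. \<bar>- 4 * (1 + \<alpha>) * l powr (2 * \<alpha> - ?n - 3) * energy_flux l\<bar> \<le> C * l powr (2 * (\<alpha> + \<gamma>) - 1 - 4 * \<eta>)"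
      by (rule rescaled_energy_rate[OF n pressure \<delta> _ \<gamma>(2) Cs \<eta>(2) _ P]) (use \<gamma> \<epsilon> \<eta>(3) in auto)
  next
    show "\<exists>C l0. \<forall>l\<ge>l0. ball_energy l \<le> C * l powr (?n + 2 * \<delta>)"
    proof (intro exI allI impI)
      fix l :: real assume l: "1 \<le> l"
      have "ball_energy l \<le> (LINT y|lborel. indicator (cball (0::real^'n) l) y *\<^sub>R (Cs * l powr \<delta>)\<^sup>2)"
        unfolding ball_energy_def set_lebesgue_integral_def
      proof (intro integral_mono ball_energy_integrable[unfolded set_integrable_def])
        show "integrable lborel (\<lambda>y::real^'n. indicator (cball 0 l) y *\<^sub>R (Cs * l powr \<delta>)\<^sup>2)"
          by (rule borel_integrable_compact) auto
        show "indicator (cball 0 l) y *\<^sub>R (norm (u y))\<^sup>2 \<le> indicator (cball 0 l) y *\<^sub>R (Cs * l powr \<delta>)\<^sup>2" for y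
          using Cs(2)[OF l, of y] by (auto simp: indicator_def intro: power_mono)
      qed
      also have "\<dots> = measure lborel (cball (0::real^'n) l) * (Cs * l powr \<delta>)\<^sup>2" by simp
      also have "measure lborel (cball (0::real^'n) l) = ?V * l powr ?n"
        using content_cball[of l "0::real^'n"] l by (simp add: powr_realpow)
      also have "?V * l powr ?n * (Cs * l powr \<delta>)\<^sup>2 = ?V * Cs\<^sup>2 * (l powr ?n * (l powr \<delta> * l powr \<delta>))"
        by (simp add: power2_eq_square)
      also have "l powr ?n * (l powr \<delta> * l powr \<delta>) = l powr (?n + 2 * \<delta>)"
        by (simp add: powr_add[symmetric])
      finally show "ball_energy l \<le> ?V * Cs\<^sup>2 * l powr (?n + 2 * \<delta>)" .
    qed
  qed (use \<eta> \<epsilon> low' rescaled_energy_nonneg rescaled_energy_le ball_energy_le rescaled_energy_deriv in auto)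
qed

end


section \<open>Asymptotic notation and the two cases of the theorem\<close>

lemma bigo_at_infinityD:
  fixes f :: "'a::real_normed_vector \<Rightarrow> real"
  assumes "(\<lambda>y. norm (g y)) \<in> O[at_infinity](f)" "\<And>y. 0 \<le> f y"
  obtains C R where "\<And>y. R \<le> norm y \<Longrightarrow> norm (g y) \<le> C * f y"
proof -
  from assms(1) obtain C where "\<forall>\<^sub>F y in at_infinity. norm (norm (g y)) \<le> C * norm (f y)"
    by (auto elim: landau_o.bigE)
  then show thesis using that assms(2) by (auto simp: eventually_at_infinity)
qed

lemma bigomega_at_infinityD:
  fixes f :: "'a::real_normed_vector \<Rightarrow> real"
  assumes "(\<lambda>y. norm (g y)) \<in> \<Omega>[at_infinity](f)" "\<And>y. 0 \<le> f y"
  obtains c R where "0 < c" "\<And>y. R \<le> norm y \<Longrightarrow> c * f y \<le> norm (g y)"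
proof -
  from assms(1) obtain c where "0 < c" "\<forall>\<^sub>F y in at_infinity. norm (norm (g y)) \<ge> c * norm (f y)"
    by (auto elim: landau_omega.bigE)
  then show thesis using that assms(2) by (auto simp: eventually_at_infinity)
qed

theorem theorem1p1:
  fixes u :: "real^'n \<Rightarrow> real^'n" and q :: "real^'n \<Rightarrow> real"
    and v :: "real \<Rightarrow> real^'n \<Rightarrow> real^'n" and p :: "real \<Rightarrow> real^'n \<Rightarrow> real"
    and \<alpha> \<delta> \<kappa> :: real
  assumes dim: "2 \<le> CARD('n)"
    and \<kappa>: "\<kappa> \<in> kernel_constants CARD('n)"
    and \<alpha>: "-1 < \<alpha>" and \<delta>: "0 < \<delta>" "\<delta> < 1"
    and C3: "Ck 3 u"
    and self_similar: "locally_self_similar \<kappa> \<alpha> u q v p"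
    and pressure: "pressure_representation \<kappa> \<alpha> \<delta> u q"
    and growth: "(\<lambda>y. norm (u y)) \<in> O[at_infinity](\<lambda>y. norm y powr \<delta>)"
  shows "(\<forall>\<epsilon>0. 0 < \<epsilon>0 \<and> \<epsilon>0 < \<delta> \<and>
             (\<lambda>y. norm (u y)) \<in> \<Omega>[at_infinity](\<lambda>y. norm y powr \<epsilon>0) \<longrightarrow>
             - \<delta> \<le> \<alpha> \<and> \<alpha> \<le> - \<epsilon>0 \<and>
             (\<lambda>L. LINT y:cball 0 L|lborel. (norm (u y))\<^sup>2)
               \<in> \<Theta>[at_top](\<lambda>L. L powr (real CARD('n) - 2 * \<alpha>)))
       \<and> (\<delta> < 1/2 \<and> -1/2 < \<alpha> \<and>
             (\<lambda>y. norm (u y)) \<in> \<Omega>[at_infinity](\<lambda>y. 1) \<longrightarrow>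
             - \<delta> \<le> \<alpha> \<and> \<alpha> \<le> 0 \<and>
             (\<lambda>L. LINT y:cball 0 L|lborel. (norm (u y))\<^sup>2)
               \<in> \<Theta>[at_top](\<lambda>L. L powr (real CARD('n) - 2 * \<alpha>)))"
proof -
  let ?E = "\<lambda>L. LINT y:cball 0 L|lborel. (norm (u y))\<^sup>2"
  have "Ck (Suc 2) u" using C3 by (simp only: numeral_3_eq_3 numeral_2_eq_2)
  note C = this Ck_Suc_differentiable[OF this]
  obtain gq where gq: "\<And>y. GDERIV q y :> gq y"
    "\<And>y. \<alpha> *\<^sub>R u y + frechet_derivative u (at y) y
        + (1 + \<alpha>) *\<^sub>R (frechet_derivative u (at y) (u y) + gq y) = 0"
    "\<And>y. divergence u y = 0"
    using profile_equations[OF self_similar \<alpha> C(2)] by blast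
  interpret euler_profile u q gq \<alpha>
    using C(2) gq \<alpha> Ck_continuous[OF Ck_Suc_partial[OF C(1)]] by unfold_locales auto
  obtain Cu R0 where Cu: "\<And>y. R0 \<le> norm y \<Longrightarrow> norm (u y) \<le> Cu * norm y powr \<delta>"
    by (rule bigo_at_infinityD[OF growth powr_ge_zero]) blast
  \<comment> \<open>Both parts at once: \<epsilon> is the given positive exponent in part (1), and 0
    in part (2), where the side conditions exclude linear pressure.\<close>
  have concl: "- \<delta> \<le> \<alpha> \<and> \<alpha> \<le> - \<epsilon> \<and> ?E \<in> \<Theta>[at_top](\<lambda>L. L powr (real CARD('n) - 2 * \<alpha>))"
    if \<epsilon>: "0 \<le> \<epsilon>" "\<epsilon> < \<delta>" "\<alpha> > -1/2 \<and> \<delta> < 1/2 \<or> 0 < \<epsilon>"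
      and c: "0 < c" and low: "\<And>y. R \<le> norm y \<Longrightarrow> c * norm y powr \<epsilon> \<le> norm (u y)" for \<epsilon> c R
  proof -
    from energy_dichotomy[OF dim pressure \<delta> Cu \<epsilon> c low] obtain c' C l0
      where \<alpha>': "- \<delta> \<le> \<alpha>" "\<alpha> \<le> - \<epsilon>" and c': "0 < c'"
        and E: "\<And>l. l0 \<le> l \<Longrightarrow> c' * l powr (real CARD('n) - 2 * \<alpha>) \<le> ?E l \<and> ?E l \<le> C * l powr (real CARD('n) - 2 * \<alpha>)"
      unfolding ball_energy_def by blast
    have nonneg: "0 \<le> ?E l" for l using ball_energy_nonneg by (simp add: ball_energy_def)
    have "?E \<in> O[at_top](\<lambda>L. L powr (real CARD('n) - 2 * \<alpha>))"
      by (rule bigoI[of _ C]) (use E nonneg in \<open>auto intro!: eventually_at_top_linorderI[of l0]\<close>)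
    moreover have "?E \<in> \<Omega>[at_top](\<lambda>L. L powr (real CARD('n) - 2 * \<alpha>))"
      by (rule landau_omega.bigI[OF c']) (use E nonneg in \<open>auto intro!: eventually_at_top_linorderI[of l0]\<close>)
    ultimately show ?thesis using \<alpha>' by (auto intro: bigthetaI)
  qed
  show ?thesis
  proof (intro conjI allI impI; elim conjE)
    fix \<epsilon>0 assume \<epsilon>0: "0 < \<epsilon>0" "\<epsilon>0 < \<delta>"
      and lower: "(\<lambda>y. norm (u y)) \<in> \<Omega>[at_infinity](\<lambda>y. norm y powr \<epsilon>0)"
    obtain c R where cR: "0 < c" "\<And>y. R \<le> norm y \<Longrightarrow> c * norm y powr \<epsilon>0 \<le> norm (u y)"
      by (rule bigomega_at_infinityD[OF lower powr_ge_zero]) blast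
    have "- \<delta> \<le> \<alpha> \<and> \<alpha> \<le> - \<epsilon>0 \<and> ?E \<in> \<Theta>[at_top](\<lambda>L. L powr (real CARD('n) - 2 * \<alpha>))"
      by (rule concl[OF _ _ _ cR]) (use \<epsilon>0 in auto)
    then show "- \<delta> \<le> \<alpha>" "\<alpha> \<le> - \<epsilon>0" "?E \<in> \<Theta>[at_top](\<lambda>L. L powr (real CARD('n) - 2 * \<alpha>))"
      by blast+
  next
    assume small: "\<delta> < 1/2" "-1/2 < \<alpha>" and lower: "(\<lambda>y. norm (u y)) \<in> \<Omega>[at_infinity](\<lambda>y. 1)"
    obtain c R where cR: "0 < c" "\<And>y. R \<le> norm y \<Longrightarrow> c * 1 \<le> norm (u y)"
      by (rule bigomega_at_infinityD[OF lower zero_le_one]) blast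
    \<comment> \<open>\<open>norm y powr 0\<close> is 1 except at \<open>y = 0\<close>, where it is
      0 by convention; the inequality holds in either case.\<close>
    have low0: "c * norm y powr 0 \<le> norm (u y)" if "R \<le> norm y" for y
      using cR(2)[OF that] cR(1) by simp
    have "- \<delta> \<le> \<alpha> \<and> \<alpha> \<le> - 0 \<and> ?E \<in> \<Theta>[at_top](\<lambda>L. L powr (real CARD('n) - 2 * \<alpha>))"
      by (rule concl[OF _ _ _ cR(1) low0]) (use small \<delta> in auto)
    then show "- \<delta> \<le> \<alpha>" "\<alpha> \<le> 0" "?E \<in> \<Theta>[at_top](\<lambda>L. L powr (real CARD('n) - 2 * \<alpha>))"
      by auto
  qed
qed

end
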